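(* For every integer $n$ with $2\le n\le 5$ there exist a lattice $L$ of signature $(2,n)$ and a subgroup $\Gamma<\mathrm{O}^+(L)$ of finite index such that the orthogonal modular variety $\mathcal{F}_L(\Gamma)=\Gamma\backslash\mathcal{D}_L$ has a noncanonical singularity, namely a cyclic quotient singularity of type $\frac{1}{6}(1,\ldots,1)$ (with $n$ ones). In particular, for $n=5$ there is an orthogonal modular variety of dimension $5$ with a noncanonical cyclic quotient singularity of type $\frac16(1,1,1,1,1)$.
   Context: $L$ is an integral lattice with a nondegenerate symmetric bilinear form $(\cdot,\cdot)$ of signature $(2,n)$. $\mathcal{D}_L$ is a connected component of $\{[w]\in\mathbb{P}(L\otimes\mathbb{C})\mid (w,w)=0,\ (w,\overline{w})>0\}$, and $\mathrm{O}^+(L)$ is the subgroup of $\mathrm{O}(L)$ preserving $\mathcal{D}_L$. A cyclic quotient singularity of type $\frac1m(a_1,\ldots,a_n)$ is a singularity locally isomorphic to $\mathbb{C}^n/\mu_m$ at the origin, where a generator of the cyclic group $\mu_m$ acts by $\mathrm{diag}(\zeta_m^{a_1},\ldots,\zeta_m^{a_n})$, $\zeta_m=e^{2\pi i/m}$. *)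

theory Defs
  imports "HOL-Analysis.Analysis" "HOL-Algebra.Coset"
begin

subsection \<open>Complex spaces as spaces with a sheaf of functions\<close>

text \<open>
  A (reduced) complex space is represented by its topology together with its sheaf of holomorphic
  functions, the sheaf being given through its stalks: \<open>cs_hol X f x\<close> says that the germ of \<open>f\<close> at
  \<open>x\<close> is holomorphic.  A section over an open \<open>U\<close> is a function \<open>f\<close> with \<open>cs_hol X f x\<close> for
  all \<open>x \<in> U\<close>.
\<close>

record 'a cspace =
  cs_top :: "'a topology"
  cs_hol :: "('a \<Rightarrow> complex) \<Rightarrow> 'a \<Rightarrow> bool"

abbreviation cs_points :: "'a cspace \<Rightarrow> 'a set" where
  "cs_points X \<equiv> topspace (cs_top X)"

definition complex_differentiable_at :: "(complex^'n \<Rightarrow> complex) \<Rightarrow> complex^'n \<Rightarrow> bool" where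
  "complex_differentiable_at f z \<longleftrightarrow>
     (\<exists>D. (f has_derivative D) (at z) \<and> (\<forall>c v. D (c *s v) = c * D v))"

definition affine_cs :: "(complex^'n) cspace" where
  "affine_cs = \<lparr> cs_top = euclidean,
     cs_hol = (\<lambda>f z. \<exists>U. open U \<and> z \<in> U \<and> (\<forall>y\<in>U. complex_differentiable_at f y)) \<rparr>"

text \<open>Reduced subspace structure: holomorphic functions are the local restrictions of holomorphic
  functions of the ambient space.  This covers open as well as locally closed analytic subspaces.\<close>

definition cs_sub :: "'a cspace \<Rightarrow> 'a set \<Rightarrow> 'a cspace" where
  "cs_sub X S = \<lparr> cs_top = subtopology (cs_top X) S,
     cs_hol = (\<lambda>f x. \<exists>V F. openin (cs_top X) V \<and> x \<in> V \<and> (\<forall>y\<in>V. cs_hol X F y) \<and>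
                           (\<forall>y\<in>V \<inter> S. F y = f y)) \<rparr>"

text \<open>Quotient along the map \<open>p\<close>: the quotient topology on \<open>p ` X\<close>, and the functions whose
  pull-back to \<open>X\<close> is holomorphic.  If \<open>p\<close> is the orbit map of a group action, these are
  the invariant holomorphic functions.\<close>

definition quotient_top :: "'a topology \<Rightarrow> ('a \<Rightarrow> 'b) \<Rightarrow> 'b topology" where
  "quotient_top T p =
     topology (\<lambda>U. U \<subseteq> p ` topspace T \<and> openin T {x \<in> topspace T. p x \<in> U})"

definition cs_quotient :: "'a cspace \<Rightarrow> ('a \<Rightarrow> 'b) \<Rightarrow> 'b cspace" where
  "cs_quotient X p = \<lparr> cs_top = quotient_top (cs_top X) p,
     cs_hol = (\<lambda>f y. \<exists>V. openin (quotient_top (cs_top X) p) V \<and> y \<in> V \<and>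
                         (\<forall>x\<in>cs_points X. p x \<in> V \<longrightarrow> cs_hol X (f \<circ> p) x)) \<rparr>"

definition cs_morphism :: "'a cspace \<Rightarrow> 'b cspace \<Rightarrow> ('a \<Rightarrow> 'b) \<Rightarrow> bool" where
  "cs_morphism X Y f \<longleftrightarrow> continuous_map (cs_top X) (cs_top Y) f \<and>
     (\<forall>h. \<forall>x\<in>cs_points X. cs_hol Y h (f x) \<longrightarrow> cs_hol X (h \<circ> f) x)"

definition cs_iso :: "'a cspace \<Rightarrow> 'b cspace \<Rightarrow> ('a \<Rightarrow> 'b) \<Rightarrow> bool" where
  "cs_iso X Y f \<longleftrightarrow> homeomorphic_map (cs_top X) (cs_top Y) f \<and>
     (\<forall>h. \<forall>x\<in>cs_points X. cs_hol Y h (f x) \<longleftrightarrow> cs_hol X (h \<circ> f) x)"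

definition locally_isomorphic_at :: "'a cspace \<Rightarrow> 'a \<Rightarrow> 'b cspace \<Rightarrow> 'b \<Rightarrow> bool" where
  "locally_isomorphic_at X x Y y \<longleftrightarrow>
     (\<exists>U V f. openin (cs_top X) U \<and> x \<in> U \<and> openin (cs_top Y) V \<and> y \<in> V \<and>
              cs_iso (cs_sub X U) (cs_sub Y V) f \<and> f x = y)"

subsection \<open>Charts, manifolds and pluricanonical forms\<close>

definition charts :: "'a cspace \<Rightarrow> ('a set \<times> ('a \<Rightarrow> complex^'n)) set" where
  "charts X = {(U, \<phi>). openin (cs_top X) U \<and>
     (\<exists>V. open V \<and> cs_iso (cs_sub X U) (cs_sub affine_cs V) \<phi>)}"

text \<open>The points where \<open>X\<close> is a complex manifold of dimension \<open>CARD('n)\<close>.\<close>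

definition regular_locus :: "'n::finite itself \<Rightarrow> 'a cspace \<Rightarrow> 'a set" where
  "regular_locus _ X = (\<Union>(U, \<phi>)\<in>(charts X :: ('a set \<times> ('a \<Rightarrow> complex^'n)) set). U)"

text \<open>The second and third conditions say that \<open>cs_hol Y\<close> really depends on germs only and that
  holomorphy at a point is an open condition.\<close>

definition complex_manifold :: "'n::finite itself \<Rightarrow> 'a cspace \<Rightarrow> bool" where
  "complex_manifold N Y \<longleftrightarrow>
     regular_locus N Y = cs_points Y \<and>
     (\<forall>f g U. openin (cs_top Y) U \<and> (\<forall>x\<in>U. f x = g x) \<longrightarrow>
        (\<forall>x\<in>U. cs_hol Y f x \<longleftrightarrow> cs_hol Y g x)) \<and>
     (\<forall>f. \<forall>x\<in>cs_points Y. cs_hol Y f x \<longrightarrow>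
        (\<exists>U. openin (cs_top Y) U \<and> x \<in> U \<and> (\<forall>y\<in>U. cs_hol Y f y))) \<and>
     Hausdorff_space (cs_top Y) \<and> second_countable (cs_top Y)"

definition jacobian_det :: "(complex^'n \<Rightarrow> complex^'n) \<Rightarrow> complex^'n \<Rightarrow> complex" where
  "jacobian_det F z = det (matrix (frechet_derivative F (at z)))"

text \<open>
  Sections of the \<open>r\<close>-th power of the canonical bundle of the regular locus of \<open>X\<close>.  Such a
  section \<open>s\<close> is given by its coefficient functions: on the domain of a chart \<open>(U, \<phi>)\<close> it is
  \<open>s (U, \<phi>) \<cdot> (d\<phi>\<^sub>1 \<and> \<dots> \<and> d\<phi>\<^sub>n)\<^sup>r\<close>.
\<close>

type_synonym ('a, 'n) form_coeffs = "'a set \<times> ('a \<Rightarrow> complex^'n) \<Rightarrow> 'a \<Rightarrow> complex"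

definition pluricanonical_form :: "'a cspace \<Rightarrow> nat \<Rightarrow> ('a, 'n::finite) form_coeffs \<Rightarrow> bool" where
  "pluricanonical_form X r s \<longleftrightarrow>
     (\<forall>(U, \<phi>)\<in>charts X. \<forall>x\<in>U. cs_hol X (s (U, \<phi>)) x) \<and>
     (\<forall>(U, \<phi>)\<in>charts X. \<forall>(V, \<psi>)\<in>charts X. \<forall>x\<in>U \<inter> V.
        s (U, \<phi>) x = s (V, \<psi>) x * jacobian_det (\<psi> \<circ> inv_into U \<phi>) (\<phi> x) ^ r)"

definition nowhere_vanishing :: "'a cspace \<Rightarrow> ('a, 'n::finite) form_coeffs \<Rightarrow> bool" where
  "nowhere_vanishing X s \<longleftrightarrow> (\<forall>(U, \<phi>)\<in>charts X. \<forall>x\<in>U. s (U, \<phi>) x \<noteq> 0)"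

subsection \<open>Canonical singularities\<close>

definition resolution :: "'n::finite itself \<Rightarrow> 'b cspace \<Rightarrow> ('b \<Rightarrow> 'a) \<Rightarrow> 'a cspace \<Rightarrow> bool" where
  "resolution N Y f X \<longleftrightarrow>
     complex_manifold N Y \<and> cs_morphism Y X f \<and> proper_map (cs_top Y) (cs_top X) f \<and>
     (let R = regular_locus N X; R' = {y \<in> cs_points Y. f y \<in> R}
      in cs_iso (cs_sub Y R') (cs_sub X R) f \<and> cs_top Y closure_of R' = cs_points Y)"

text \<open>\<open>t\<close> is a form on all of \<open>Y\<close> which over the regular locus of \<open>X\<close>, where \<open>f\<close> is an
  isomorphism, is the pull-back of \<open>s\<close>: there \<open>\<phi> \<circ> f\<close> is a chart of \<open>Y\<close> for every chart \<open>\<phi>\<close>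
  of \<open>X\<close>.\<close>

definition extends_pullback ::
    "'b cspace \<Rightarrow> ('b \<Rightarrow> 'a) \<Rightarrow> 'a cspace \<Rightarrow> nat \<Rightarrow> ('a, 'n::finite) form_coeffs \<Rightarrow>
     ('b, 'n) form_coeffs \<Rightarrow> bool" where
  "extends_pullback Y f X r s t \<longleftrightarrow>
     pluricanonical_form Y r t \<and>
     (\<forall>(U, \<phi>)\<in>charts X. \<forall>y\<in>cs_points Y. f y \<in> U \<longrightarrow>
        t ({y \<in> cs_points Y. f y \<in> U}, \<phi> \<circ> f) y = s (U, \<phi>) (f y))"

text \<open>
  Canonicity at \<open>x\<close> of a normal complex space \<open>X\<close> of dimension \<open>CARD('n)\<close> (Reid): near \<open>x\<close>,
  some \<open>r K\<^sub>X\<close> with \<open>r \<ge> 1\<close> is Cartier, and \<open>r K\<^sub>Y = f\<^sup>*(r K\<^sub>X) + \<Sum> a\<^sub>i E\<^sub>i\<close> with all \<open>a\<^sub>i \<ge> 0\<close> for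
  resolutions \<open>f\<close>.  By normality \<open>r K\<^sub>X\<close> is Cartier on \<open>W\<close> (after shrinking \<open>W\<close>) iff it has a
  nowhere vanishing section \<open>s\<close> over the regular locus, and \<open>\<Sum> a\<^sub>i E\<^sub>i\<close> is the divisor of \<open>f\<^sup>* s\<close>
  as a meromorphic section of \<open>r K\<^sub>Y\<close>; so effectivity says that \<open>f\<^sup>* s\<close> is holomorphic on \<open>Y\<close>.
  Resolutions of all open \<open>V \<subseteq> W\<close> are considered, as canonicity of \<open>W\<close> passes to \<open>V\<close>.
  A complex manifold with countable base has at most continuum many points, so that nothing is
  lost by taking the points of \<open>Y\<close> in the type \<open>nat \<Rightarrow> complex\<close>.
\<close>

definition canonical_at :: "'n::finite itself \<Rightarrow> 'a cspace \<Rightarrow> 'a \<Rightarrow> bool" where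
  "canonical_at N X x \<longleftrightarrow>
     (\<exists>W r. \<exists>s :: ('a, 'n) form_coeffs.
        openin (cs_top X) W \<and> x \<in> W \<and> r \<ge> 1 \<and>
        pluricanonical_form (cs_sub X W) r s \<and> nowhere_vanishing (cs_sub X W) s \<and>
        (\<forall>V. \<forall>Y :: (nat \<Rightarrow> complex) cspace. \<forall>f.
           openin (cs_top X) V \<and> V \<subseteq> W \<and> resolution N Y f (cs_sub X V) \<longrightarrow>
           (\<exists>t. extends_pullback Y f (cs_sub X V) r s t)))"

definition noncanonical_singularity :: "'n::finite itself \<Rightarrow> 'a cspace \<Rightarrow> 'a \<Rightarrow> bool" where
  "noncanonical_singularity N X x \<longleftrightarrow>
     x \<in> cs_points X \<and> x \<notin> regular_locus N X \<and> \<not> canonical_at N X x"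

subsection \<open>Cyclic quotient singularities\<close>

definition cyclic_orbit :: "nat \<Rightarrow> ('n \<Rightarrow> int) \<Rightarrow> complex^'n \<Rightarrow> (complex^'n) set" where
  "cyclic_orbit m a z =
     {\<chi> i. (exp (2 * of_real pi * \<i> / of_nat m) powi a i) ^ k * z $ i | k :: nat. True}"

definition cyclic_quotient :: "nat \<Rightarrow> ('n::finite \<Rightarrow> int) \<Rightarrow> (complex^'n) set cspace" where
  "cyclic_quotient m a = cs_quotient affine_cs (cyclic_orbit m a)"

definition cyclic_quotient_singularity ::
    "'a cspace \<Rightarrow> 'a \<Rightarrow> nat \<Rightarrow> ('n::finite \<Rightarrow> int) \<Rightarrow> bool" where
  "cyclic_quotient_singularity X x m a \<longleftrightarrow>
     locally_isomorphic_at X x (cyclic_quotient m a) (cyclic_orbit m a 0)"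

subsection \<open>Lattices and orthogonal modular varieties\<close>

text \<open>A lattice of rank \<open>CARD('m)\<close> is the group \<open>\<int>\<^sup>m\<close> with the bilinear form given by an integral
  Gram matrix \<open>G\<close>; \<open>lattice_form G\<close> is its bilinear extension to real or complex scalars.\<close>

definition lattice_form :: "int^'m^'m \<Rightarrow> ('a::comm_ring_1)^'m \<Rightarrow> 'a^'m \<Rightarrow> 'a" where
  "lattice_form G x y = (\<Sum>i\<in>UNIV. \<Sum>j\<in>UNIV. of_int (G $ i $ j) * x $ i * y $ j)"

definition integral_lattice :: "int^'m^'m \<Rightarrow> bool" where
  "integral_lattice G \<longleftrightarrow> transpose G = G \<and> det G \<noteq> 0"

definition has_signature :: "int^'m^'m \<Rightarrow> nat \<times> nat \<Rightarrow> bool" where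
  "has_signature G pq \<longleftrightarrow>
     (\<exists>b :: 'm \<Rightarrow> real^'m. inj b \<and> independent (range b) \<and>
        (\<forall>i j. i \<noteq> j \<longrightarrow> lattice_form G (b i) (b j) = 0) \<and>
        pq = (card {i. lattice_form G (b i) (b i) > 0}, card {i. lattice_form G (b i) (b i) < 0}))"

text \<open>A point of projective space is a line through the origin, as a subset of \<open>\<complex>\<^sup>m\<close>.\<close>

definition line_through :: "complex^'m \<Rightarrow> (complex^'m) set" where
  "line_through w = range (\<lambda>c. c *s w)"

definition projective_space :: "(complex^'m) set cspace" where
  "projective_space = cs_quotient (cs_sub affine_cs (- {0})) line_through"

definition period_space :: "int^'m^'m \<Rightarrow> (complex^'m) set set" where
  "period_space G = {line_through w | w. w \<noteq> 0 \<and> lattice_form G w w = 0 \<and>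
     Re (lattice_form G w (\<chi> i. cnj (w $ i))) > 0}"

text \<open>The two possible choices of the domain \<open>\<D>\<^sub>L\<close>.\<close>

definition period_domains :: "int^'m^'m \<Rightarrow> (complex^'m) set set set" where
  "period_domains G =
     connected_components_of (subtopology (cs_top projective_space) (period_space G))"

definition lattice_act :: "int^'m^'m \<Rightarrow> (complex^'m) set \<Rightarrow> (complex^'m) set" where
  "lattice_act g l = (\<lambda>w. (\<chi> i j. of_int (g $ i $ j)) *v w) ` l"

definition O_plus :: "int^'m^'m \<Rightarrow> (complex^'m) set set \<Rightarrow> (int^'m^'m) monoid" where
  "O_plus G D =
     \<lparr> carrier = {g. invertible g \<and> transpose g ** G ** g = G \<and> lattice_act g ` D = D},
       monoid.mult = (**), one = mat 1 \<rparr>"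

definition modular_variety ::
    "(complex^'m) set set \<Rightarrow> (int^'m^'m) set \<Rightarrow> (complex^'m) set set cspace" where
  "modular_variety D \<Gamma> =
     cs_quotient (cs_sub projective_space D) (\<lambda>l. (\<lambda>g. lattice_act g l) ` \<Gamma>)"

end

theory Submission
  imports Defs "HOL-Complex_Analysis.Complex_Analysis"
begin

no_notation fps_nth (infixl \<open>$\<close> 75)

text \<open>
  Take \<open>L = A\<^sub>2 \<oplus> \<langle>-1\<rangle>\<^sup>n\<close>.  The rotation of order 6 of \<open>A\<^sub>2\<close>, extended by the identity, fixes the
  point \<open>[w]\<close> of the period domain given by an eigenvector \<open>w\<close> in \<open>A\<^sub>2 \<otimes> \<complex>\<close>, and acts on the tangent
  space there by a primitive sixth root of unity.  An isometry that moves a point near \<open>[w]\<close> to a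
  point near \<open>[w]\<close> respects the decomposition of \<open>L\<close>, by discreteness of the lattice, and has
  entries \<open>0, \<plusminus>1\<close>; if it is moreover congruent modulo 3 to a power of the rotation, it equals that
  power.  So for the group \<open>\<Gamma>\<close> of all isometries with this congruence property the quotient looks
  like \<open>\<complex>\<^sup>n / \<mu>\<^sub>6\<close>, with scalar action, near the image of \<open>[w]\<close>.

  This quotient is resolved by the blow-up of the origin, with exceptional divisor \<open>u = 0\<close> where
  \<open>u = z\<^sub>1\<^sup>6\<close>, and there \<open>dz\<^sub>1 \<and> \<dots> \<and> dz\<^sub>n\<close> acquires the factor \<open>u\<close> to the power \<open>(n - 6) / 6\<close>.  For
  \<open>n \<le> 5\<close> this is a pole, so no power of it extends.
\<close>

text \<open>Six is the largest order of a rotation of a lattice of rank two, and the discrepancy n/6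
  - 1 of the exceptional divisor is negative exactly for n \<le> 5. Canonicity asserts that some
  neighbourhood, some power r and some generating form work, so in the refutation all three are
  arbitrary; one explicit resolution, taken over a small enough ball, is tested against them. The
  form lives only off the centre, so its coefficient S comes with no value or bound at the origin.
  It has to be kept away from zero along one axis by means of a second coordinate, and this is one
  of the places where n \<ge> 2 enters. The singularity theory uses nothing but a map from a ball
  whose fibres are \<mu>_6-orbits and which detects open sets and holomorphic functions; it is
  therefore proved for any space with such a map, and the modular variety only has to supply one.
  The plane A_2 tensor \<complex> has two conjugate eigenlines, one for each component of the period
  space; keeping the eigenvalue \<theta> as a variable lets one argument serve both.\<close>

section \<open>Holomorphic functions of several variables\<close>

abbreviation hol_at :: "(complex^'n \<Rightarrow> complex) \<Rightarrow> complex^'n \<Rightarrow> bool" where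
  "hol_at \<equiv> cs_hol affine_cs"

abbreviation cdiff :: "(complex^'n \<Rightarrow> complex) \<Rightarrow> complex^'n \<Rightarrow> bool" where
  "cdiff \<equiv> complex_differentiable_at"

lemma hol_at_def: "hol_at f z \<longleftrightarrow> (\<exists>U. open U \<and> z \<in> U \<and> (\<forall>y\<in>U. cdiff f y))"
  by (simp add: affine_cs_def)

lemma hol_atI: "open U \<Longrightarrow> z \<in> U \<Longrightarrow> (\<And>y. y \<in> U \<Longrightarrow> cdiff f y) \<Longrightarrow> hol_at f z"
  by (auto simp: hol_at_def)

lemma hol_at_imp_cdiff: "hol_at f z \<Longrightarrow> cdiff f z"
  by (auto simp: hol_at_def)

lemma cdiff_cong:
  assumes "open U" "z \<in> U" "\<And>y. y \<in> U \<Longrightarrow> f y = g y"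
  shows "cdiff f z \<longleftrightarrow> cdiff g z"
proof -
  have "(f has_derivative D) (at z) \<longleftrightarrow> (g has_derivative D) (at z)" for D
    using has_derivative_transform_within_open[OF _ assms(1,2)] assms(3) by metis
  then show ?thesis by (simp add: complex_differentiable_at_def)
qed

lemma hol_at_cong:
  assumes "open U" "z \<in> U" "\<And>y. y \<in> U \<Longrightarrow> f y = g y"
  shows "hol_at f z \<longleftrightarrow> hol_at g z"
proof -
  have *: "hol_at g z" if h: "hol_at f z" and eq: "\<And>y. y \<in> U \<Longrightarrow> f y = g y" for f g
  proof -
    obtain V where V: "open V" "z \<in> V" "\<And>y. y \<in> V \<Longrightarrow> cdiff f y"
      using h by (auto simp: hol_at_def)
    show ?thesis
    proof (rule hol_atI)
      show "open (U \<inter> V)" using V assms by auto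
      show "z \<in> U \<inter> V" using V assms by auto
      show "cdiff g y" if "y \<in> U \<inter> V" for y
        using V(3)[of y] cdiff_cong[of U y f g] assms(1) eq that by auto
    qed
  qed
  show ?thesis using * assms(3) by metis
qed

text \<open>A derivative that commutes with complex scalars is determined by its values on the
  standard basis. The gradient turns functions on a chart into vectors of \<complex>^n, to which a
  dimension count can be applied.\<close>

lemma cdiff_iff_gradient:
  fixes f :: "complex^'n::finite \<Rightarrow> complex"
  shows "cdiff f z \<longleftrightarrow> (\<exists>d. (f has_derivative (\<lambda>v. \<Sum>i\<in>UNIV. d $ i * v $ i)) (at z))"
    (is "?L \<longleftrightarrow> ?R")
proof
  assume ?L
  then obtain D where D: "(f has_derivative D) (at z)" "\<And>c v. D (c *s v) = c * D v"
    by (auto simp: complex_differentiable_at_def)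
  have lin: "linear D" using D(1) has_derivative_linear by blast
  define d :: "complex^'n" where "d = (\<chi> i. D (axis i 1))"
  have "D v = (\<Sum>i\<in>UNIV. d $ i * v $ i)" for v
  proof -
    have "v = (\<Sum>i\<in>UNIV. v $ i *s axis i 1)" by (simp add: basis_expansion)
    then have "D v = D (\<Sum>i\<in>UNIV. v $ i *s axis i 1)" by simp
    also have "\<dots> = (\<Sum>i\<in>UNIV. D (v $ i *s axis i 1))" by (rule linear_sum[OF lin])
    finally show ?thesis by (simp add: D(2) d_def mult.commute)
  qed
  then have "D = (\<lambda>v. \<Sum>i\<in>UNIV. d $ i * v $ i)" by auto
  then show ?R using D(1) by metis
next
  assume ?R
  then obtain d where "(f has_derivative (\<lambda>v. \<Sum>i\<in>UNIV. d $ i * v $ i)) (at z)" by auto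
  then show ?L unfolding complex_differentiable_at_def
    by (intro exI conjI) (auto simp: sum_distrib_left algebra_simps)
qed

lemma bounded_linear_axis: "bounded_linear (axis i :: complex \<Rightarrow> complex^'n::finite)"
  by (intro linear_conv_bounded_linear[THEN iffD1] linearI) (auto simp: axis_def vec_eq_iff)

lemma vec_expansion: "(x :: complex^'n::finite) = (\<Sum>i\<in>UNIV. axis i (x $ i))"
  by (simp add: vec_eq_iff axis_def)

lemma has_derivative_vec:
  fixes F :: "'b::real_normed_vector \<Rightarrow> complex^'n::finite"
  assumes "\<And>i. ((\<lambda>x. F x $ i) has_derivative (\<lambda>v. D v $ i)) (at z)"
  shows "(F has_derivative D) (at z)"
proof -
  have "((\<lambda>x. \<Sum>i\<in>UNIV. axis i (F x $ i)) has_derivative (\<lambda>v. \<Sum>i\<in>UNIV. axis i (D v $ i))) (at z)"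
    by (intro has_derivative_sum bounded_linear.has_derivative[OF bounded_linear_axis] assms)
  then show ?thesis by (simp flip: vec_expansion)
qed

lemma cdiff_compose:
  fixes F :: "complex^'m::finite \<Rightarrow> complex^'n::finite"
  assumes F: "\<And>i. cdiff (\<lambda>x. F x $ i) z" and h: "cdiff h (F z)"
  shows "cdiff (h \<circ> F) z"
proof -
  obtain D where D: "\<And>i. ((\<lambda>x. F x $ i) has_derivative D i) (at z)" "\<And>i c v. D i (c *s v) = c * D i v"
    using F unfolding complex_differentiable_at_def by metis
  have 1: "(F has_derivative (\<lambda>v. \<chi> i. D i v)) (at z)"
    by (rule has_derivative_vec) (simp add: D)
  obtain E where E: "(h has_derivative E) (at (F z))" "\<And>c v. E (c *s v) = c * E v"
    using h by (auto simp: complex_differentiable_at_def)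
  have 2: "((h \<circ> F) has_derivative (E \<circ> (\<lambda>v. \<chi> i. D i v))) (at z)"
    by (rule diff_chain_at[OF 1 E(1)])
  have "(\<chi> i. D i (c *s v)) = c *s (\<chi> i. D i v)" for c v
    by (simp add: vec_eq_iff D)
  then show ?thesis using 2 E(2) unfolding complex_differentiable_at_def by auto
qed

lemma cdiff_continuous: "cdiff f z \<Longrightarrow> isCont f z"
  by (auto simp: complex_differentiable_at_def intro: has_derivative_continuous)

lemma hol_at_compose:
  fixes F :: "complex^'m::finite \<Rightarrow> complex^'n::finite"
  assumes "open N" "z \<in> N" and F: "\<And>i y. y \<in> N \<Longrightarrow> cdiff (\<lambda>x. F x $ i) y" and h: "hol_at h (F z)"
  shows "hol_at (h \<circ> F) z"
proof -
  obtain U where U: "open U" "F z \<in> U" "\<And>y. y \<in> U \<Longrightarrow> cdiff h y"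
    using h by (auto simp: hol_at_def)
  have "continuous_on N F"
  proof -
    have "continuous_on N (\<lambda>x. F x $ i)" for i
      using F cdiff_continuous continuous_at_imp_continuous_on by blast
    then have "continuous_on N (\<lambda>x. \<chi> i. F x $ i)" by (rule continuous_on_vec_lambda)
    then show ?thesis by simp
  qed
  then have "open (N \<inter> F -` U)"
    by (simp add: assms(1) U(1) continuous_open_preimage)
  then show ?thesis
    by (rule hol_atI) (use assms U in \<open>auto intro: cdiff_compose\<close>)
qed

lemma cdiff_const [simp]: "cdiff (\<lambda>_. c) z"
  unfolding complex_differentiable_at_def by (rule exI[of _ "\<lambda>_. 0"]) auto

lemma cdiff_nth [simp]: "cdiff (\<lambda>x. x $ i) z"
  unfolding complex_differentiable_at_def
  by (rule exI[of _ "\<lambda>x. x $ i"])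
     (auto intro!: bounded_linear_imp_has_derivative bounded_linear_vec_nth)

lemma cdiff_add: "cdiff f z \<Longrightarrow> cdiff g z \<Longrightarrow> cdiff (\<lambda>x. f x + g x) z"
  unfolding complex_differentiable_at_def
  by (elim exE conjE, rule_tac x="\<lambda>v. D v + Da v" in exI)
     (auto intro: has_derivative_add simp: algebra_simps)

lemma cdiff_mult: "cdiff f z \<Longrightarrow> cdiff g z \<Longrightarrow> cdiff (\<lambda>x. f x * g x) z"
  unfolding complex_differentiable_at_def
  by (elim exE conjE) (rule_tac x="\<lambda>v. f z * Da v + D v * g z" in exI,
      rule conjI, erule (1) has_derivative_mult, simp add: algebra_simps)

lemma cdiff_sum: "(\<And>i. i \<in> I \<Longrightarrow> cdiff (f i) z) \<Longrightarrow> cdiff (\<lambda>x. \<Sum>i\<in>I. f i x) z"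
  by (induction I rule: infinite_finite_induct) (auto intro: cdiff_add)

lemma cdiff_power: "cdiff f z \<Longrightarrow> cdiff (\<lambda>x. f x ^ k) z"
  by (induction k) (auto intro: cdiff_mult)

lemma cdiff_scalar_compose:
  assumes "cdiff f z" "k field_differentiable (at (f z))"
  shows "cdiff (\<lambda>x. k (f x)) z"
proof -
  obtain d where d: "(k has_field_derivative d) (at (f z))"
    using assms(2) by (auto simp: field_differentiable_def)
  obtain D where D: "(f has_derivative D) (at z)" "\<And>c v. D (c *s v) = c * D v"
    using assms(1) by (auto simp: complex_differentiable_at_def)
  have "((k \<circ> f) has_derivative ((*) d \<circ> D)) (at z)"
    by (rule diff_chain_at[OF D(1)]) (use d in \<open>simp add: has_field_derivative_def\<close>)
  then show ?thesis
    unfolding complex_differentiable_at_def comp_def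
    by (rule_tac x="\<lambda>v. d * D v" in exI) (auto simp: D algebra_simps comp_def)
qed

lemma cdiff_inverse: "cdiff f z \<Longrightarrow> f z \<noteq> 0 \<Longrightarrow> cdiff (\<lambda>x. inverse (f x)) z"
  by (erule cdiff_scalar_compose) (auto intro!: derivative_intros simp: field_differentiable_def)

lemma cdiff_divide: "cdiff f z \<Longrightarrow> cdiff g z \<Longrightarrow> g z \<noteq> 0 \<Longrightarrow> cdiff (\<lambda>x. f x / g x) z"
  unfolding divide_inverse by (intro cdiff_mult cdiff_inverse)

lemmas cdiff_intros = cdiff_const cdiff_nth cdiff_add cdiff_mult cdiff_sum cdiff_power cdiff_divide

text \<open>Several variables are handled by restriction to complex lines, where Taylor expansion,
  Cauchy estimates and the maximum principle of one variable apply.\<close>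

lemma cdiff_along_curve:
  fixes A :: "complex \<Rightarrow> complex^'n::finite"
  assumes h: "cdiff h (A t)" and A: "\<And>i. (\<lambda>t. A t $ i) field_differentiable (at t)"
  shows "(\<lambda>t. h (A t)) field_differentiable (at t)"
proof -
  obtain d where d: "\<And>i. ((\<lambda>t. A t $ i) has_field_derivative d i) (at t)"
    using A unfolding field_differentiable_def by metis
  have 1: "(A has_derivative (\<lambda>v. v *s (\<chi> i. d i))) (at t)"
    by (rule has_derivative_vec) (use d in \<open>simp add: has_field_derivative_def mult_commute_abs\<close>)
  obtain E where E: "(h has_derivative E) (at (A t))" "\<And>c v. E (c *s v) = c * E v"
    using h by (auto simp: complex_differentiable_at_def)
  have 2: "((h \<circ> A) has_derivative (E \<circ> (\<lambda>v. v *s (\<chi> i. d i)))) (at t)"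
    by (rule diff_chain_at[OF 1 E(1)])
  then have "((\<lambda>t. h (A t)) has_derivative (*) (E (\<chi> i. d i))) (at t)"
    by (simp add: comp_def E(2) mult.commute[of _ "E _"])
  then show ?thesis by (auto simp: field_differentiable_def has_field_derivative_def)
qed

lemma norm_vector_smult: "norm (c *s (v :: complex^'n::finite)) = cmod c * norm v"
proof -
  have "norm (c *s v) = L2_set (\<lambda>i. cmod c * norm (v $ i)) UNIV"
    by (simp add: norm_vec_def norm_mult)
  then show ?thesis by (simp add: norm_vec_def L2_set_right_distrib)
qed

lemma tendsto_vector_smult [tendsto_intros]:
  fixes g :: "'b \<Rightarrow> complex^'n::finite"
  assumes "(f \<longlongrightarrow> a) F" "(g \<longlongrightarrow> b) F"
  shows "((\<lambda>x. f x *s g x) \<longlongrightarrow> a *s b) F"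
  by (rule vec_tendstoI) (auto intro!: tendsto_intros assms)

lemma continuous_on_vector_smult [continuous_intros]:
  fixes g :: "'b::topological_space \<Rightarrow> complex^'n::finite"
  shows "continuous_on S f \<Longrightarrow> continuous_on S g \<Longrightarrow> continuous_on S (\<lambda>x. f x *s g x)"
  by (auto simp: continuous_on_def intro: tendsto_vector_smult)

subsection \<open>Sixth roots of unity\<close>

lemma sixth_root_cases:
  fixes e :: complex
  assumes "e ^ 6 = 1" "e \<noteq> 1"
  shows "e = -1 \<or> e^2 + e + 1 = 0 \<or> e^2 - e + 1 = 0"
proof -
  have "(e - 1) * ((e + 1) * ((e^2 + e + 1) * (e^2 - e + 1))) = e^6 - 1"
    by (simp add: algebra_simps power_numeral_reduce)
  then have "(e - 1) * ((e + 1) * ((e^2 + e + 1) * (e^2 - e + 1))) = 0" using assms by simp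
  then show ?thesis using assms by (auto simp: eq_neg_iff_add_eq_0)
qed

lemma norm_sixth_root: "e ^ 6 = 1 \<Longrightarrow> cmod e = 1"
  by (metis norm_ge_zero norm_one norm_power power_eq_1_iff zero_neq_numeral)

text \<open>The regular hexagon inscribed in the unit circle has side 1. This separation is what
  makes the quotient map injective on explicit balls.\<close>

lemma sixth_root_far_from_one:
  assumes "e ^ 6 = 1" "e \<noteq> 1"
  shows "1 \<le> cmod (e - 1)"
proof -
  have n: "cmod e = 1" using norm_sixth_root[OF assms(1)] .
  consider "e = -1" | "e^2 + e + 1 = 0" | "e^2 - e + 1 = 0" using sixth_root_cases[OF assms] by auto
  then show ?thesis
  proof cases
    case 1 then show ?thesis by simp
  next
    case 2
    then have "(e - 1)^2 = -3 * e" by algebra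
    then have "cmod (e - 1) ^ 2 = 3" using n by (metis norm_power norm_mult norm_minus_cancel norm_numeral mult.right_neutral)
    then show ?thesis by (smt (verit) norm_ge_zero power_le_one)
  next
    case 3
    then have "e * (e - 1) = -1" by algebra
    then have "cmod e * cmod (e - 1) = 1" by (metis norm_minus_cancel norm_mult norm_one)
    then show ?thesis using n by simp
  qed
qed

lemma sixth_roots_finite: "finite {e::complex. e ^ 6 = 1}"
  by (rule finite_roots_unity) auto

lemma exists_sixth_root: "\<exists>t::complex. t ^ 6 = u"
proof (cases "u = 0")
  case False
  then have "exp (Ln u / 6) ^ 6 = u" by (simp flip: exp_of_nat_mult)
  then show ?thesis by blast
qed (auto intro: exI[of _ 0])

text \<open>The character \<open>e ^ k\<close> of \<mu>_6 is nontrivial for 0 < k < 6. The root -1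
  detects odd k, a primitive cube root of unity detects k = 2 and k = 4.\<close>

lemma sixth_root_annihilates:
  fixes a :: complex
  assumes "\<And>e::complex. e ^ 6 = 1 \<Longrightarrow> e ^ k * a = a" "0 < k" "k < 6"
  shows "a = 0"
proof -
  define c where "c = cis (2*pi/3)"
  have "c ^ 3 = cis (2 * pi)" unfolding c_def using Complex.DeMoivre[of "2 * pi / 3" 3] by simp
  then have c3: "c ^ 3 = 1" by simp
  have c1: "c \<noteq> 1"
  proof
    assume "c = 1"
    then have "cos (2*pi/3) = 1" unfolding c_def by (metis cis.sel(1) one_complex.sel(1))
    then show False using cos_120 by simp
  qed
  have c6: "c ^ 6 = 1" using c3 by (metis mult_2 numeral_Bit0 power_add mult_1)
  have c2: "c ^ 2 \<noteq> 1" using c1 c3 by (metis mult_1 power2_eq_square power3_eq_cube)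
  have c4: "c ^ 4 = c" using c3 by (simp add: power_numeral_reduce)
  have "k = 1 \<or> k = 2 \<or> k = 3 \<or> k = 4 \<or> k = 5" using assms by auto
  then show ?thesis using assms(1)[of "-1"] assms(1)[of c] c6 c2 c4 c1 by auto
qed

text \<open>Invariance kills the Taylor coefficients of order 1 to 5, and Cauchy estimates on the
  circle of radius R/2 bound the tail from order 7 on by a geometric series of ratio at most 1/2.
  The constant depends only on M and R, so that the estimate is uniform over families of
  functions.\<close>

lemma invariant_Taylor_bound:
  assumes f: "f holomorphic_on ball 0 R" "0 < R"
    and M: "\<And>t. cmod t < R \<Longrightarrow> cmod (f t) \<le> M"
    and inv: "\<And>e t. e ^ 6 = 1 \<Longrightarrow> cmod t < R \<Longrightarrow> f (e * t) = f t"
    and t: "cmod t \<le> R / 4"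
  shows "cmod (f t - f 0 - (deriv ^^ 6) f 0 / fact 6 * t ^ 6) \<le> 2 * M * (2 * cmod t / R) ^ 7"
proof -
  define a where "a k = (deriv ^^ k) f 0 / fact k" for k
  have s: "(\<lambda>k. a k * t ^ k) sums f t"
    using holomorphic_power_series[OF f(1), of t] t f(2) by (simp add: a_def)
  have R2: "0 < R / 2" using f(2) by simp
  have "cmod ((deriv ^^ k) f 0) \<le> fact k * M / (R/2) ^ k" for k
  proof (rule Cauchy_inequality[OF _ _ R2])
    show "f holomorphic_on ball 0 (R/2)"
      using f by (auto intro: holomorphic_on_subset)
    show "continuous_on (cball 0 (R/2)) f"
      by (rule holomorphic_on_imp_continuous_on, rule holomorphic_on_subset[OF f(1)]) (use f(2) in auto)
    show "cmod (f x) \<le> M" if "cmod (0 - x) = R/2" for x using that M f(2) by auto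
  qed
  then have a_bound: "cmod (a k) \<le> M / (R/2)^k" for k
    by (simp only: a_def norm_divide norm_fact) (simp add: pos_divide_le_eq mult.commute)
  have a_zero: "a k = 0" if "0 < k" "k < 6" for k
  proof -
    have "e ^ k * (deriv ^^ k) f 0 = (deriv ^^ k) f 0" if e: "e ^ 6 = 1" for e
    proof -
      have eb: "e * w \<in> ball 0 R" if "w \<in> ball 0 R" for w
        using that norm_sixth_root[OF e] by (simp add: norm_mult)
      have "(deriv ^^ k) (\<lambda>w. f (e * w)) 0 = e ^ k * (deriv ^^ k) f (e * 0)"
        by (rule higher_deriv_compose_linear[OF f(1), where S = "ball 0 R"]) (use f(2) eb in auto)
      moreover have "(deriv ^^ k) (\<lambda>w. f (e * w)) 0 = (deriv ^^ k) f 0"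
      proof (rule higher_deriv_cong_ev)
        show "\<forall>\<^sub>F w in nhds 0. f (e * w) = f w"
          unfolding eventually_nhds using f(2) inv[OF e]
          by (intro exI[of _ "ball 0 R"]) auto
      qed auto
      ultimately show ?thesis by simp
    qed
    then have "(deriv ^^ k) f 0 = 0" by (rule sixth_root_annihilates[OF _ that])
    then show ?thesis by (simp add: a_def)
  qed
  have "(\<lambda>k. a (k + 7) * t ^ (k + 7)) sums (f t - (\<Sum>k<7. a k * t ^ k))"
    using sums_split_initial_segment[OF s] by simp
  moreover have "(\<Sum>k<7. a k * t ^ k) = f 0 + a 6 * t ^ 6"
    by (simp add: a_zero eval_nat_numeral) (simp add: a_def)
  ultimately have s7: "(\<lambda>k. a (k + 7) * t ^ (k + 7)) sums (f t - f 0 - a 6 * t ^ 6)"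
    by (simp add: algebra_simps)
  define q where "q = 2 * cmod t / R"
  have q: "0 \<le> q" "q \<le> 1/2" using t f(2) by (auto simp: q_def divide_simps)
  have M0: "0 \<le> M" using M[of 0] f(2) norm_ge_zero order_trans by (metis norm_zero)
  have b: "cmod (a (k + 7) * t ^ (k + 7)) \<le> M * q ^ 7 * (1/2) ^ k" for k
  proof -
    have "cmod (a (k + 7) * t ^ (k + 7)) \<le> M / (R/2)^(k+7) * cmod t ^ (k+7)"
      unfolding norm_mult norm_power by (rule mult_right_mono[OF a_bound]) simp
    also have "\<dots> = M * q ^ (k + 7)"
      by (simp add: q_def power_divide power_mult_distrib)
    also have "\<dots> = M * q ^ 7 * q ^ k" by (simp add: power_add)
    also have "\<dots> \<le> M * q ^ 7 * (1/2) ^ k"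
      using q M0 by (intro mult_left_mono power_mono) auto
    finally show ?thesis .
  qed
  have g: "(\<lambda>k. M * q ^ 7 * (1/2) ^ k) sums (M * q ^ 7 * 2)"
    using sums_mult[OF geometric_sums[of "1/2::real"], of "M * q^7"] by simp
  have "cmod (f t - f 0 - a 6 * t ^ 6) \<le> M * q ^ 7 * 2"
    using norm_suminf_le[OF b sums_summable[OF g]] sums_unique[OF s7] sums_unique[OF g] by simp
  then show ?thesis by (simp add: a_def q_def mult_ac)
qed

section \<open>Spaces whose holomorphic functions form a sheaf\<close>

text \<open>The two conditions that \<open>complex_manifold\<close> imposes on
  \<open>cs_hol\<close>: dependence on germs only, and openness. A \<open>cspace\<close> need not
  satisfy them, so they are carried through every construction.\<close>

definition sheafy :: "'a cspace \<Rightarrow> bool" where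
  "sheafy X \<longleftrightarrow>
     (\<forall>f g U. openin (cs_top X) U \<and> (\<forall>x\<in>U. f x = g x) \<longrightarrow>
        (\<forall>x\<in>U. cs_hol X f x \<longleftrightarrow> cs_hol X g x)) \<and>
     (\<forall>f. \<forall>x\<in>cs_points X. cs_hol X f x \<longrightarrow>
        (\<exists>U. openin (cs_top X) U \<and> x \<in> U \<and> (\<forall>y\<in>U. cs_hol X f y)))"

lemma sheafy_cong:
  assumes "sheafy X" "openin (cs_top X) U" "x \<in> U" "\<And>y. y \<in> U \<Longrightarrow> f y = g y"
  shows "cs_hol X f x \<longleftrightarrow> cs_hol X g x"
  using assms unfolding sheafy_def by metis

lemma sheafy_openD:
  assumes "sheafy X" "x \<in> cs_points X" "cs_hol X f x"
  shows "\<exists>U. openin (cs_top X) U \<and> x \<in> U \<and> (\<forall>y\<in>U. cs_hol X f y)"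
  using assms unfolding sheafy_def by metis

lemma cs_top_sub [simp]: "cs_top (cs_sub X S) = subtopology (cs_top X) S"
  by (simp add: cs_sub_def)

lemma cs_hol_sub: "cs_hol (cs_sub X S) f x \<longleftrightarrow>
    (\<exists>V F. openin (cs_top X) V \<and> x \<in> V \<and> (\<forall>y\<in>V. cs_hol X F y) \<and> (\<forall>y\<in>V \<inter> S. F y = f y))"
  by (simp add: cs_sub_def)

lemma cs_top_affine [simp]: "cs_top affine_cs = euclidean"
  by (simp add: affine_cs_def)

lemma sheafy_sub: "sheafy (cs_sub X S)"
  unfolding sheafy_def
proof (intro conjI allI impI ballI)
  fix f g :: "'a \<Rightarrow> complex" and U x
  assume U: "openin (cs_top (cs_sub X S)) U \<and> (\<forall>x\<in>U. f x = g x)" and x: "x \<in> U"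
  obtain T where T: "openin (cs_top X) T" "U = T \<inter> S"
    using U by (auto simp: openin_subtopology)
  have *: "cs_hol (cs_sub X S) g x"
    if f: "cs_hol (cs_sub X S) f x" and eq: "\<forall>x\<in>U. f x = g x" for f g
  proof -
    obtain V F where "openin (cs_top X) V" "x \<in> V" "\<forall>y\<in>V. cs_hol X F y" "\<forall>y\<in>V \<inter> S. F y = f y"
      using f by (auto simp: cs_hol_sub)
    then show ?thesis unfolding cs_hol_sub
      by (intro exI[of _ "V \<inter> T"] exI[of _ F]) (use T x eq in auto)
  qed
  show "cs_hol (cs_sub X S) f x \<longleftrightarrow> cs_hol (cs_sub X S) g x"
    using *[of f g] *[of g f] U by auto
next
  fix f x
  assume "x \<in> cs_points (cs_sub X S)" "cs_hol (cs_sub X S) f x"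
  then obtain V F where "openin (cs_top X) V" "x \<in> V" "\<forall>y\<in>V. cs_hol X F y" "\<forall>y\<in>V \<inter> S. F y = f y" "x \<in> S"
    by (auto simp: cs_hol_sub)
  then show "\<exists>U. openin (cs_top (cs_sub X S)) U \<and> x \<in> U \<and> (\<forall>y\<in>U. cs_hol (cs_sub X S) f y)"
    by (intro exI[of _ "V \<inter> S"]) (auto simp: cs_hol_sub openin_subtopology)
qed

lemma sheafy_affine: "sheafy affine_cs"
  unfolding sheafy_def
proof (intro conjI allI impI ballI)
  fix f g :: "complex^'n \<Rightarrow> complex" and U x
  assume "openin (cs_top affine_cs) U \<and> (\<forall>x\<in>U. f x = g x)" "x \<in> U"
  then show "hol_at f x \<longleftrightarrow> hol_at g x" by (intro hol_at_cong[of U]) auto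
next
  fix f :: "complex^'n \<Rightarrow> complex" and x
  assume "hol_at f x"
  then show "\<exists>U. openin (cs_top affine_cs) U \<and> x \<in> U \<and> (\<forall>y\<in>U. hol_at f y)"
    unfolding hol_at_def by auto
qed

text \<open>The structure of \<open>cs_sub\<close> asks for extensions to the ambient space; over an
  open set a function is its own extension, once the ambient structure depends on germs
  only.\<close>

lemma hol_sub_open:
  assumes "sheafy X" "openin (cs_top X) U" "x \<in> U"
  shows "cs_hol (cs_sub X U) f x \<longleftrightarrow> cs_hol X f x"
proof
  assume "cs_hol (cs_sub X U) f x"
  then obtain V F where "openin (cs_top X) V" "x \<in> V" "\<forall>y\<in>V. cs_hol X F y" "\<forall>y\<in>V \<inter> U. F y = f y"
    by (auto simp: cs_hol_sub)
  then show "cs_hol X f x"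
    using sheafy_cong[OF assms(1), of "V \<inter> U" x F f] assms by auto
next
  assume "cs_hol X f x"
  moreover have "x \<in> cs_points X" using assms openin_subset by blast
  ultimately obtain V where "openin (cs_top X) V" "x \<in> V" "\<forall>y\<in>V. cs_hol X f y"
    using sheafy_openD[OF assms(1)] by blast
  then show "cs_hol (cs_sub X U) f x" by (auto simp: cs_hol_sub)
qed

lemma cs_iso_open:
  assumes "sheafy X" "sheafy Y" "openin (cs_top X) U" "openin (cs_top Y) V"
  shows "cs_iso (cs_sub X U) (cs_sub Y V) f \<longleftrightarrow>
     homeomorphic_map (subtopology (cs_top X) U) (subtopology (cs_top Y) V) f \<and>
     (\<forall>h. \<forall>x\<in>U. cs_hol Y h (f x) \<longleftrightarrow> cs_hol X (h \<circ> f) x)"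
proof -
  have tU: "topspace (subtopology (cs_top X) U) = U"
    and tV: "topspace (subtopology (cs_top Y) V) = V"
    using assms(3,4) openin_subset by (auto simp: topspace_subtopology)
  have "f x \<in> V" if "homeomorphic_map (subtopology (cs_top X) U) (subtopology (cs_top Y) V) f" "x \<in> U" for x
    using homeomorphic_imp_surjective_map[OF that(1)] that(2) tU tV by auto
  then show ?thesis
    unfolding cs_iso_def cs_top_sub tU
    using hol_sub_open[OF assms(1,3)] hol_sub_open[OF assms(2,4)] by auto
qed

lemma charts_iff:
  fixes \<phi> :: "'a \<Rightarrow> complex^'n"
  assumes "sheafy X"
  shows "(U, \<phi>) \<in> charts X \<longleftrightarrow> openin (cs_top X) U \<and> 
    (\<exists>V. open V \<and> homeomorphic_map (subtopology (cs_top X) U) (top_of_set V) \<phi>) \<and>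
     (\<forall>h. \<forall>x\<in>U. hol_at h (\<phi> x) \<longleftrightarrow> cs_hol X (h \<circ> \<phi>) x)"
proof -
  have "cs_iso (cs_sub X U) (cs_sub affine_cs V) \<phi> \<longleftrightarrow>
     homeomorphic_map (subtopology (cs_top X) U) (top_of_set V) \<phi> \<and>
     (\<forall>h. \<forall>x\<in>U. hol_at h (\<phi> x) \<longleftrightarrow> cs_hol X (h \<circ> \<phi>) x)"
    if "openin (cs_top X) U" "open V" for V
    using cs_iso_open[OF assms sheafy_affine, of U V \<phi>] that by auto
  then show ?thesis unfolding charts_def by auto
qed

text \<open>Coefficients of pluricanonical forms are indexed by charts. Passing to a smaller open
  set thus restricts the index set and leaves the coefficients as they are.\<close>

lemma charts_sub:
  assumes "sheafy X" "openin (cs_top X) W"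
  shows "(U, \<phi>) \<in> charts (cs_sub X W) \<longleftrightarrow> (U, \<phi>) \<in> charts X \<and> U \<subseteq> W"
proof -
  have "cs_hol (cs_sub X W) h x \<longleftrightarrow> cs_hol X h x" if "U \<subseteq> W" "x \<in> U" for h x
    using hol_sub_open[OF assms] that by auto
  moreover have "subtopology (subtopology (cs_top X) W) U = subtopology (cs_top X) U" if "U \<subseteq> W"
    using that by (simp add: subtopology_subtopology Int_absorb1)
  ultimately show ?thesis
    unfolding charts_iff[OF sheafy_sub] charts_iff[OF assms(1)] cs_top_sub openin_open_subtopology[OF assms(2)]
    by auto
qed

lemma quotient_istopology:
  "istopology (\<lambda>U. U \<subseteq> p ` topspace T \<and> openin T {x \<in> topspace T. p x \<in> U})"
proof -
  have 1: "{x \<in> topspace T. p x \<in> S \<inter> S'} = {x \<in> topspace T. p x \<in> S} \<inter> {x \<in> topspace T. p x \<in> S'}" for S S'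
    by blast
  have 2: "{x \<in> topspace T. p x \<in> \<Union>K} = (\<Union>S\<in>K. {x \<in> topspace T. p x \<in> S})" for K
    by blast
  show ?thesis
    unfolding istopology_def 1 2
  proof (intro conjI allI impI)
    show "S \<inter> S' \<subseteq> p ` topspace T"
      if "S \<subseteq> p ` topspace T \<and> openin T {x \<in> topspace T. p x \<in> S}" for S S' using that by blast
    show "openin T ({x \<in> topspace T. p x \<in> S} \<inter> {x \<in> topspace T. p x \<in> S'})"
      if "S \<subseteq> p ` topspace T \<and> openin T {x \<in> topspace T. p x \<in> S}"
        "S' \<subseteq> p ` topspace T \<and> openin T {x \<in> topspace T. p x \<in> S'}" for S S'
      by (rule openin_Int) (use that in simp_all)
    show "\<Union>K \<subseteq> p ` topspace T"
      if "\<forall>S\<in>K. S \<subseteq> p ` topspace T \<and> openin T {x \<in> topspace T. p x \<in> S}" for K using that by blast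
    show "openin T (\<Union>S\<in>K. {x \<in> topspace T. p x \<in> S})"
      if "\<forall>S\<in>K. S \<subseteq> p ` topspace T \<and> openin T {x \<in> topspace T. p x \<in> S}" for K
      by (rule openin_Union) (use that in blast)
  qed
qed

lemma openin_quotient_top:
  "openin (quotient_top T p) U \<longleftrightarrow> U \<subseteq> p ` topspace T \<and> openin T {x \<in> topspace T. p x \<in> U}"
  unfolding quotient_top_def by (subst topology_inverse'[OF quotient_istopology]) (rule refl)

lemma topspace_quotient_top [simp]: "topspace (quotient_top T p) = p ` topspace T"
proof
  show "topspace (quotient_top T p) \<subseteq> p ` topspace T"
    using openin_topspace[of "quotient_top T p"] unfolding openin_quotient_top by auto
  have "{x \<in> topspace T. p x \<in> p ` topspace T} = topspace T" by auto
  then have "openin (quotient_top T p) (p ` topspace T)" unfolding openin_quotient_top by auto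
  then show "p ` topspace T \<subseteq> topspace (quotient_top T p)" by (rule openin_subset)
qed

lemma cs_top_quotient [simp]: "cs_top (cs_quotient X p) = quotient_top (cs_top X) p"
  by (simp add: cs_quotient_def)

lemma cs_hol_quotient: "cs_hol (cs_quotient X p) f y \<longleftrightarrow>
   (\<exists>V. openin (quotient_top (cs_top X) p) V \<and> y \<in> V \<and>
      (\<forall>x\<in>cs_points X. p x \<in> V \<longrightarrow> cs_hol X (f \<circ> p) x))"
  by (simp add: cs_quotient_def)

lemma sheafy_quotient:
  fixes p :: "'a \<Rightarrow> 'b"
  assumes "sheafy X" shows "sheafy (cs_quotient X p)"
  unfolding sheafy_def
proof (intro conjI allI impI ballI)
  fix f g :: "'b \<Rightarrow> complex" and U y
  assume U: "openin (cs_top (cs_quotient X p)) U \<and> (\<forall>x\<in>U. f x = g x)" and y: "y \<in> U"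
  have *: "cs_hol (cs_quotient X p) g y"
    if f: "cs_hol (cs_quotient X p) f y" and eq: "\<forall>x\<in>U. f x = g x" for f g
  proof -
    obtain V where V: "openin (quotient_top (cs_top X) p) V" "y \<in> V"
      "\<And>x. x\<in>cs_points X \<Longrightarrow> p x \<in> V \<Longrightarrow> cs_hol X (f \<circ> p) x"
      using f unfolding cs_hol_quotient by auto
    have o: "openin (quotient_top (cs_top X) p) (V \<inter> U)" using V U by auto
    have "cs_hol X (g \<circ> p) x" if "x \<in> cs_points X" "p x \<in> V \<inter> U" for x
    proof -
      have "openin (cs_top X) {x \<in> cs_points X. p x \<in> V \<inter> U}" using o unfolding openin_quotient_top by auto
      then show ?thesis
        using sheafy_cong[OF assms, of _ x "f \<circ> p" "g \<circ> p"] V(3) eq that by auto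
    qed
    then show ?thesis unfolding cs_hol_quotient using o y V(2) by blast
  qed
  show "cs_hol (cs_quotient X p) f y \<longleftrightarrow> cs_hol (cs_quotient X p) g y"
    using *[of f g] *[of g f] U by auto
next
  fix f y assume "cs_hol (cs_quotient X p) f y"
  then show "\<exists>U. openin (cs_top (cs_quotient X p)) U \<and> y \<in> U \<and> (\<forall>y\<in>U. cs_hol (cs_quotient X p) f y)"
    unfolding cs_hol_quotient cs_top_quotient by blast
qed

subsection \<open>Local models of the sextic quotient\<close>

text \<open>The interface between singularity theory and lattice theory: near \<open>\<pi> 0\<close>
  the space is a ball modulo scalar sixth roots of unity, expressed through \<open>\<pi>\<close>
  alone. It is instantiated both by the modular variety and by the standard cyclic quotient.\<close>

locale sextic_model =
  fixes X :: "'a cspace" and \<pi> :: "complex^'n::finite \<Rightarrow> 'a" and \<rho> :: real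
  assumes rho: "0 < \<rho>" and sheafy: "sheafy X"
    and open_image: "\<And>S. open S \<Longrightarrow> S \<subseteq> ball 0 \<rho> \<Longrightarrow> openin (cs_top X) (\<pi> ` S)"
    and open_vimage: "\<And>U. openin (cs_top X) U \<Longrightarrow> open {z \<in> ball 0 \<rho>. \<pi> z \<in> U}"
    and fibre: "\<And>z z'. z \<in> ball 0 \<rho> \<Longrightarrow> z' \<in> ball 0 \<rho> \<Longrightarrow> \<pi> z = \<pi> z' \<longleftrightarrow> (\<exists>e. e ^ 6 = 1 \<and> z' = e *s z)"
    and hol: "\<And>z h. z \<in> ball 0 \<rho> \<Longrightarrow> cs_hol X h (\<pi> z) \<longleftrightarrow> hol_at (h \<circ> \<pi>) z"
begin

abbreviation B where "B \<equiv> ball (0::complex^'n) \<rho>"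

lemma open_piB: "openin (cs_top X) (\<pi> ` B)" by (rule open_image) auto

lemma pi_in [simp]: "z \<in> B \<Longrightarrow> \<pi> z \<in> cs_points X"
  using open_piB openin_subset by blast

lemma root_in_B: "e ^ 6 = 1 \<Longrightarrow> z \<in> B \<Longrightarrow> e *s z \<in> B"
  by (simp add: norm_vector_smult norm_sixth_root)

lemma pi_root: "e ^ 6 = 1 \<Longrightarrow> z \<in> B \<Longrightarrow> \<pi> (e *s z) = \<pi> z"
  using fibre root_in_B by metis

lemma pi_zero_iff: "z \<in> B \<Longrightarrow> \<pi> z = \<pi> 0 \<longleftrightarrow> z = 0"
  using fibre[of 0 z] rho by (auto intro: exI[of _ 1])

text \<open>Canonicity allows an arbitrarily small neighbourhood of the centre; the argument is then
  rerun on a smaller ball contained in it.\<close>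

lemma restrict:
  assumes "0 < r" "r \<le> \<rho>"
  shows "sextic_model (cs_sub X (\<pi> ` ball 0 r)) \<pi> r"
proof
  have o: "openin (cs_top X) (\<pi> ` ball 0 r)" by (rule open_image) (use assms in auto)
  show "openin (cs_top (cs_sub X (\<pi> ` ball 0 r))) (\<pi> ` S)" if "open S" "S \<subseteq> ball 0 r" for S
    unfolding cs_top_sub openin_open_subtopology[OF o]
    using that open_image[of S] subset_ball[OF assms(2), of 0] by blast
  show "open {z \<in> ball 0 r. \<pi> z \<in> U}" if "openin (cs_top (cs_sub X (\<pi> ` ball 0 r))) U" for U
  proof -
    have "open (ball 0 r \<inter> {z \<in> B. \<pi> z \<in> U})"
      using that open_vimage unfolding cs_top_sub openin_open_subtopology[OF o] by auto
    moreover have "ball 0 r \<inter> {z \<in> B. \<pi> z \<in> U} = {z \<in> ball 0 r. \<pi> z \<in> U}" using assms by auto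
    ultimately show ?thesis by simp
  qed
  show "\<pi> z = \<pi> z' \<longleftrightarrow> (\<exists>e. e ^ 6 = 1 \<and> z' = e *s z)" if "z \<in> ball 0 r" "z' \<in> ball 0 r" for z z'
    using that assms fibre[of z z'] by auto
  show "cs_hol (cs_sub X (\<pi> ` ball 0 r)) h (\<pi> z) = hol_at (h \<circ> \<pi>) z" if "z \<in> ball 0 r" for h z
    using hol_sub_open[OF sheafy o, of "\<pi> z" h] hol[of z h] that assms by auto
qed (use assms sheafy_sub in auto)

text \<open>A neighbourhood of \<open>z\<close> on which the free action of \<mu>_6 off the origin
  identifies no two points. For \<open>z = 0\<close> it is empty, so the family needs no case
  distinction.\<close>

definition piece :: "complex^'n \<Rightarrow> (complex^'n) set" where
  "piece z = ball z (norm z / 4) \<inter> B"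

lemma open_piece: "open (piece z)" unfolding piece_def by (intro open_Int open_ball)
lemma piece_subset: "piece z \<subseteq> B" by (simp add: piece_def)
lemma in_piece: "z \<in> B \<Longrightarrow> z \<noteq> 0 \<Longrightarrow> z \<in> piece z" by (simp add: piece_def)

text \<open>Two distinct points x and e x of one orbit are at distance |e - 1| |x| \<ge> |x|, which
  exceeds 3/4 of |z|, while points of the piece are less than 1/2 of |z| apart.\<close>

lemma inj_piece: "inj_on \<pi> (piece z)"
proof (rule inj_onI)
  fix x y assume x: "x \<in> piece z" and y: "y \<in> piece z" and eq: "\<pi> x = \<pi> y"
  obtain e where e: "e ^ 6 = 1" "y = e *s x" using fibre[of x y] x y eq by (auto simp: piece_def)
  show "x = y"
  proof (rule ccontr)
    assume "x \<noteq> y"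
    then have "e \<noteq> 1" using e by auto
    then have "1 \<le> cmod (e - 1)" using sixth_root_far_from_one e by auto
    moreover have "y - x = (e - 1) *s x" using e by (simp add: vec_eq_iff algebra_simps)
    ultimately have 1: "norm x \<le> norm (y - x)"
      by (metis norm_vector_smult mult_right_mono norm_ge_zero mult_1)
    have 2: "norm (z - x) < norm z / 4" "norm (z - y) < norm z / 4"
      using x y by (auto simp: piece_def dist_norm)
    have "norm (y - x) \<le> norm (z - x) + norm (z - y)"
      using norm_triangle_ineq4[of "z - x" "z - y"] by simp
    moreover have "norm z - norm x \<le> norm (z - x)" by (rule norm_triangle_ineq2)
    moreover have "norm z > 0" using 2(1) norm_ge_zero[of "z - x"] by linarith
    ultimately show False using 1 2 by linarith
  qed
qed

lemma homeomorphic_maps_inj: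
  assumes "open N" "N \<subseteq> B" "inj_on \<pi> N"
  shows "homeomorphic_maps (subtopology (cs_top X) (\<pi> ` N)) (top_of_set N) (inv_into N \<pi>) \<pi>"
proof -
  have o: "openin (cs_top X) (\<pi> ` N)" by (rule open_image) (use assms in auto)
  have t: "topspace (subtopology (cs_top X) (\<pi> ` N)) = \<pi> ` N"
    using openin_subset[OF o] by auto
  have inv: "inv_into N \<pi> (\<pi> z) = z" if "z \<in> N" for z using that assms(3) by (rule inv_into_f_f[rotated])
  have "continuous_map (subtopology (cs_top X) (\<pi> ` N)) (top_of_set N) (inv_into N \<pi>)"
    unfolding continuous_map_def t
  proof (intro conjI allI impI)
    show "inv_into N \<pi> \<in> \<pi> ` N \<rightarrow> topspace (top_of_set N)" using inv by auto
    fix U assume "openin (top_of_set N) U"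
    then have U: "open U" "U \<subseteq> N" using assms(1) openin_open_eq by auto
    have "{x \<in> \<pi> ` N. inv_into N \<pi> x \<in> U} = \<pi> ` U" using inv U by force
    then show "openin (subtopology (cs_top X) (\<pi> ` N)) {x \<in> \<pi> ` N. inv_into N \<pi> x \<in> U}"
      unfolding openin_open_subtopology[OF o] using U assms open_image[of U] by auto
  qed
  moreover have "continuous_map (top_of_set N) (subtopology (cs_top X) (\<pi> ` N)) \<pi>"
    unfolding continuous_map_def t
  proof (intro conjI allI impI)
    fix U assume "openin (subtopology (cs_top X) (\<pi> ` N)) U"
    then have "openin (cs_top X) U" using openin_open_subtopology[OF o] by auto
    then have "open ({z \<in> B. \<pi> z \<in> U} \<inter> N)" using open_vimage assms(1) by auto
    moreover have "{z \<in> B. \<pi> z \<in> U} \<inter> N = {z \<in> topspace (top_of_set N). \<pi> z \<in> U}" using assms by auto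
    ultimately show "openin (top_of_set N) {z \<in> topspace (top_of_set N). \<pi> z \<in> U}"
      using assms(1) openin_open_eq by auto
  qed auto
  ultimately show ?thesis unfolding homeomorphic_maps_def t using inv by auto
qed

text \<open>An inverse branch of \<open>\<pi>\<close> is a chart: the action is free off the origin,
  so the quotient has the local structure of the ball there.\<close>

lemma local_chart:
  assumes "open N" "N \<subseteq> B" "inj_on \<pi> N"
  shows "(\<pi> ` N, inv_into N \<pi>) \<in> charts X"
  unfolding charts_iff[OF sheafy]
proof (intro conjI allI ballI)
  show "openin (cs_top X) (\<pi> ` N)" by (rule open_image) (use assms in auto)
  show "\<exists>V. open V \<and> homeomorphic_map (subtopology (cs_top X) (\<pi> ` N)) (top_of_set V) (inv_into N \<pi>)"
    using homeomorphic_maps_inj[OF assms] homeomorphic_maps_imp_map assms(1) by blast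
  fix h x assume "x \<in> \<pi> ` N"
  then obtain y where y: "y \<in> N" "x = \<pi> y" by auto
  have inv: "inv_into N \<pi> (\<pi> z) = z" if "z \<in> N" for z using that assms(3) by (rule inv_into_f_f[rotated])
  have "cs_hol X (h \<circ> inv_into N \<pi>) x \<longleftrightarrow> hol_at ((h \<circ> inv_into N \<pi>) \<circ> \<pi>) y"
    using y assms(2) hol by auto
  also have "\<dots> \<longleftrightarrow> hol_at h y"
    by (rule hol_at_cong[OF assms(1) y(1)]) (simp add: inv)
  finally show "hol_at h (inv_into N \<pi> x) \<longleftrightarrow> cs_hol X (h \<circ> inv_into N \<pi>) x"
    using inv y by simp
qed

lemma piece_chart: "(\<pi> ` piece z, inv_into (piece z) \<pi>) \<in> charts X"
  by (rule local_chart[OF open_piece piece_subset inj_piece])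

end

text \<open>The identity of the ball descends to the quotients. Choosing any preimage under
  \<open>\<pi>\<close> and applying \<open>\<pi>'\<close> is well defined because both maps have the
  same fibres.\<close>

lemma sextic_models_locally_isomorphic:
  fixes \<pi> :: "complex^'n::finite \<Rightarrow> 'a" and \<pi>' :: "complex^'n \<Rightarrow> 'b"
  assumes "sextic_model X \<pi> \<rho>" "sextic_model X' \<pi>' \<rho>"
  shows "locally_isomorphic_at X (\<pi> 0) X' (\<pi>' 0)"
proof -
  interpret M: sextic_model X \<pi> \<rho> by fact
  interpret M': sextic_model X' \<pi>' \<rho> by fact
  define f where "f x = \<pi>' (inv_into M.B \<pi> x)" for x
  define f' where "f' x = \<pi> (inv_into M.B \<pi>' x)" for x
  have f: "f (\<pi> z) = \<pi>' z" if z: "z \<in> M.B" for z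
  proof -
    have "inv_into M.B \<pi> (\<pi> z) \<in> M.B" "\<pi> (inv_into M.B \<pi> (\<pi> z)) = \<pi> z"
      using z by (blast intro: inv_into_into f_inv_into_f)+
    then show ?thesis unfolding f_def using M.fibre M'.fibre z by blast
  qed
  have f': "f' (\<pi>' z) = \<pi> z" if z: "z \<in> M.B" for z
  proof -
    have "inv_into M.B \<pi>' (\<pi>' z) \<in> M.B" "\<pi>' (inv_into M.B \<pi>' (\<pi>' z)) = \<pi>' z"
      using z by (blast intro: inv_into_into f_inv_into_f)+
    then show ?thesis unfolding f'_def using M.fibre M'.fibre z by blast
  qed
  have t: "topspace (subtopology (cs_top X) (\<pi> ` M.B)) = \<pi> ` M.B"
    "topspace (subtopology (cs_top X') (\<pi>' ` M.B)) = \<pi>' ` M.B"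
    by (auto simp del: mem_ball)
  have c1: "continuous_map (subtopology (cs_top X) (\<pi> ` M.B)) (subtopology (cs_top X') (\<pi>' ` M.B)) f"
    unfolding continuous_map_def t
  proof (intro conjI allI impI)
    fix U assume "openin (subtopology (cs_top X') (\<pi>' ` M.B)) U"
    then have U: "openin (cs_top X') U" "U \<subseteq> \<pi>' ` M.B"
      using openin_open_subtopology[OF M'.open_piB] by auto
    have "{x \<in> \<pi> ` M.B. f x \<in> U} = \<pi> ` {z \<in> M.B. \<pi>' z \<in> U}" using f by auto
    then show "openin (subtopology (cs_top X) (\<pi> ` M.B)) {x \<in> \<pi> ` M.B. f x \<in> U}"
      unfolding openin_open_subtopology[OF M.open_piB]
      using M.open_image[OF M'.open_vimage[OF U(1)]] by fastforce
  qed (use f in auto)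
  have c2: "continuous_map (subtopology (cs_top X') (\<pi>' ` M.B)) (subtopology (cs_top X) (\<pi> ` M.B)) f'"
    unfolding continuous_map_def t
  proof (intro conjI allI impI)
    fix U assume "openin (subtopology (cs_top X) (\<pi> ` M.B)) U"
    then have U: "openin (cs_top X) U" "U \<subseteq> \<pi> ` M.B"
      using openin_open_subtopology[OF M.open_piB] by auto
    have "{x \<in> \<pi>' ` M.B. f' x \<in> U} = \<pi>' ` {z \<in> M.B. \<pi> z \<in> U}" using f' by auto
    then show "openin (subtopology (cs_top X') (\<pi>' ` M.B)) {x \<in> \<pi>' ` M.B. f' x \<in> U}"
      unfolding openin_open_subtopology[OF M'.open_piB]
      using M'.open_image[OF M.open_vimage[OF U(1)]] by fastforce
  qed (use f' in auto)
  have "homeomorphic_maps (subtopology (cs_top X) (\<pi> ` M.B)) (subtopology (cs_top X') (\<pi>' ` M.B)) f f'"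
    unfolding homeomorphic_maps_def t using c1 c2 f f' by auto
  then have "homeomorphic_map (subtopology (cs_top X) (\<pi> ` M.B)) (subtopology (cs_top X') (\<pi>' ` M.B)) f"
    by (rule homeomorphic_maps_imp_map)
  moreover have "cs_hol X' h (f x) \<longleftrightarrow> cs_hol X (h \<circ> f) x" if x: "x \<in> \<pi> ` M.B" for h x
  proof -
    obtain z where z: "z \<in> M.B" "x = \<pi> z" using x by auto
    have "cs_hol X (h \<circ> f) x \<longleftrightarrow> hol_at ((h \<circ> f) \<circ> \<pi>) z" using z M.hol by auto
    also have "\<dots> \<longleftrightarrow> hol_at (h \<circ> \<pi>') z"
      by (rule hol_at_cong[of M.B]) (use z f in auto)
    finally show ?thesis using f z M'.hol by auto
  qed
  ultimately have "cs_iso (cs_sub X (\<pi> ` M.B)) (cs_sub X' (\<pi>' ` M.B)) f"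
    using cs_iso_open[OF M.sheafy M'.sheafy M.open_piB M'.open_piB] by auto
  then show ?thesis
    unfolding locally_isomorphic_at_def
    by (intro exI[of _ "\<pi> ` M.B"] exI[of _ "\<pi>' ` M.B"] exI[of _ f] conjI M.open_piB M'.open_piB)
       (use f M.rho in auto)
qed

lemma hol_at_root_scale:
  fixes h :: "complex^'n::finite \<Rightarrow> complex"
  assumes "hol_at h (e *s z)"
  shows "hol_at (\<lambda>x. h (e *s x)) z"
proof -
  have "hol_at (h \<circ> (\<lambda>x. e *s x)) z"
    by (rule hol_at_compose[of UNIV]) (auto intro!: cdiff_intros assms)
  then show ?thesis by (simp add: comp_def)
qed

lemma cyclic_orbit_six: "cyclic_orbit 6 (\<lambda>_. 1) z = {e *s z | e. e ^ 6 = 1}"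
proof -
  define w where "w = exp (2 * of_real pi * \<i> / 6 :: complex)"
  have w: "w ^ j = exp (2 * of_real pi * \<i> * of_nat j / 6)" for j
    by (simp add: w_def flip: exp_of_nat_mult) (simp add: field_simps)
  have "{e::complex. e ^ 6 = 1} = {exp(2 * of_real pi * \<i> * of_nat j / of_nat 6) | j. j < 6}"
    by (rule complex_roots_unity) simp
  then have 1: "{e::complex. e ^ 6 = 1} = {w ^ j | j. j < 6}" by (simp add: w)
  have "w ^ 1 \<in> {w ^ j | j. j < 6}" by (intro CollectI exI[of _ 1]) simp
  then have w6: "w ^ 6 = 1" using 1 by auto
  have "(w ^ k) ^ 6 = 1" for k using w6 by (metis power_mult mult.commute power_one)
  then have *: "e ^ 6 = 1 \<longleftrightarrow> (\<exists>k. e = w ^ k)" for e using 1 by blast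
  have "cyclic_orbit 6 (\<lambda>_. 1) z = {w ^ k *s z | k. True}"
    unfolding cyclic_orbit_def w_def by (simp add: vector_scalar_mult_def)
  also have "\<dots> = {e *s z | e. e ^ 6 = 1}" unfolding * by auto
  finally show ?thesis .
qed

lemma cyclic_orbit_six_eq:
  "cyclic_orbit 6 (\<lambda>_. 1) z = cyclic_orbit 6 (\<lambda>_. 1) z' \<longleftrightarrow> (\<exists>e. e ^ 6 = 1 \<and> z' = e *s z)"
proof
  assume "cyclic_orbit 6 (\<lambda>_. 1) z = cyclic_orbit 6 (\<lambda>_. 1) z'"
  moreover have "z' \<in> cyclic_orbit 6 (\<lambda>_. 1) z'" unfolding cyclic_orbit_six by (auto intro: exI[of _ 1])
  ultimately show "\<exists>e. e ^ 6 = 1 \<and> z' = e *s z" unfolding cyclic_orbit_six by auto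
next
  assume "\<exists>e. e ^ 6 = 1 \<and> z' = e *s z"
  then obtain e where e: "e ^ 6 = 1" "z' = e *s z" by auto
  have e0: "e \<noteq> 0" using e by auto
  show "cyclic_orbit 6 (\<lambda>_. 1) z = cyclic_orbit 6 (\<lambda>_. 1) z'"
    unfolding cyclic_orbit_six e(2)
  proof (intro equalityI subsetI; elim CollectE exE conjE)
    fix x d assume "x = d *s z" "d ^ 6 = 1"
    then show "x \<in> {ea *s (e *s z) |ea. ea ^ 6 = 1}"
      using e e0 by (intro CollectI exI[of _ "d / e"]) (auto simp: power_divide)
  next
    fix x d assume "x = d *s (e *s z)" "d ^ 6 = 1"
    then show "x \<in> {e *s z |e. e ^ 6 = 1}"
      using e by (intro CollectI exI[of _ "d * e"]) (auto simp: power_mult_distrib)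
  qed
qed

text \<open>The action is linear and defined on all of \<complex>^n, so every radius is admissible
  and can be matched with that of another model.\<close>

lemma cyclic_quotient_model:
  assumes "0 < \<rho>"
  shows "sextic_model (cyclic_quotient 6 (\<lambda>_::'n::finite. 1)) (cyclic_orbit 6 (\<lambda>_. 1)) \<rho>"
proof
  let ?p = "cyclic_orbit 6 (\<lambda>_::'n. 1)"
  have top: "cs_top (cyclic_quotient 6 (\<lambda>_::'n. 1)) = quotient_top euclidean ?p"
    by (simp add: cyclic_quotient_def)
  have im: "openin (quotient_top euclidean ?p) (?p ` S)" if "open S" for S
  proof -
    have "{x. ?p x \<in> ?p ` S} = (\<Union>e\<in>{e. e^6 = 1}. (\<lambda>x. e *s x) -` S)"
      unfolding image_iff cyclic_orbit_six_eq by auto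
    moreover have "open ((\<lambda>x. e *s x) -` S)" for e
      by (rule open_vimage[OF that]) (intro continuous_intros)
    ultimately show ?thesis unfolding openin_quotient_top by auto
  qed
  show "openin (cs_top (cyclic_quotient 6 (\<lambda>_::'n. 1))) (?p ` S)" if "open S" for S
    using im[OF that] top by simp
  show "open {z \<in> ball 0 \<rho>. ?p z \<in> U}" if "openin (cs_top (cyclic_quotient 6 (\<lambda>_::'n. 1))) U" for U
  proof -
    have "open {x. ?p x \<in> U}" using that unfolding top openin_quotient_top by auto
    then have "open (ball 0 \<rho> \<inter> {x. ?p x \<in> U})" by auto
    then show ?thesis by (simp add: Int_def)
  qed
  show "?p z = ?p z' \<longleftrightarrow> (\<exists>e. e ^ 6 = 1 \<and> z' = e *s z)" for z z'
    by (rule cyclic_orbit_six_eq)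
  show "cs_hol (cyclic_quotient 6 (\<lambda>_::'n. 1)) h (?p z) \<longleftrightarrow> hol_at (h \<circ> ?p) z" for h z
  proof
    assume "cs_hol (cyclic_quotient 6 (\<lambda>_::'n. 1)) h (?p z)"
    then show "hol_at (h \<circ> ?p) z" unfolding cyclic_quotient_def cs_hol_quotient by auto
  next
    assume "hol_at (h \<circ> ?p) z"
    then obtain N where N: "open N" "z \<in> N" "\<And>y. y \<in> N \<Longrightarrow> hol_at (h \<circ> ?p) y"
      unfolding hol_at_def by blast
    \<comment> \<open>An open set of the quotient pulls back to a saturated set; a root of unity
      carries each of its points into \<open>N\<close>, where holomorphy is known.\<close>
    have "hol_at (h \<circ> ?p) x" if "?p x \<in> ?p ` N" for x
    proof -
      obtain y where y: "y \<in> N" "?p x = ?p y" using \<open>?p x \<in> ?p ` N\<close> by auto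
      then obtain e where e: "e ^ 6 = 1" "y = e *s x" using cyclic_orbit_six_eq by blast
      have "hol_at (\<lambda>x. (h \<circ> ?p) (e *s x)) x" by (rule hol_at_root_scale) (use N(3)[OF y(1)] e in \<open>simp add: comp_def\<close>)
      moreover have "(h \<circ> ?p) (e *s x) = (h \<circ> ?p) x" for x
        using cyclic_orbit_six_eq[of x "e *s x"] e(1) by auto
      ultimately show ?thesis by (simp add: comp_def)
    qed
    then show "cs_hol (cyclic_quotient 6 (\<lambda>_::'n. 1)) h (?p z)"
      unfolding cyclic_quotient_def cs_hol_quotient using im[OF N(1)] N(2) by auto
  qed
  show "sheafy (cyclic_quotient 6 (\<lambda>_::'n. 1))"
    unfolding cyclic_quotient_def by (rule sheafy_quotient[OF sheafy_affine])
qed (use assms in auto)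

context sextic_model begin

lemma center_cyclic_quotient_singularity: "cyclic_quotient_singularity X (\<pi> 0) 6 (\<lambda>_::'n. 1)"
  unfolding cyclic_quotient_singularity_def
  by (rule sextic_models_locally_isomorphic[OF sextic_model_axioms cyclic_quotient_model[OF rho]])

end

section \<open>The centre is not a smooth point\<close>

text \<open>The family is indexed, so its vectors may coincide; a coincidence gives a relation with
  coefficients 1 and -1, and otherwise the dimension count applies.\<close>

lemma nontrivial_linear_relation:
  fixes d :: "nat \<Rightarrow> complex^'n::finite"
  assumes "CARD('n) < m"
  shows "\<exists>l. (\<exists>k<m. l k \<noteq> 0) \<and> (\<forall>j. (\<Sum>k<m. l k * d k $ j) = 0)"
proof (cases "inj_on d {..<m}")
  case True
  have "card (d ` {..<m}) = m" using True by (simp add: card_image)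
  moreover have "vec.dim (d ` {..<m}) \<le> CARD('n)"
    using vec.dim_subset_UNIV[of "d ` {..<m}"] by (simp add: card_cart_basis vec.dimension_def)
  ultimately have "vec.dependent (d ` {..<m})"
    using assms by (intro vec.dependent_biggerset_general) auto
  then obtain u where u: "\<exists>v\<in>d ` {..<m}. u v \<noteq> 0" "(\<Sum>v\<in>d ` {..<m}. u v *s v) = 0"
    using vec.dependent_finite[of "d ` {..<m}"] by auto
  have "(\<Sum>k<m. u (d k) *s d k) = 0" using u(2) sum.reindex[OF True, of "\<lambda>v. u v *s v"] by simp
  then have "(\<Sum>k<m. u (d k) * d k $ j) = 0" for j
    by (metis (mono_tags, lifting) sum_component sum.cong vector_smult_component zero_index)
  then show ?thesis using u(1) by (intro exI[of _ "\<lambda>k. u (d k)"]) auto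
next
  case False
  then obtain k k' where k: "k < m" "k' < m" "k \<noteq> k'" "d k = d k'"
    by (auto simp: inj_on_def)
  define l where "l i = (if i = k then 1 else if i = k' then -1 else 0 :: complex)" for i
  have "(\<Sum>i<m. l i * d i $ j) = 0" for j
  proof -
    have "(\<Sum>i<m. l i * d i $ j) = (\<Sum>i\<in>{k,k'}. l i * d i $ j)"
      by (rule sum.mono_neutral_right) (use k in \<open>auto simp: l_def\<close>)
    then show ?thesis using k by (simp add: l_def)
  qed
  then show ?thesis using k by (intro exI[of _ l]) (auto simp: l_def)
qed

text \<open>On a line through the origin an invariant function is constant up to order 6. The bound
  \<open>M\<close> lives on the disc of radius R/2, and the Taylor estimate on that disc is valid on
  a quarter of it, hence R/8.\<close>

lemma invariant_order_six:
  assumes f: "f holomorphic_on ball 0 R" "0 < R"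
    and inv: "\<And>e t. e ^ 6 = 1 \<Longrightarrow> cmod t < R \<Longrightarrow> f (e * t) = f t"
  obtains C where "\<And>t. cmod t \<le> R / 8 \<Longrightarrow> cmod (f t - f 0) \<le> C * cmod t ^ 6"
proof -
  have "compact (f ` cball 0 (R/2))"
    by (intro compact_continuous_image holomorphic_on_imp_continuous_on[OF holomorphic_on_subset[OF f(1)]])
       (use f(2) in auto)
  then obtain M where M: "\<And>t. cmod t \<le> R/2 \<Longrightarrow> cmod (f t) \<le> M"
    by (meson compact_imp_bounded bounded_iff image_eqI mem_cball_0)
  define a where "a = (deriv ^^ 6) f 0 / fact 6"
  have M0: "0 \<le> M" using M[of 0] f(2) norm_ge_zero order_trans by (metis half_gt_zero less_eq_real_def norm_zero)
  have main: "cmod (f t - f 0) \<le> (cmod a + 2 * M * (4 / R) ^ 7 * R) * cmod t ^ 6" if t: "cmod t \<le> R / 8" for t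
  proof -
    have "cmod (f t - f 0 - a * t ^ 6) \<le> 2 * M * (2 * cmod t / (R/2)) ^ 7"
      unfolding a_def
    proof (rule invariant_Taylor_bound)
      show "f holomorphic_on ball 0 (R/2)" by (rule holomorphic_on_subset[OF f(1)]) (use f(2) in auto)
    qed (use f(2) M inv t in auto)
    also have "\<dots> = 2 * M * (4 / R) ^ 7 * cmod t ^ 6 * cmod t"
      by (simp add: power_divide power_mult_distrib eval_nat_numeral)
    also have "\<dots> \<le> 2 * M * (4 / R) ^ 7 * cmod t ^ 6 * R"
      using t f(2) M0 by (intro mult_left_mono) auto
    finally have "cmod (f t - f 0 - a * t ^ 6) \<le> 2 * M * (4 / R) ^ 7 * R * cmod t ^ 6" by (simp add: mult_ac)
    moreover have "cmod (f t - f 0) \<le> cmod (f t - f 0 - a * t ^ 6) + cmod (a * t ^ 6)"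
      using norm_triangle_ineq[of "f t - f 0 - a * t ^ 6" "a * t ^ 6"] by simp
    moreover have "cmod (a * t ^ 6) = cmod a * cmod t ^ 6" by (simp add: norm_mult norm_power)
    ultimately show ?thesis unfolding distrib_right by linarith
  qed
  show thesis by (rule that) (rule main)
qed

lemma norm_le_sum_components: "norm (x :: complex^'n::finite) \<le> (\<Sum>i\<in>UNIV. cmod (x $ i))"
  by (simp add: norm_vec_def L2_set_le_sum)

context sextic_model begin

text \<open>
  If there were a chart at the centre, its \<open>n\<close> coordinates \<open>F\<close>, being invariant, would vanish to
  order 6, so that modulo order 7 the invariants of degree 6 would be linear combinations of the
  \<open>n\<close> leading forms of \<open>F\<close>.  But already \<open>z\<^sub>a\<^sup>6, z\<^sub>a\<^sup>5 z\<^sub>b, \<dots>, z\<^sub>b\<^sup>6\<close> are seven independent ones.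
\<close>

lemma center_not_regular:
  assumes "2 \<le> CARD('n)" "CARD('n) \<le> 5"
  shows "\<pi> 0 \<notin> regular_locus TYPE('n) X"
proof
  assume "\<pi> 0 \<in> regular_locus TYPE('n) X"
  then obtain U and \<phi> :: "'a \<Rightarrow> complex^'n" where U\<phi>: "(U, \<phi>) \<in> charts X" "\<pi> 0 \<in> U"
    unfolding regular_locus_def by auto
  obtain V where U: "openin (cs_top X) U" and V: "open V" "homeomorphic_map (subtopology (cs_top X) U) (top_of_set V) \<phi>"
    and h\<phi>: "\<And>h x. x \<in> U \<Longrightarrow> hol_at h (\<phi> x) \<longleftrightarrow> cs_hol X (h \<circ> \<phi>) x"
    using U\<phi>(1) unfolding charts_iff[OF sheafy] by auto
  have "topspace (subtopology (cs_top X) U) = U" using openin_subset[OF U] by auto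
  then have inj: "inj_on \<phi> U" using homeomorphic_imp_injective_map[OF V(2)] by simp
  obtain a b :: 'n where ab: "a \<noteq> b"
    using assms(1) by (metis card_2_iff' ex_card)
  have "open {z \<in> B. \<pi> z \<in> U}" by (rule open_vimage[OF U])
  moreover have "0 \<in> {z \<in> B. \<pi> z \<in> U}" using rho U\<phi>(2) by simp
  ultimately obtain r where r: "0 < r" "ball 0 r \<subseteq> {z \<in> B. \<pi> z \<in> U}"
    by (meson open_contains_ball)
  define F where "F z = \<phi> (\<pi> z)" for z
  have F_hol: "cdiff (\<lambda>z. F z $ j) z" if "z \<in> ball 0 r" for j z
  proof -
    have z: "z \<in> B" "\<pi> z \<in> U" using that r(2) by auto
    have "hol_at (\<lambda>c. c $ j) (\<phi> (\<pi> z))" by (rule hol_atI[OF open_UNIV]) auto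
    then have "hol_at ((\<lambda>c. c $ j) \<circ> \<phi> \<circ> \<pi>) z" using h\<phi>[OF z(2)] hol[OF z(1)] by simp
    then show ?thesis using hol_at_imp_cdiff by (simp add: F_def comp_def)
  qed
  have F_inv: "F (e *s z) = F z" if "e ^ 6 = 1" "z \<in> ball 0 r" for e z
    using pi_root[OF that(1), of z] that(2) r(2) by (auto simp: F_def)
  \<comment> \<open>The seven invariant monomials of degree 6 in two coordinates, for k from 0 to 6,
    as functions on \<open>X\<close>. The choice of a preimage is harmless because a root e
    contributes e^6 = 1.\<close>
  define m where "m k x = (let z = inv_into B \<pi> x in z $ a ^ (6 - k) * z $ b ^ k)" for k x
  have m: "m k (\<pi> z) = z $ a ^ (6 - k) * z $ b ^ k" if z: "z \<in> B" and k: "k < 7" for k z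
  proof -
    have "inv_into B \<pi> (\<pi> z) \<in> B" "\<pi> (inv_into B \<pi> (\<pi> z)) = \<pi> z"
      using z by (blast intro: inv_into_into f_inv_into_f)+
    then obtain e where e: "e ^ 6 = 1" "inv_into B \<pi> (\<pi> z) = e *s z" using fibre[OF z] by metis
    have "e ^ (6 - k) * e ^ k = 1" using e(1) k by (simp flip: power_add)
    then show ?thesis unfolding m_def Let_def e(2)
      by (simp add: power_mult_distrib)
  qed
  define H where "H k = m k \<circ> inv_into U \<phi>" for k
  have HF: "H k (F z) = z $ a ^ (6 - k) * z $ b ^ k" if "z \<in> ball 0 r" "k < 7" for k z
  proof -
    have "z \<in> B" "\<pi> z \<in> U" using that r(2) by auto
    then show ?thesis using m[of z k] that(2) inj by (simp add: H_def F_def)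
  qed
  have "cdiff (H k) (F 0)" if k: "k < 7" for k
  proof -
    have "hol_at (m k \<circ> \<pi>) 0 \<longleftrightarrow> hol_at (\<lambda>z. z $ a ^ (6 - k) * z $ b ^ k) 0"
      by (rule hol_at_cong[of B]) (use rho m[OF _ k] in auto)
    moreover have "hol_at (\<lambda>z. z $ a ^ (6 - k) * z $ b ^ k) 0"
      by (rule hol_atI[OF open_UNIV]) (auto intro!: cdiff_intros)
    ultimately have "cs_hol X (m k) (\<pi> 0)" using hol[of 0 "m k"] rho by simp
    moreover have "cs_hol X (m k) (\<pi> 0) \<longleftrightarrow> cs_hol X (H k \<circ> \<phi>) (\<pi> 0)"
      by (rule sheafy_cong[OF sheafy U U\<phi>(2)]) (simp add: H_def inj)
    ultimately have "hol_at (H k) (F 0)" using h\<phi>[OF U\<phi>(2)] by (simp add: F_def)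
    then show ?thesis by (rule hol_at_imp_cdiff)
  qed
  then obtain d where d: "\<And>k. k < 7 \<Longrightarrow> (H k has_derivative (\<lambda>v. \<Sum>i\<in>UNIV. d k $ i * v $ i)) (at (F 0))"
    unfolding cdiff_iff_gradient by metis
  \<comment> \<open>Seven gradients in \<complex>^n are dependent, so some combination
    \<open>L\<close> of the seven functions has zero derivative at the centre of the chart.\<close>
  have "CARD('n) < 7" using assms by simp
  then obtain l where l: "\<exists>k<7. l k \<noteq> 0" "\<And>j. (\<Sum>k<7. l k * d k $ j) = 0"
    using nontrivial_linear_relation[of 7 d] by auto
  define L where "L y = (\<Sum>k<7. l k * H k y)" for y
  have "(L has_derivative (\<lambda>v. \<Sum>k<7. l k * (\<Sum>i\<in>UNIV. d k $ i * v $ i))) (at (F 0))"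
    unfolding L_def by (intro has_derivative_sum has_derivative_mult_right) (use d in auto)
  moreover have "(\<Sum>k<7. l k * (\<Sum>i\<in>UNIV. d k $ i * v $ i)) = 0" for v
  proof -
    have "(\<Sum>k<7. l k * (\<Sum>i\<in>UNIV. d k $ i * v $ i)) = (\<Sum>i\<in>UNIV. (\<Sum>k<7. l k * d k $ i) * v $ i)"
      by (simp add: sum_distrib_left sum_distrib_right mult.assoc) (rule sum.swap)
    then show ?thesis using l(2) by simp
  qed
  ultimately have L0: "(L has_derivative (\<lambda>v. 0)) (at (F 0))" by simp
  \<comment> \<open>On the line spanned by (1, x) the combination L(F) equals t^6 p(x). But F - F 0
    is O(t^6) and L is o of that, so p(x) vanishes for every x, and the polynomial p of degree at
    most 6 is zero.\<close>
  have "(\<Sum>k\<le>6. l k * x ^ k) = 0" for x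
  proof -
    define v :: "complex^'n" where "v = axis a 1 + x *s axis b 1"
    have va: "v $ a = 1" and vb: "v $ b = x" using ab by (auto simp: v_def axis_def)
    have nv: "0 < norm v" using va by auto
    define R where "R = r / norm v"
    have R: "0 < R" using nv r by (simp add: R_def)
    have in_r: "t *s v \<in> ball 0 r" if "cmod t < R" for t
      using that nv by (simp add: norm_vector_smult R_def pos_less_divide_eq)
    have "\<exists>C. \<forall>t. cmod t \<le> R / 8 \<longrightarrow> cmod (F (t *s v) $ j - F 0 $ j) \<le> C * cmod t ^ 6" for j
    proof -
      have h1: "(\<lambda>t. F (t *s v) $ j) holomorphic_on ball 0 R"
        unfolding holomorphic_on_def
      proof
        fix t :: complex assume "t \<in> ball 0 R"
        then have "cdiff (\<lambda>z. F z $ j) (t *s v)" using in_r F_hol by auto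
        then have "(\<lambda>t. F (t *s v) $ j) field_differentiable at t"
          by (rule cdiff_along_curve) (auto intro!: derivative_intros simp: field_differentiable_def)
        then show "(\<lambda>t. F (t *s v) $ j) field_differentiable at t within ball 0 R"
          by (rule field_differentiable_at_within)
      qed
      have h2: "F ((e * t) *s v) $ j = F (t *s v) $ j" if "e ^ 6 = 1" "cmod t < R" for e t
        using F_inv[OF that(1) in_r[OF that(2)]] by (simp add: vector_smult_assoc)
      show ?thesis using invariant_order_six[OF h1 R h2] by (metis vector_smult_lzero)
    qed
    then obtain C where C: "\<And>j t. cmod t \<le> R / 8 \<Longrightarrow> cmod (F (t *s v) $ j - F 0 $ j) \<le> C j * cmod t ^ 6"
      by metis
    define K where "K = \<bar>\<Sum>j\<in>UNIV. C j\<bar> + 1"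
    have K: "norm (F (t *s v) - F 0) \<le> K * cmod t ^ 6" if "cmod t \<le> R / 8" for t
    proof -
      have "norm (F (t *s v) - F 0) \<le> (\<Sum>j\<in>UNIV. cmod ((F (t *s v) - F 0) $ j))" by (rule norm_le_sum_components)
      also have "\<dots> \<le> (\<Sum>j\<in>UNIV. C j * cmod t ^ 6)" using C[OF that] by (intro sum_mono) simp
      also have "\<dots> = (\<Sum>j\<in>UNIV. C j) * cmod t ^ 6" by (simp add: sum_distrib_right)
      also have "\<dots> \<le> K * cmod t ^ 6" by (intro mult_right_mono) (auto simp: K_def)
      finally show ?thesis .
    qed
    have K1: "K \<ge> 1" by (simp add: K_def)
    define p where "p = (\<Sum>k<7. l k * x ^ k)"
    have LF: "L (F (t *s v)) = t ^ 6 * p" if "cmod t < R" for t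
    proof -
      have "L (F (t *s v)) = (\<Sum>k<7. l k * ((t * 1) ^ (6 - k) * (t * x) ^ k))"
        unfolding L_def using HF[OF in_r[OF that]] by (intro sum.cong) (auto simp: va vb)
      also have "\<dots> = (\<Sum>k<7. t ^ 6 * (l k * x ^ k))"
      proof (rule sum.cong)
        fix k :: nat assume "k \<in> {..<7}"
        then have "t ^ (6 - k) * t ^ k = t ^ 6" by (simp flip: power_add)
        then show "l k * ((t * 1) ^ (6 - k) * (t * x) ^ k) = t ^ 6 * (l k * x ^ k)"
          by (simp add: power_mult_distrib)
      qed simp
      finally show ?thesis by (simp add: p_def sum_distrib_left)
    qed
    have LF0: "L (F 0) = 0" using LF[of 0] R by simp
    have "cmod p \<le> \<epsilon> * K" if \<epsilon>: "0 < \<epsilon>" for \<epsilon>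
    proof -
      obtain \<delta> where \<delta>: "0 < \<delta>" "\<And>y. norm (y - F 0) < \<delta> \<Longrightarrow> norm (L y - L (F 0)) \<le> \<epsilon> * norm (y - F 0)"
        using L0 \<epsilon> unfolding has_derivative_at_alt by (auto simp: dist_norm)
      \<comment> \<open>Small enough for the order-six bound (R/8), for t^6 \<le> t, and for
        \<open>K * t ^ 6\<close> to stay below \<delta>.\<close>
      define t where "t = min (min (R / 8) 1) (\<delta> / (2 * K))"
      have t: "0 < t" "t \<le> R / 8" "t \<le> 1" "t \<le> \<delta> / (2 * K)" using R \<delta>(1) K1 by (auto simp: t_def)
      have "K * t ^ 6 \<le> K * t" using t K1 power_decreasing[of 1 6 t] by (intro mult_left_mono) auto
      also have "\<dots> \<le> \<delta> / 2" using t(4) K1 by (simp add: field_simps)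
      finally have 1: "K * t ^ 6 < \<delta>" using \<delta>(1) by linarith
      have n: "norm (F (of_real t *s v) - F 0) \<le> K * t ^ 6" using K[of "of_real t"] t by simp
      have "cmod (of_real t ^ 6 * p) \<le> \<epsilon> * norm (F (of_real t *s v) - F 0)"
        using \<delta>(2)[of "F (of_real t *s v)"] n 1 LF[of "of_real t"] LF0 t R by simp
      also have "\<dots> \<le> \<epsilon> * (K * t ^ 6)" using n \<epsilon> by (intro mult_left_mono) auto
      finally have "t ^ 6 * cmod p \<le> t ^ 6 * (\<epsilon> * K)" using t by (simp add: norm_mult norm_power mult_ac)
      then show ?thesis using t(1) by simp
    qed
    then have "cmod p \<le> \<epsilon>" if "0 < \<epsilon>" for \<epsilon>
      using that K1 by (metis divide_pos_pos less_le_trans nonzero_eq_divide_eq order_less_irrefl zero_less_one)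
    then have "p = 0" using field_le_epsilon[of "cmod p" 0] by simp
    then show ?thesis unfolding p_def by (simp add: lessThan_Suc_atMost[symmetric])
  qed
  then have "\<forall>k\<le>6. l k = 0" using polyfun_eq_0[of l 6] by auto
  then show False using l(1) by auto
qed

lemma regular_locus_eq:
  assumes "2 \<le> CARD('n)" "CARD('n) \<le> 5" "cs_points X = \<pi> ` B"
  shows "regular_locus TYPE('n) X = \<pi> ` (B - {0})"
proof
  have "regular_locus TYPE('n) X \<subseteq> cs_points X"
    unfolding regular_locus_def using openin_subset by (auto simp: charts_def)
  then show "regular_locus TYPE('n) X \<subseteq> \<pi> ` (B - {0})"
    using center_not_regular[OF assms(1,2)] assms(3) by (auto simp del: mem_ball)
  show "\<pi> ` (B - {0}) \<subseteq> regular_locus TYPE('n) X"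
  proof
    fix x assume "x \<in> \<pi> ` (B - {0})"
    then obtain z where z: "z \<in> B" "z \<noteq> 0" "x = \<pi> z" by blast
    then have "x \<in> \<pi> ` piece z" using in_piece by blast
    then show "x \<in> regular_locus TYPE('n) X"
      unfolding regular_locus_def using piece_chart[of z] by blast
  qed
qed

end

subsection \<open>The blow-up of the sextic quotient\<close>

text \<open>
  The resolution is the total space of \<open>\<O>(-6)\<close> over projective space: pairs of a line \<open>\<complex>v\<close> and an
  element \<open>u v\<^sup>6\<close> of its sixth tensor power.  It is realised inside \<open>nat \<Rightarrow> complex\<close> by recording
  the orthogonal projection to \<open>\<complex>v\<close> and the numbers \<open>u v\<^sub>i\<^sup>6\<close>.
\<close>

definition slot :: "('n::finite \<times> 'n) + 'n \<Rightarrow> nat" where "slot = to_nat"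

lemma inj_slot: "inj slot" by (simp add: slot_def)

definition blow_point :: "complex^'n::finite \<Rightarrow> complex \<Rightarrow> nat \<Rightarrow> complex" where
  "blow_point v u k = (if k \<in> range (slot :: ('n \<times> 'n) + 'n \<Rightarrow> nat) then
     (case inv_into UNIV (slot :: ('n \<times> 'n) + 'n \<Rightarrow> nat) k of
        Inl (i, j) \<Rightarrow> v $ i * cnj (v $ j) / of_real ((norm v)\<^sup>2)
      | Inr i \<Rightarrow> u * v $ i ^ 6) else 0)"

abbreviation proj_entry :: "(nat \<Rightarrow> complex) \<Rightarrow> 'n::finite \<Rightarrow> 'n \<Rightarrow> complex" where
  "proj_entry y i j \<equiv> y (slot (Inl (i, j)))"

abbreviation sixth_entry :: "(nat \<Rightarrow> complex) \<Rightarrow> 'n::finite \<Rightarrow> complex" where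
  "sixth_entry y i \<equiv> y (slot (Inr i :: ('n \<times> 'n) + 'n))"

lemma blow_point_proj [simp]:
  "proj_entry (blow_point v u) i j = v $ i * cnj (v $ j) / of_real ((norm v)\<^sup>2)"
  by (simp add: blow_point_def inv_f_f[OF inj_slot])

lemma blow_point_sixth [simp]: "sixth_entry (blow_point v u) i = u * v $ i ^ 6"
  by (simp add: blow_point_def inv_f_f[OF inj_slot])

lemma blow_point_eqI:
  fixes v v' :: "complex^'n::finite"
  assumes "\<And>i j. v $ i * cnj (v $ j) / of_real ((norm v)\<^sup>2) = v' $ i * cnj (v' $ j) / of_real ((norm v')\<^sup>2)"
    "\<And>i. u * v $ i ^ 6 = u' * v' $ i ^ 6"
  shows "blow_point v u = blow_point v' u'"
  by (rule ext) (simp only: blow_point_def assms)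

lemma blow_point_scale:
  fixes v :: "complex^'n::finite"
  assumes "c \<noteq> 0"
  shows "blow_point (c *s v) u = blow_point v (c ^ 6 * u)"
proof (rule blow_point_eqI)
  fix i j
  have "complex_of_real ((norm (c *s v))\<^sup>2) = c * cnj c * of_real ((norm v)\<^sup>2)"
    by (simp only: norm_vector_smult power_mult_distrib of_real_mult complex_norm_square)
  then show "(c *s v) $ i * cnj ((c *s v) $ j) / of_real ((norm (c *s v))\<^sup>2)
      = v $ i * cnj (v $ j) / of_real ((norm v)\<^sup>2)"
    using assms by (simp add: mult_ac)
qed (simp add: power_mult_distrib mult_ac)

text \<open>The standard affine chart of projective space in which the i-th homogeneous coordinate
  is 1. Position i of the coordinate vector is then free and holds the fibre coordinate of the line
  bundle.\<close>

definition chart_vec :: "'n::finite \<Rightarrow> complex^'n \<Rightarrow> complex^'n" where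
  "chart_vec i c = (\<chi> j. if j = i then 1 else c $ j)"

definition chart_inv :: "'n::finite \<Rightarrow> complex^'n \<Rightarrow> nat \<Rightarrow> complex" where
  "chart_inv i c = blow_point (chart_vec i c) (c $ i)"

definition chart_map :: "'n::finite \<Rightarrow> (nat \<Rightarrow> complex) \<Rightarrow> complex^'n" where
  "chart_map i y = (\<chi> j. if j = i then sixth_entry y i else proj_entry y j i / proj_entry y i i)"

definition chart_coord :: "'n::finite \<Rightarrow> complex^'n \<Rightarrow> complex \<Rightarrow> complex^'n" where
  "chart_coord i v u = (\<chi> j. if j = i then u * v $ i ^ 6 else v $ j / v $ i)"

lemma chart_vec_self [simp]: "chart_vec i c $ i = 1" by (simp add: chart_vec_def)

lemma chart_vec_nonzero [simp]: "chart_vec i c \<noteq> 0"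
  by (metis chart_vec_self zero_index zero_neq_one)

lemma chart_map_blow_point:
  assumes "v $ i \<noteq> 0"
  shows "chart_map i (blow_point v u) = chart_coord i v u"
proof -
  have "v \<noteq> 0" using assms by auto
  then show ?thesis using assms by (simp add: chart_map_def chart_coord_def vec_eq_iff)
qed

lemma chart_vec_coord: "v $ i \<noteq> 0 \<Longrightarrow> chart_vec i (chart_coord i v u) = (1 / v $ i) *s v"
  by (simp add: chart_vec_def chart_coord_def vec_eq_iff)

lemma chart_inv_coord: "v $ i \<noteq> 0 \<Longrightarrow> chart_inv i (chart_coord i v u) = blow_point v u"
  by (simp add: chart_inv_def chart_vec_coord blow_point_scale)
     (simp add: chart_coord_def power_divide)

lemma chart_map_inv [simp]: "chart_map i (chart_inv i c) = c"
  by (simp add: chart_inv_def chart_map_blow_point) (simp add: chart_coord_def vec_eq_iff chart_vec_def)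

lemma proj_entry_chart_inv [simp]: "proj_entry (chart_inv i c) i i \<noteq> 0"
  by (simp add: chart_inv_def)

text \<open>The encoding is faithful. In a chart with v_i nonzero, the i-th column of the projection
  gives the ratios v_j / v_i and the i-th sixth power gives the fibre coordinate, so the points are
  exactly the classes of pairs (v, u) under (c v, u) ~ (v, c^6 u).\<close>

lemma blow_point_eqD:
  fixes v v' :: "complex^'n::finite"
  assumes eq: "blow_point v u = blow_point v' u'" and v: "v \<noteq> 0"
  obtains c where "c \<noteq> 0" "v' = c *s v" "u = c ^ 6 * u'"
proof -
  obtain i where i: "v $ i \<noteq> 0" using v by (metis vec_eq_iff zero_index)
  have "proj_entry (blow_point v u) i i \<noteq> 0" using i v by simp
  then have i': "v' $ i \<noteq> 0" unfolding eq by auto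
  have "chart_coord i v u = chart_coord i v' u'"
    using chart_map_blow_point[OF i] chart_map_blow_point[OF i'] eq by metis
  then have *: "(if j = i then u * v $ i ^ 6 else v $ j / v $ i) = (if j = i then u' * v' $ i ^ 6 else v' $ j / v' $ i)" for j
    by (simp add: chart_coord_def vec_eq_iff)
  define c where "c = v' $ i / v $ i"
  have "v' $ j = c * v $ j" for j
    using *[of j] i i' by (cases "j = i") (auto simp: c_def field_simps)
  then have "v' = c *s v" by (simp add: vec_eq_iff)
  moreover have "u = c ^ 6 * u'" using *[of i] i by (simp add: c_def power_divide field_simps)
  moreover have "c \<noteq> 0" using i i' by (simp add: c_def)
  ultimately show thesis using that by blast
qed

text \<open>The bound is invariant under rescaling of (v, u); for u = t^6 it says that t v lies in
  the ball of radius \<rho>.\<close>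

definition blow_points :: "'n::finite itself \<Rightarrow> real \<Rightarrow> (nat \<Rightarrow> complex) set" where
  "blow_points _ \<rho> = {blow_point v u | (v :: complex^'n) u. v \<noteq> 0 \<and> cmod u * norm v ^ 6 < \<rho> ^ 6}"

text \<open>Holomorphy is tested in some affine chart around the point; that every such chart gives
  the same answer is \<open>blow_up_hol_iff\<close>.\<close>

definition blow_up :: "'n::finite itself \<Rightarrow> real \<Rightarrow> (nat \<Rightarrow> complex) cspace" where
  "blow_up N \<rho> = \<lparr> cs_top = top_of_set (blow_points N \<rho>),
     cs_hol = (\<lambda>h y. \<exists>i::'n. proj_entry y i i \<noteq> 0 \<and> hol_at (h \<circ> chart_inv i) (chart_map i y)) \<rparr>"

definition chart_domain :: "'n::finite \<Rightarrow> real \<Rightarrow> (complex^'n) set" where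
  "chart_domain i \<rho> = {c. cmod (c $ i) * norm (chart_vec i c) ^ 6 < \<rho> ^ 6}"

definition chart_range :: "'n::finite \<Rightarrow> real \<Rightarrow> (nat \<Rightarrow> complex) set" where
  "chart_range i \<rho> = {y \<in> blow_points TYPE('n) \<rho>. proj_entry y i i \<noteq> 0}"

lemma cs_top_blow_up [simp]: "cs_top (blow_up N \<rho>) = top_of_set (blow_points N \<rho>)"
  by (simp add: blow_up_def)

lemma blow_points_chart:
  assumes "y \<in> blow_points TYPE('n::finite) \<rho>"
  obtains i :: "'n::finite" where "y \<in> chart_range i \<rho>"
proof -
  obtain v :: "complex^'n" and u where y: "y = blow_point v u" "v \<noteq> 0"
    using assms unfolding blow_points_def by auto
  then obtain i where "v $ i \<noteq> 0" by (metis vec_eq_iff zero_index)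
  then show thesis using that[of i] y assms by (simp add: chart_range_def)
qed

lemma chart_inv_in: "c \<in> chart_domain i \<rho> \<Longrightarrow> chart_inv i c \<in> chart_range i \<rho>"
  unfolding chart_range_def mem_Collect_eq
  by (rule conjI[OF _ proj_entry_chart_inv])
     (auto simp: chart_domain_def chart_inv_def blow_points_def intro!: exI[of _ "chart_vec i c"] exI[of _ "c $ i"])

lemma chart_map_in:
  assumes "y \<in> chart_range i \<rho>"
  shows "chart_map i y \<in> chart_domain i \<rho>" "chart_inv i (chart_map i y) = y"
proof -
  obtain v u where y: "y = blow_point v u" "v \<noteq> 0" "cmod u * norm v ^ 6 < \<rho> ^ 6" "v $ i \<noteq> 0"
    using assms unfolding chart_range_def blow_points_def by auto
  show "chart_inv i (chart_map i y) = y" by (simp add: y chart_map_blow_point chart_inv_coord)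
  have "cmod (u * v $ i ^ 6) * norm ((1 / v $ i) *s v) ^ 6 = cmod u * norm v ^ 6"
    using y(4) by (simp add: norm_vector_smult norm_mult norm_divide norm_power power_divide)
  then show "chart_map i y \<in> chart_domain i \<rho>"
    using y by (simp add: chart_map_blow_point chart_domain_def chart_vec_coord) (simp add: chart_coord_def)
qed

lemma chart_range_subset: "chart_range (i::'n::finite) \<rho> \<subseteq> blow_points TYPE('n) \<rho>"
  by (auto simp: chart_range_def)

lemma continuous_on_blow_point:
  fixes V :: "'b::topological_space \<Rightarrow> complex^'n::finite"
  assumes "continuous_on S V" "continuous_on S U" "\<And>x. x \<in> S \<Longrightarrow> V x \<noteq> 0"
  shows "continuous_on S (\<lambda>x. blow_point (V x) (U x))"
proof (rule continuous_on_coordinatewise_then_product)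
  fix k
  show "continuous_on S (\<lambda>x. blow_point (V x) (U x) k)"
  proof (cases "k \<in> range (slot :: ('n \<times> 'n) + 'n \<Rightarrow> nat)")
    case True
    then obtain s where s: "k = slot (s :: ('n \<times> 'n) + 'n)" by auto
    show ?thesis
    proof (cases s)
      case (Inl p)
      then obtain i j where "s = Inl (i, j)" by (cases p) auto
      then show ?thesis unfolding s using assms(3)
        by (auto intro!: continuous_intros assms)
    next
      case (Inr i)
      then show ?thesis unfolding s by (auto intro!: continuous_intros assms)
    qed
  qed (simp add: blow_point_def)
qed

lemma continuous_on_chart_vec [continuous_intros]:
  "continuous_on S f \<Longrightarrow> continuous_on S (\<lambda>x. chart_vec i (f x))"
  unfolding chart_vec_def
  by (rule continuous_on_vec_lambda, case_tac "j = i") (auto intro!: continuous_intros)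

lemma continuous_on_chart_inv: "continuous_on S (chart_inv i)"
  unfolding chart_inv_def
  by (rule continuous_on_blow_point) (auto intro!: continuous_intros)

lemma continuous_on_entry: "continuous_on S (\<lambda>y::nat \<Rightarrow> complex. y k)"
  by (rule continuous_on_subset[OF continuous_on_product_coordinates]) auto

lemma continuous_on_chart_map: "continuous_on {y. proj_entry y i i \<noteq> 0} (chart_map i)"
proof -
  have "continuous_on {y. proj_entry y i i \<noteq> 0} (\<lambda>y. if j = i then sixth_entry y i else proj_entry y j i / proj_entry y i i)" for j
    by (cases "j = i") (auto intro!: continuous_intros continuous_on_entry)
  then show ?thesis unfolding chart_map_def by (rule continuous_on_vec_lambda)
qed

lemma open_chart_domain: "open (chart_domain i \<rho>)"
  unfolding chart_domain_def
  by (rule open_Collect_less) (auto intro!: continuous_intros)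

lemma openin_chart_range: "openin (top_of_set (blow_points TYPE('n::finite) \<rho>)) (chart_range (i::'n) \<rho>)"
proof -
  have "open {y. proj_entry y i i \<noteq> 0}"
    by (rule open_Collect_neq) (auto intro!: continuous_intros continuous_on_entry)
  then have "openin (top_of_set (blow_points TYPE('n) \<rho>)) (blow_points TYPE('n) \<rho> \<inter> {y. proj_entry y i i \<noteq> 0})"
    by (rule openin_open_Int)
  then show ?thesis by (simp add: chart_range_def Int_def)
qed

lemma openin_chart_image:
  fixes i :: "'n::finite"
  assumes "open N" 
  shows "openin (top_of_set (blow_points TYPE('n) \<rho>)) {y \<in> chart_range i \<rho>. chart_map i y \<in> N}"
proof -
  have "continuous_on (chart_range i \<rho>) (chart_map i)"
    by (rule continuous_on_subset[OF continuous_on_chart_map]) (auto simp: chart_range_def)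
  then have "openin (top_of_set (chart_range i \<rho>)) (chart_range i \<rho> \<inter> chart_map i -` N)"
    using assms by (rule continuous_openin_preimage_gen)
  then have "openin (top_of_set (blow_points TYPE('n) \<rho>)) (chart_range i \<rho> \<inter> chart_map i -` N)"
    by (rule openin_trans[OF _ openin_chart_range])
  then show ?thesis by (simp add: vimage_def Int_def)
qed

lemma open_chart_preimage:
  fixes i :: "'n::finite"
  assumes "openin (top_of_set (blow_points TYPE('n) \<rho>)) U"
  shows "open {c \<in> chart_domain i \<rho>. chart_inv i c \<in> U}"
proof -
  obtain T where T: "open T" "U = blow_points TYPE('n) \<rho> \<inter> T" using assms by (auto simp: openin_open)
  have "open (chart_domain i \<rho> \<inter> chart_inv i -` T)"
    using continuous_on_chart_inv open_chart_domain T(1) by (rule continuous_open_preimage)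
  moreover have "chart_domain i \<rho> \<inter> chart_inv i -` T = {c \<in> chart_domain i \<rho>. chart_inv i c \<in> U}"
    using chart_inv_in[of _ i \<rho>] chart_range_subset[of i \<rho>] by (auto simp: T)
  ultimately show ?thesis by simp
qed

lemma cdiff_chart_coord:
  assumes "\<And>j. cdiff (\<lambda>x. V x $ j) z" "cdiff U z" "V z $ i \<noteq> 0"
  shows "cdiff (\<lambda>x. chart_coord i (V x) (U x) $ j) z"
  by (cases "j = i") (auto simp: chart_coord_def intro!: cdiff_intros assms)

lemma cdiff_chart_vec [simp]: "cdiff (\<lambda>x. chart_vec i x $ j) z"
  by (cases "j = i") (auto simp: chart_vec_def)

text \<open>Holomorphic homogeneous data (V, U) give a holomorphic map to the blow-up. The lemma
  serves both for changes of affine chart and for the map from z to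
  \<open>blow_point z 1\<close>.\<close>

lemma hol_at_blow_point:
  fixes V :: "complex^'m::finite \<Rightarrow> complex^'n::finite"
  assumes N: "open N" "z \<in> N" "\<And>j y. y \<in> N \<Longrightarrow> cdiff (\<lambda>x. V x $ j) y" "\<And>y. y \<in> N \<Longrightarrow> cdiff U y"
    and h: "cs_hol (blow_up TYPE('n) \<rho>) h (blow_point (V z) (U z))" "V z \<noteq> 0"
  shows "hol_at (\<lambda>x. h (blow_point (V x) (U x))) z"
proof -
  obtain i where i: "V z $ i \<noteq> 0" "hol_at (h \<circ> chart_inv i) (chart_map i (blow_point (V z) (U z)))"
    using h unfolding blow_up_def by auto
  have "continuous_on N (\<lambda>x. V x $ i)"
    using N(3) cdiff_continuous continuous_at_imp_continuous_on by blast
  then have "open (N \<inter> (\<lambda>x. V x $ i) -` (- {0}))"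
    by (rule continuous_open_preimage) (use N in auto)
  then have o: "open {x \<in> N. V x $ i \<noteq> 0}" by (simp add: vimage_def Int_def)
  have "hol_at ((h \<circ> chart_inv i) \<circ> (\<lambda>x. chart_coord i (V x) (U x))) z"
  proof (rule hol_at_compose[OF o])
    show "cdiff (\<lambda>x. chart_coord i (V x) (U x) $ j) y" if "y \<in> {x \<in> N. V x $ i \<noteq> 0}" for j y
      by (rule cdiff_chart_coord) (use that N in auto)
    show "hol_at (h \<circ> chart_inv i) (chart_coord i (V z) (U z))"
      using i by (simp add: chart_map_blow_point)
  qed (use i N in auto)
  moreover have "hol_at ((h \<circ> chart_inv i) \<circ> (\<lambda>x. chart_coord i (V x) (U x))) z \<longleftrightarrow>
     hol_at (\<lambda>x. h (blow_point (V x) (U x))) z"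
    by (rule hol_at_cong[OF o]) (use i N in \<open>auto simp: chart_inv_coord\<close>)
  ultimately show ?thesis by simp
qed

lemma blow_up_hol_iff:
  fixes i :: "'n::finite"
  assumes "y \<in> chart_range i \<rho>"
  shows "cs_hol (blow_up TYPE('n) \<rho>) h y \<longleftrightarrow> hol_at (h \<circ> chart_inv i) (chart_map i y)"
proof
  assume h: "cs_hol (blow_up TYPE('n) \<rho>) h y"
  have "y = blow_point (chart_vec i (chart_map i y)) (chart_map i y $ i)"
    using chart_map_in(2)[OF assms] by (simp add: chart_inv_def)
  then have "hol_at (\<lambda>x. h (blow_point (chart_vec i x) (x $ i))) (chart_map i y)"
    using h by (intro hol_at_blow_point[OF open_UNIV UNIV_I, where \<rho> = \<rho>]) auto
  then show "hol_at (h \<circ> chart_inv i) (chart_map i y)" by (simp add: comp_def chart_inv_def)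
next
  assume "hol_at (h \<circ> chart_inv i) (chart_map i y)"
  then show "cs_hol (blow_up TYPE('n) \<rho>) h y"
    using assms by (auto simp: blow_up_def chart_range_def)
qed

lemma sheafy_blow_up: "sheafy (blow_up TYPE('n::finite) \<rho>)"
  unfolding sheafy_def
proof (intro conjI allI impI ballI)
  fix f g :: "(nat \<Rightarrow> complex) \<Rightarrow> complex" and U y
  assume U: "openin (cs_top (blow_up TYPE('n) \<rho>)) U \<and> (\<forall>x\<in>U. f x = g x)" and y: "y \<in> U"
  have U': "openin (top_of_set (blow_points TYPE('n) \<rho>)) U" using U by simp
  then have "y \<in> blow_points TYPE('n) \<rho>" using y openin_subset by fastforce
  then obtain i :: 'n where i: "y \<in> chart_range i \<rho>" by (rule blow_points_chart)
  have "hol_at (f \<circ> chart_inv i) (chart_map i y) \<longleftrightarrow> hol_at (g \<circ> chart_inv i) (chart_map i y)"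
    by (rule hol_at_cong[OF open_chart_preimage[OF U', of i]]) (use chart_map_in[OF i] y U in auto)
  then show "cs_hol (blow_up TYPE('n) \<rho>) f y \<longleftrightarrow> cs_hol (blow_up TYPE('n) \<rho>) g y"
    by (simp add: blow_up_hol_iff[OF i])
next
  fix f y
  assume y: "y \<in> cs_points (blow_up TYPE('n) \<rho>)" and f: "cs_hol (blow_up TYPE('n) \<rho>) f y"
  obtain i :: 'n where i: "y \<in> chart_range i \<rho>" using y blow_points_chart by auto
  obtain N where N: "open N" "chart_map i y \<in> N" "\<And>c. c \<in> N \<Longrightarrow> hol_at (f \<circ> chart_inv i) c"
    using f unfolding blow_up_hol_iff[OF i] unfolding hol_at_def by blast
  show "\<exists>U. openin (cs_top (blow_up TYPE('n) \<rho>)) U \<and> y \<in> U \<and> (\<forall>y\<in>U. cs_hol (blow_up TYPE('n) \<rho>) f y)"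
    by (intro exI[of _ "{y \<in> chart_range i \<rho>. chart_map i y \<in> N}"])
       (use openin_chart_image[OF N(1)] i N blow_up_hol_iff[of _ i \<rho> f] in auto)
qed

lemma homeomorphic_maps_chart:
  fixes i :: "'n::finite"
  shows "homeomorphic_maps (top_of_set (chart_range i \<rho>)) (top_of_set (chart_domain i \<rho>)) (chart_map i) (chart_inv i)"
  unfolding homeomorphic_maps_def
proof (intro conjI)
  show "continuous_map (top_of_set (chart_range i \<rho>)) (top_of_set (chart_domain i \<rho>)) (chart_map i)"
    using continuous_on_subset[OF continuous_on_chart_map, of "chart_range i \<rho>" i] chart_map_in
    by (auto simp: continuous_map_in_subtopology chart_range_def)
  show "continuous_map (top_of_set (chart_domain i \<rho>)) (top_of_set (chart_range i \<rho>)) (chart_inv i)"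
    using continuous_on_chart_inv chart_inv_in by (auto simp: continuous_map_in_subtopology)
qed (use chart_map_in in auto)

lemma blow_up_chart: "(chart_range (i::'n::finite) \<rho>, chart_map i) \<in> charts (blow_up TYPE('n) \<rho>)"
  unfolding charts_iff[OF sheafy_blow_up]
proof (intro conjI allI ballI)
  show "openin (cs_top (blow_up TYPE('n) \<rho>)) (chart_range i \<rho>)" using openin_chart_range by simp
  have "subtopology (cs_top (blow_up TYPE('n) \<rho>)) (chart_range i \<rho>) = top_of_set (chart_range i \<rho>)"
    using chart_range_subset[of i \<rho>] by (simp add: subtopology_subtopology Int_absorb1)
  then show "\<exists>V. open V \<and> homeomorphic_map (subtopology (cs_top (blow_up TYPE('n) \<rho>)) (chart_range i \<rho>)) (top_of_set V) (chart_map i)"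
    using homeomorphic_maps_imp_map[OF homeomorphic_maps_chart[of i \<rho>]] open_chart_domain by metis
  fix h y assume y: "y \<in> chart_range i \<rho>"
  have "hol_at (h \<circ> chart_map i \<circ> chart_inv i) (chart_map i y) \<longleftrightarrow> hol_at h (chart_map i y)"
    by (rule hol_at_cong[OF open_UNIV]) auto
  then show "hol_at h (chart_map i y) \<longleftrightarrow> cs_hol (blow_up TYPE('n) \<rho>) (h \<circ> chart_map i) y"
    by (simp add: blow_up_hol_iff[OF y])
qed

lemma second_countable_euclidean: "second_countable (euclidean :: 'a::second_countable_topology topology)"
proof -
  obtain D :: "'a set set" where D: "countable D" "topological_basis D" using ex_countable_basis by auto
  show ?thesis unfolding second_countable_def
  proof (intro exI[of _ D] conjI ballI allI impI)
    show "openin euclidean V" if "V \<in> D" for V using D(2) that by (simp add: topological_basis_open)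
    show "\<exists>V\<in>D. x \<in> V \<and> V \<subseteq> U" if "openin euclidean U \<and> x \<in> U" for U x
      using topological_basisE[OF D(2)] that by (metis open_openin)
  qed (rule D(1))
qed

text \<open>The Hausdorff property and the countable base are inherited from the ambient product
  space, a benefit of realising the points inside \<open>nat \<Rightarrow> complex\<close>.\<close>

lemma complex_manifold_blow_up: "complex_manifold TYPE('n::finite) (blow_up TYPE('n) \<rho>)"
  unfolding complex_manifold_def
proof (intro conjI)
  show "regular_locus TYPE('n) (blow_up TYPE('n) \<rho>) = cs_points (blow_up TYPE('n) \<rho>)"
  proof
    show "regular_locus TYPE('n) (blow_up TYPE('n) \<rho>) \<subseteq> cs_points (blow_up TYPE('n) \<rho>)"
      unfolding regular_locus_def using openin_subset by (fastforce simp: charts_def)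
    show "cs_points (blow_up TYPE('n) \<rho>) \<subseteq> regular_locus TYPE('n) (blow_up TYPE('n) \<rho>)"
    proof
      fix y assume "y \<in> cs_points (blow_up TYPE('n) \<rho>)"
      then have "y \<in> blow_points TYPE('n) \<rho>" by simp
      then obtain i :: 'n where "y \<in> chart_range i \<rho>" by (rule blow_points_chart)
      then show "y \<in> regular_locus TYPE('n) (blow_up TYPE('n) \<rho>)"
        unfolding regular_locus_def using blow_up_chart[of i \<rho>] by blast
    qed
  qed
  show "\<forall>f g U. openin (cs_top (blow_up TYPE('n) \<rho>)) U \<and> (\<forall>x\<in>U. f x = g x) \<longrightarrow>
        (\<forall>x\<in>U. cs_hol (blow_up TYPE('n) \<rho>) f x \<longleftrightarrow> cs_hol (blow_up TYPE('n) \<rho>) g x)"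
    and "\<forall>f. \<forall>x\<in>cs_points (blow_up TYPE('n) \<rho>). cs_hol (blow_up TYPE('n) \<rho>) f x \<longrightarrow>
        (\<exists>U. openin (cs_top (blow_up TYPE('n) \<rho>)) U \<and> x \<in> U \<and> (\<forall>y\<in>U. cs_hol (blow_up TYPE('n) \<rho>) f y))"
    using sheafy_blow_up[where 'n='n and \<rho> = \<rho>] unfolding sheafy_def by blast+
  show "Hausdorff_space (cs_top (blow_up TYPE('n) \<rho>))"
    unfolding cs_top_blow_up by (rule Hausdorff_space_subtopology) (rule Hausdorff_space_euclidean)
  show "second_countable (cs_top (blow_up TYPE('n) \<rho>))"
    unfolding cs_top_blow_up by (rule second_countable_subtopology) (rule second_countable_euclidean)
qed

section \<open>The blow-down map and its holomorphy\<close>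

text \<open>Away from 0 a branch of the sixth root is given by the logarithm, normalised to take the
  value \<open>t0\<close>. At 0 any choice of roots is continuous, as its modulus is the sixth root
  of |u|.\<close>

lemma root_branch:
  fixes t0 u0 :: complex
  assumes "t0 ^ 6 = u0"
  obtains \<tau> where "\<tau> u0 = t0" "\<And>u. \<tau> u ^ 6 = u" "isCont \<tau> u0" 
    "u0 \<noteq> 0 \<Longrightarrow> \<tau> field_differentiable (at u0)"
proof (cases "u0 = 0")
  case True
  define \<tau> :: "complex \<Rightarrow> complex" where "\<tau> u = (SOME t. t ^ 6 = u)" for u
  have \<tau>: "\<tau> u ^ 6 = u" for u unfolding \<tau>_def by (rule someI_ex[OF exists_sixth_root])
  have \<tau>0: "\<tau> 0 = 0" using \<tau>[of 0] by simp
  have "isCont \<tau> 0"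
    unfolding continuous_at_eps_delta
  proof (intro allI impI)
    fix e :: real assume e: "0 < e"
    have "dist (\<tau> x) (\<tau> 0) < e" if "dist x 0 < e ^ 6" for x
    proof -
      have "cmod (\<tau> x) ^ 6 < e ^ 6" using that \<tau>[of x] by (metis dist_0_norm dist_commute norm_power)
      then show ?thesis using e power_less_imp_less_base[of "cmod (\<tau> x)" 6 e] \<tau>0 by simp
    qed
    then show "\<exists>d>0. \<forall>x. dist x 0 < d \<longrightarrow> dist (\<tau> x) (\<tau> 0) < e" using e by (intro exI[of _ "e ^ 6"]) auto
  qed
  then show ?thesis using that[of \<tau>] \<tau> \<tau>0 True assms by auto
next
  case False
  then have t0: "t0 \<noteq> 0" using assms by auto
  define \<tau> where "\<tau> u = (if u = 0 then 0 else t0 * exp (Ln (u / u0) / 6))" for u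
  have 1: "\<tau> u ^ 6 = u" for u
    using False assms by (simp add: \<tau>_def power_mult_distrib flip: exp_of_nat_mult)
  have 2: "\<tau> u0 = t0" using False by (simp add: \<tau>_def)
  have "((\<lambda>u. t0 * exp (Ln (u / u0) / 6)) has_field_derivative t0 * (exp (Ln (u0 / u0) / 6) * (1 / u0 / (u0 / u0) / 6))) (at u0)"
    using False by (auto intro!: derivative_eq_intros)
  then have "(\<tau> has_field_derivative t0 * (exp (Ln (u0 / u0) / 6) * (1 / u0 / (u0 / u0) / 6))) (at u0)"
    by (rule has_field_derivative_transform_within_open[of _ _ _ "- {0}"]) (use False in \<open>auto simp: \<tau>_def\<close>)
  then have 3: "\<tau> field_differentiable (at u0)" unfolding field_differentiable_def by blast
  then have "isCont \<tau> u0" by (rule field_differentiable_imp_continuous_at)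
  then show ?thesis using that[of \<tau>] 1 2 3 by auto
qed

text \<open>
  The sixth-order coefficient of the restriction of \<open>H\<close> to the line \<open>\<complex>v\<close> depends continuously on
  \<open>v\<close>; it is the derivative of \<open>g\<close> transversal to the zero section, in local coordinates
  \<open>z = t v\<close>, \<open>c\<^sub>i = t\<^sup>6\<close>.
\<close>

lemma cdiff_zero_section:
  fixes H :: "complex^'n::finite \<Rightarrow> complex"
  assumes H: "hol_at H 0" and r0: "0 < r0"
    and inv: "\<And>e z. e ^ 6 = 1 \<Longrightarrow> z \<in> ball 0 r0 \<Longrightarrow> H (e *s z) = H z"
    and O: "open O'" "c0 \<in> O'" "c0 $ i = 0"
    and g: "\<And>c t. c \<in> O' \<Longrightarrow> t ^ 6 = c $ i \<Longrightarrow> g c = H (t *s chart_vec i c)"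
  shows "cdiff g c0"
proof -
  obtain U where U: "open U" "0 \<in> U" "\<And>y. y \<in> U \<Longrightarrow> cdiff H y" using H by (auto simp: hol_at_def)
  obtain R1 where R1: "0 < R1" "ball 0 R1 \<subseteq> U" using U by (meson open_contains_ball)
  define R0 where "R0 = min R1 r0"
  have R0: "0 < R0" "\<And>z. z \<in> ball 0 R0 \<Longrightarrow> cdiff H z" "R0 \<le> r0"
    using R1 r0 U(3) by (auto simp: R0_def)
  have "compact (H ` cball 0 (R0/2))"
  proof (intro compact_continuous_image continuous_at_imp_continuous_on ballI compact_cball)
    fix x :: "complex^'n" assume "x \<in> cball 0 (R0/2)"
    then show "isCont H x" using R0 by (intro cdiff_continuous) auto
  qed
  then obtain M where M: "\<And>z. norm z \<le> R0/2 \<Longrightarrow> cmod (H z) \<le> M"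
    by (meson compact_imp_bounded bounded_iff image_eqI mem_cball_0)
  have M0: "0 \<le> M" using M[of 0] R0(1) by (smt (verit) norm_ge_zero norm_zero half_gt_zero)
  define v0 where "v0 = chart_vec i c0"
  define K where "K = norm v0 + 1"
  have K: "1 \<le> K" by (simp add: K_def)
  define R where "R = R0 / (2 * K)"
  have R: "0 < R" using R0 K by (simp add: R_def)
  have small: "norm (t *s v) < R0 / 2" if "norm v \<le> K" "cmod t < R" for t v
  proof -
    have "norm (t *s v) = cmod t * norm v" by (rule norm_vector_smult)
    also have "\<dots> \<le> cmod t * K" using that by (intro mult_left_mono) auto
    also have "\<dots> < R * K" using that K by (intro mult_strict_right_mono) auto
    also have "R * K = R0 / 2" using K by (simp add: R_def)
    finally show ?thesis .
  qed
  define a where "a v = (deriv ^^ 6) (\<lambda>t. H (t *s v)) 0 / fact 6" for v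
  define C where "C = 2 * M * (2 / R) ^ 7"
  have C0: "0 \<le> C" using M0 R by (simp add: C_def)
  \<comment> \<open>The constant \<open>C\<close> is the same for all directions \<open>v\<close> of
    norm at most \<open>K\<close>, because the one-variable estimate depends only on
    \<open>M\<close> and \<open>R\<close>.\<close>
  have Taylor: "cmod (H (t *s v) - H 0 - a v * t ^ 6) \<le> C * cmod t ^ 7"
    if v: "norm v \<le> K" and t: "cmod t \<le> R / 4" for t v
  proof -
    have "cmod (H (t *s v) - H (0 *s v) - (deriv ^^ 6) (\<lambda>t. H (t *s v)) 0 / fact 6 * t ^ 6) \<le> 2 * M * (2 * cmod t / R) ^ 7"
    proof (rule invariant_Taylor_bound[OF _ R _ _ t])
      show "(\<lambda>t. H (t *s v)) holomorphic_on ball 0 R"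
        unfolding holomorphic_on_def
      proof
        fix t :: complex assume "t \<in> ball 0 R"
        then have "cdiff H (t *s v)" using small[OF v, of t] R0 by auto
        then have "(\<lambda>t. H (t *s v)) field_differentiable at t"
          by (rule cdiff_along_curve) (auto intro!: derivative_intros simp: field_differentiable_def)
        then show "(\<lambda>t. H (t *s v)) field_differentiable at t within ball 0 R"
          by (rule field_differentiable_at_within)
      qed
      show "cmod (H (t *s v)) \<le> M" if "cmod t < R" for t using small[OF v that] M by simp
      show "H ((e * t) *s v) = H (t *s v)" if "e ^ 6 = 1" "cmod t < R" for e t
      proof -
        have "t *s v \<in> ball 0 r0" using small[OF v that(2)] R0(1,3) by auto
        then have "H (e *s (t *s v)) = H (t *s v)" by (rule inv[OF that(1)])
        then show ?thesis by (simp only: vector_smult_assoc)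
      qed
    qed
    then show ?thesis by (simp add: a_def C_def power_divide power_mult_distrib mult_ac)
  qed
  \<comment> \<open>Continuity by comparison at one fixed small t: a(v) t^6 differs from H(t v) -
    H(0) by at most C t^7, and H is continuous at t v0.\<close>
  have a_cont: "\<exists>\<delta>>0. \<forall>v. norm (v - v0) < \<delta> \<longrightarrow> norm v \<le> K \<and> cmod (a v - a v0) \<le> \<epsilon>" if \<epsilon>: "0 < \<epsilon>" for \<epsilon>
  proof -
    define t where "t = min (R / 4) (\<epsilon> / (4 * C + 4))"
    have t: "0 < t" "t \<le> R / 4" "t \<le> \<epsilon> / (4 * C + 4)"
      unfolding t_def using R \<epsilon> C0 by (simp, intro min.cobounded1, intro min.cobounded2)
    have "(4 * C + 4) * t \<le> \<epsilon>" using t(3) C0 by (simp add: pos_le_divide_eq mult.commute)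
    moreover have "4 * C * t \<le> (4 * C + 4) * t" using t by (intro mult_right_mono) auto
    ultimately have Ct: "2 * C * t \<le> \<epsilon> / 2" by simp
    have tc: "cmod (of_real t) = t" using t by simp
    have "cdiff H (of_real t *s v0)"
      using small[of v0 "of_real t"] t R R0 by (auto simp: K_def)
    then have "isCont H (of_real t *s v0)" by (rule cdiff_continuous)
    then obtain d where d: "0 < d" "\<And>z. norm (z - of_real t *s v0) < d \<Longrightarrow> cmod (H z - H (of_real t *s v0)) < \<epsilon> / 2 * t ^ 6"
      unfolding continuous_at_eps_delta dist_norm using \<epsilon> t(1)
      by (metis half_gt_zero mult_pos_pos zero_less_power)
    have "norm v \<le> K \<and> cmod (a v - a v0) \<le> \<epsilon>" if v: "norm (v - v0) < min 1 (d / t)" for v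
    proof
      show vK: "norm v \<le> K" using v norm_triangle_ineq2[of v v0] by (simp add: K_def)
      have "norm (of_real t *s v - of_real t *s v0) = t * norm (v - v0)"
        using norm_vector_smult[of "of_real t" "v - v0"] t(1) by (simp add: vector_ssub_ldistrib)
      also have "\<dots> < d" using v t(1) by (simp add: pos_less_divide_eq mult.commute)
      finally have 1: "cmod (H (of_real t *s v) - H (of_real t *s v0)) < \<epsilon> / 2 * t ^ 6" by (rule d(2))
      have 2: "cmod (H (of_real t *s v) - H 0 - a v * of_real t ^ 6) \<le> C * t ^ 7"
        using Taylor[OF vK, of "of_real t"] t by simp
      have 3: "cmod (H (of_real t *s v0) - H 0 - a v0 * of_real t ^ 6) \<le> C * t ^ 7"
        using Taylor[of v0 "of_real t"] t by (simp add: K_def)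
      have "(a v - a v0) * of_real t ^ 6 = (H (of_real t *s v) - H (of_real t *s v0))
          - (H (of_real t *s v) - H 0 - a v * of_real t ^ 6) + (H (of_real t *s v0) - H 0 - a v0 * of_real t ^ 6)"
        by (simp add: algebra_simps)
      then have "cmod ((a v - a v0) * of_real t ^ 6) \<le> \<epsilon> / 2 * t ^ 6 + C * t ^ 7 + C * t ^ 7"
        using 1 2 3 by (smt (verit) norm_triangle_ineq norm_triangle_ineq4)
      also have "\<dots> = t ^ 6 * (\<epsilon> / 2 + 2 * C * t)" by (simp add: algebra_simps eval_nat_numeral)
      also have "\<dots> \<le> t ^ 6 * \<epsilon>" using Ct t(1) by (intro mult_left_mono) auto
      finally have "t ^ 6 * cmod (a v - a v0) \<le> t ^ 6 * \<epsilon>" using t(1) by (simp add: norm_mult norm_power mult.commute)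
      then show "cmod (a v - a v0) \<le> \<epsilon>" using t(1) by simp
    qed
    moreover have "0 < min 1 (d / t)" using d(1) t(1) by simp
    ultimately show ?thesis by blast
  qed
  \<comment> \<open>With c_i = t^6 the Taylor estimate reads g(c) - g(c0) = a(v) c_i +
    O(|c_i|^(7/6)). Only the fibre direction contributes, since g is constant on the zero
    section.\<close>
  have "(g has_derivative (\<lambda>v. a v0 * v $ i)) (at c0)"
    unfolding has_derivative_at_alt
  proof (intro conjI allI impI)
    show "bounded_linear (\<lambda>v. a v0 * v $ i)" 
      by (intro bounded_linear_const_mult bounded_linear_vec_nth)
    fix e :: real assume e: "0 < e"
    obtain d1 where d1: "0 < d1" "\<And>v. norm (v - v0) < d1 \<Longrightarrow> norm v \<le> K \<and> cmod (a v - a v0) \<le> e / 2"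
      using a_cont[of "e / 2"] e by auto
    have "isCont (chart_vec i) c0"
      using continuous_on_chart_vec[OF continuous_on_id, of UNIV i] by (simp add: continuous_on_eq_continuous_at)
    then obtain d2 where d2: "0 < d2" "\<And>c. norm (c - c0) < d2 \<Longrightarrow> norm (chart_vec i c - v0) < d1"
      unfolding continuous_at_eps_delta dist_norm v0_def using d1(1) by metis
    obtain d3 where d3: "0 < d3" "ball c0 d3 \<subseteq> O'" using O by (meson open_contains_ball)
    \<comment> \<open>A bound for |t| with C s \<le> e/2; the corresponding bound for c_i = t^6 is
      \<open>s ^ 6\<close>.\<close>
    define s where "s = min (R / 4) (e / (2 * C + 2))"
    have s: "0 < s" "s \<le> R / 4" "s \<le> e / (2 * C + 2)"
      unfolding s_def using R e C0 by (simp, intro min.cobounded1, intro min.cobounded2)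
    have "(2 * C + 2) * s \<le> e" using s(3) C0 by (simp add: pos_le_divide_eq mult.commute)
    moreover have "2 * C * s \<le> (2 * C + 2) * s" using s by (intro mult_right_mono) auto
    ultimately have Cs: "C * s \<le> e / 2" by simp
    show "\<exists>d>0. \<forall>c. norm (c - c0) < d \<longrightarrow> norm (g c - g c0 - a v0 * (c - c0) $ i) \<le> e * norm (c - c0)"
    proof (intro exI[of _ "min (min d2 d3) (s ^ 6)"] conjI allI impI)
      show "0 < min (min d2 d3) (s ^ 6)" using d2 d3 s by simp
      fix c assume c: "norm (c - c0) < min (min d2 d3) (s ^ 6)"
      obtain t where t: "t ^ 6 = c $ i" using exists_sixth_root by blast
      have ci: "cmod (c $ i) \<le> norm (c - c0)" using Finite_Cartesian_Product.norm_nth_le[of "c - c0" i] O(3) by simp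
      then have "cmod t ^ 6 \<le> s ^ 6" using c t by (simp flip: norm_power)
      then have ts: "cmod t \<le> s" using s(1) by (simp add: power_mono_iff)
      have v: "norm (chart_vec i c) \<le> K" "cmod (a (chart_vec i c) - a v0) \<le> e / 2"
        using d1(2) d2(2) c by auto
      have "c \<in> O'" using c d3(2) by (auto simp: dist_norm norm_minus_commute)
      then have gc: "g c = H (t *s chart_vec i c)" using g t by blast
      have gc0: "g c0 = H 0" using g[OF O(2), of 0] O(3) by simp
      have "g c - g c0 - a v0 * (c - c0) $ i = (H (t *s chart_vec i c) - H 0 - a (chart_vec i c) * t ^ 6)
          + (a (chart_vec i c) - a v0) * t ^ 6"
        using O(3) t by (simp add: gc gc0 algebra_simps)
      then have "norm (g c - g c0 - a v0 * (c - c0) $ i) \<le> C * cmod t ^ 7 + e / 2 * cmod t ^ 6"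
      proof -
        have 1: "cmod (H (t *s chart_vec i c) - H 0 - a (chart_vec i c) * t ^ 6) \<le> C * cmod t ^ 7"
          by (rule Taylor) (use v ts s in auto)
        have 2: "cmod ((a (chart_vec i c) - a v0) * t ^ 6) \<le> e / 2 * cmod t ^ 6"
          unfolding norm_mult norm_power by (rule mult_right_mono[OF v(2)]) simp
        show ?thesis
          unfolding \<open>g c - g c0 - a v0 * (c - c0) $ i = _\<close> using norm_triangle_mono[OF 1 2] .
      qed
      also have "\<dots> = (C * cmod t + e / 2) * cmod t ^ 6" by (simp add: algebra_simps eval_nat_numeral)
      also have "\<dots> \<le> e * cmod t ^ 6"
      proof (rule mult_right_mono)
        have "C * cmod t \<le> C * s" using ts C0 by (intro mult_left_mono)
        then show "C * cmod t + e / 2 \<le> e" using Cs by simp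
      qed simp
      also have "\<dots> = e * cmod (c $ i)" using t by (simp flip: norm_power)
      also have "\<dots> \<le> e * norm (c - c0)" using ci e by simp
      finally show "norm (g c - g c0 - a v0 * (c - c0) $ i) \<le> e * norm (c - c0)" .
    qed
  qed
  then show ?thesis unfolding complex_differentiable_at_def
    by (intro exI[of _ "\<lambda>v. a v0 * v $ i"] conjI) auto
qed

lemma isCont_open_nbhd:
  "isCont f x \<Longrightarrow> open W \<Longrightarrow> f x \<in> W \<Longrightarrow> \<exists>N. open N \<and> x \<in> N \<and> (\<forall>y\<in>N. f y \<in> W)"
  unfolding continuous_at_open by blast

context sextic_model begin

text \<open>Sends the class of (v, t^6) to the class of t v. The representative is determined up to
  a sixth root of unity, which \<open>\<pi>\<close> does not see.\<close>

definition blow_down :: "(nat \<Rightarrow> complex) \<Rightarrow> 'a" where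
  "blow_down y = \<pi> (SOME z. \<exists>v t. v \<noteq> 0 \<and> y = blow_point v (t ^ 6) \<and> z = t *s v)"

lemma blow_down_eq:
  assumes "v \<noteq> 0" "t *s v \<in> B"
  shows "blow_down (blow_point v (t ^ 6)) = \<pi> (t *s v)"
proof -
  define P where "P z \<longleftrightarrow> (\<exists>v' t'. v' \<noteq> 0 \<and> blow_point v (t ^ 6) = blow_point v' (t' ^ 6) \<and> z = t' *s v')" for z :: "complex^'n"
  define z where "z = (SOME z. P z)"
  have "P (t *s v)" using assms(1) unfolding P_def by blast
  then have "P z" unfolding z_def by (rule someI)
  then obtain v' t' where z: "v' \<noteq> 0" "blow_point v (t ^ 6) = blow_point v' (t' ^ 6)" "z = t' *s v'"
    unfolding P_def by blast
  obtain c where c: "c \<noteq> 0" "v' = c *s v" "t ^ 6 = c ^ 6 * t' ^ 6" by (rule blow_point_eqD[OF z(2) assms(1)])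
  have "\<pi> z = \<pi> (t *s v)"
  proof (cases "t = 0")
    case True
    then have "t' = 0" using c by simp
    then show ?thesis using True z by simp
  next
    case False
    define e where "e = t' * c / t"
    have "e ^ 6 = 1" using c(3) False by (metis e_def divide_self power_divide power_mult_distrib mult.commute power_eq_0_iff)
    moreover have "z = e *s (t *s v)" using z c False by (simp add: e_def vector_smult_assoc)
    ultimately show ?thesis using pi_root[of e "t *s v"] assms(2) by metis
  qed
  then show ?thesis unfolding blow_down_def z_def P_def .
qed

lemma blow_point_in_iff:
  fixes v :: "complex^'n"
  assumes "v \<noteq> 0"
  shows "blow_point v (t ^ 6) \<in> blow_points TYPE('n) \<rho> \<longleftrightarrow> t *s v \<in> B"
proof -
  have *: "cmod (t ^ 6) * norm v ^ 6 < \<rho> ^ 6 \<longleftrightarrow> t *s v \<in> B" for t and v :: "complex^'n"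
  proof -
    have "cmod (t ^ 6) * norm v ^ 6 = norm (t *s v) ^ 6"
      by (simp add: norm_vector_smult norm_power power_mult_distrib)
    moreover have "norm (t *s v) ^ 6 < \<rho> ^ 6 \<longleftrightarrow> norm (t *s v) < \<rho>"
      using rho power_mono_iff[of \<rho> "norm (t *s v)" 6] by (simp flip: not_le)
    ultimately show ?thesis by simp
  qed
  show ?thesis
  proof
    assume "blow_point v (t ^ 6) \<in> blow_points TYPE('n) \<rho>"
    then obtain v' :: "complex^'n" and u' where
      v': "blow_point v (t ^ 6) = blow_point v' u'" "v' \<noteq> 0" "cmod u' * norm v' ^ 6 < \<rho> ^ 6"
      unfolding blow_points_def by blast
    obtain c where c: "c \<noteq> 0" "v' = c *s v" "t ^ 6 = c ^ 6 * u'" by (rule blow_point_eqD[OF v'(1) assms])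
    have "cmod (t ^ 6) * norm v ^ 6 = cmod u' * norm v' ^ 6"
      unfolding c(2,3) by (simp add: norm_vector_smult norm_mult norm_power power_mult_distrib)
    then show "t *s v \<in> B" using v'(3) * by metis
  next
    assume "t *s v \<in> B"
    then show "blow_point v (t ^ 6) \<in> blow_points TYPE('n) \<rho>"
      using * assms unfolding blow_points_def by blast
  qed
qed

text \<open>Unit vectors exhibit the blow-up as an image of sphere times disc, on which properness
  can be tested.\<close>

lemma blow_points_root:
  assumes "y \<in> blow_points TYPE('n) \<rho>"
  obtains v :: "complex^'n" and t where "norm v = 1" "y = blow_point v (t ^ 6)" "t *s v \<in> B"
proof -
  obtain v :: "complex^'n" and u where y: "y = blow_point v u" "v \<noteq> 0"
    using assms unfolding blow_points_def by auto
  define v' where "v' = inverse (of_real (norm v)) *s v"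
  have n: "norm v' = 1" using y(2) by (simp add: v'_def norm_vector_smult norm_inverse)
  have "v = of_real (norm v) *s v'" using y(2) by (simp add: v'_def vector_smult_assoc)
  then have "y = blow_point v' (of_real (norm v) ^ 6 * u)"
    using y blow_point_scale[of "of_real (norm v)" v' u] by simp
  moreover obtain t where "t ^ 6 = of_real (norm v) ^ 6 * u" using exists_sixth_root by blast
  ultimately have y': "y = blow_point v' (t ^ 6)" by simp
  moreover have "v' \<noteq> 0" using n by auto
  ultimately show thesis using that[of v' t] n assms blow_point_in_iff by blast
qed

lemma blow_down_chart_inv:
  assumes "c \<in> chart_domain i \<rho>" "t ^ 6 = c $ i"
  shows "t *s chart_vec i c \<in> B" "blow_down (chart_inv i c) = \<pi> (t *s chart_vec i c)"
proof -
  have e: "chart_inv i c = blow_point (chart_vec i c) (t ^ 6)" using assms(2) by (simp add: chart_inv_def)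
  have "chart_inv i c \<in> blow_points TYPE('n) \<rho>" using chart_inv_in[OF assms(1)] chart_range_subset by blast
  then show "t *s chart_vec i c \<in> B" using blow_point_in_iff[of "chart_vec i c" t] e by simp
  then show "blow_down (chart_inv i c) = \<pi> (t *s chart_vec i c)" using blow_down_eq e by simp
qed

text \<open>A lift of the blow-down to the ball, continuous at one prescribed point. This suffices
  for the continuity of the blow-down there, and it confines nearby values to a set where a given
  function is holomorphic.\<close>

lemma root_section:
  fixes i :: 'n
  obtains G where "isCont G c0" "\<And>c. c \<in> chart_domain i \<rho> \<Longrightarrow> G c \<in> B \<and> blow_down (chart_inv i c) = \<pi> (G c)"
    "\<And>c. \<exists>t. t ^ 6 = c $ i \<and> G c = t *s chart_vec i c"
proof -
  obtain t0 where t0: "t0 ^ 6 = c0 $ i" using exists_sixth_root by blast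
  obtain \<tau> where \<tau>: "\<tau> (c0 $ i) = t0" "\<And>u. \<tau> u ^ 6 = u" "isCont \<tau> (c0 $ i)"
    using root_branch[OF t0] by metis
  have 1: "isCont (\<lambda>c. \<tau> (c $ i)) c0"
    by (rule isCont_o2[where f = "\<lambda>c. c $ i", OF _ \<tau>(3)]) (simp add: continuous_component)
  have 2: "isCont (chart_vec i) c0"
    using continuous_on_chart_vec[OF continuous_on_id, of UNIV i] by (simp add: continuous_on_eq_continuous_at)
  have "isCont (\<lambda>c. \<tau> (c $ i) *s chart_vec i c) c0"
    using tendsto_vector_smult[of "\<lambda>c. \<tau> (c $ i)" _ "at c0" "chart_vec i"] 1 2 unfolding isCont_def by blast
  then show thesis
    by (rule that) (use blow_down_chart_inv \<tau>(2) in blast)+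
qed

lemma continuous_blow_down:
  assumes "cs_points X = \<pi> ` B"
  shows "continuous_map (top_of_set (blow_points TYPE('n) \<rho>)) (cs_top X) blow_down"
  unfolding continuous_map_def
proof (intro conjI allI impI)
  have "blow_down y \<in> \<pi> ` B" if y: "y \<in> blow_points TYPE('n) \<rho>" for y
  proof -
    obtain v :: "complex^'n" and t where "norm v = 1" "y = blow_point v (t ^ 6)" "t *s v \<in> B"
      by (rule blow_points_root[OF y])
    then show ?thesis using blow_down_eq[of v t] by (metis imageI norm_zero zero_neq_one)
  qed
  then show "blow_down \<in> topspace (top_of_set (blow_points TYPE('n) \<rho>)) \<rightarrow> cs_points X"
    using assms by auto
  fix U assume U: "openin (cs_top X) U"
  have W: "open {z \<in> B. \<pi> z \<in> U}" by (rule open_vimage[OF U])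
  have "\<exists>T. openin (top_of_set (blow_points TYPE('n) \<rho>)) T \<and> y \<in> T \<and> T \<subseteq> {y \<in> blow_points TYPE('n) \<rho>. blow_down y \<in> U}"
    if y: "y \<in> blow_points TYPE('n) \<rho>" "blow_down y \<in> U" for y
  proof -
    obtain i :: 'n where i: "y \<in> chart_range i \<rho>" using y(1) by (rule blow_points_chart)
    obtain G where G: "isCont G (chart_map i y)"
      "\<And>c. c \<in> chart_domain i \<rho> \<Longrightarrow> G c \<in> B \<and> blow_down (chart_inv i c) = \<pi> (G c)"
      by (rule root_section[of "chart_map i y" i]) blast
    have "G (chart_map i y) \<in> {z \<in> B. \<pi> z \<in> U}"
      using G(2) chart_map_in[OF i] y(2) by fastforce
    then obtain N where N: "open N" "chart_map i y \<in> N" "\<And>c. c \<in> N \<Longrightarrow> G c \<in> {z \<in> B. \<pi> z \<in> U}"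
      using isCont_open_nbhd[OF G(1) W] by blast
    have "blow_down y' \<in> U" if "y' \<in> chart_range i \<rho>" "chart_map i y' \<in> N" for y'
      using G(2)[of "chart_map i y'"] N(3)[OF that(2)] chart_map_in[OF that(1)] by fastforce
    then show ?thesis
      by (intro exI[of _ "{y \<in> chart_range i \<rho>. chart_map i y \<in> N}"])
         (use openin_chart_image[OF N(1)] i N(2) chart_range_subset[of i \<rho>] in auto)
  qed
  then show "openin (top_of_set (blow_points TYPE('n) \<rho>)) {x \<in> topspace (top_of_set (blow_points TYPE('n) \<rho>)). blow_down x \<in> U}"
    by (subst openin_subopen) auto
qed

text \<open>Off the zero section the blow-down is locally \<open>\<pi>\<close> after a holomorphic
  branch of the sixth root. On the zero section no such branch exists, and invariance under \<mu>_6
  is used through \<open>cdiff_zero_section\<close>.\<close>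

lemma blow_down_hol:
  assumes y: "y \<in> blow_points TYPE('n) \<rho>" and h: "cs_hol X h (blow_down y)"
  shows "cs_hol (blow_up TYPE('n) \<rho>) (h \<circ> blow_down) y"
proof -
  obtain i :: 'n where i: "y \<in> chart_range i \<rho>" using y by (rule blow_points_chart)
  define c0 where "c0 = chart_map i y"
  have c0: "c0 \<in> chart_domain i \<rho>" "chart_inv i c0 = y" using chart_map_in[OF i] by (auto simp: c0_def)
  obtain G where G: "isCont G c0"
    "\<And>c. c \<in> chart_domain i \<rho> \<Longrightarrow> G c \<in> B \<and> blow_down (chart_inv i c) = \<pi> (G c)"
    "\<And>c. \<exists>t. t ^ 6 = c $ i \<and> G c = t *s chart_vec i c"
    by (rule root_section[of c0 i]) blast
  define H where "H = h \<circ> \<pi>"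
  have "hol_at H (G c0)" using h G(2)[OF c0(1)] hol unfolding H_def c0(2) by metis
  then obtain W where W: "open W" "G c0 \<in> W" "\<And>z. z \<in> W \<Longrightarrow> cdiff H z" by (auto simp: hol_at_def)
  obtain N where N: "open N" "c0 \<in> N" "\<And>c. c \<in> N \<Longrightarrow> G c \<in> W"
    using isCont_open_nbhd[OF G(1) W(1,2)] by blast
  have gH: "(h \<circ> blow_down \<circ> chart_inv i) c = H (t *s chart_vec i c)"
    if "c \<in> chart_domain i \<rho>" "t ^ 6 = c $ i" for c t
    using blow_down_chart_inv[OF that] by (simp add: H_def)
  have "hol_at (h \<circ> blow_down \<circ> chart_inv i) c0"
  proof (rule hol_atI)
    show "open (N \<inter> chart_domain i \<rho>)" using N(1) open_chart_domain by auto
    show "c0 \<in> N \<inter> chart_domain i \<rho>" using N(2) c0 by simp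
    fix c assume c: "c \<in> N \<inter> chart_domain i \<rho>"
    then have cW: "G c \<in> W" using N(3) by auto
    obtain t where t: "t ^ 6 = c $ i" "G c = t *s chart_vec i c" using G(3) by blast
    show "cdiff (h \<circ> blow_down \<circ> chart_inv i) c"
    proof (cases "c $ i = 0")
      case True
      then have "G c = 0" using t by simp
      then have "hol_at H 0" using W cW by (auto intro: hol_atI)
      then show ?thesis
      proof (rule cdiff_zero_section[where i = i and ?r0.0 = \<rho> and O' = "chart_domain i \<rho>"])
        show "H (e *s z) = H z" if "e ^ 6 = 1" "z \<in> B" for e z
          using pi_root[OF that] by (simp add: H_def)
        show "(h \<circ> blow_down \<circ> chart_inv i) c = H (t *s chart_vec i c)"
          if "c \<in> chart_domain i \<rho>" "t ^ 6 = c $ i" for c t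
          by (rule gH[OF that])
      qed (use c True rho open_chart_domain in auto)
    next
      case False
      obtain \<tau> where \<tau>: "\<tau> (c $ i) = t" "\<And>u. \<tau> u ^ 6 = u" "\<tau> field_differentiable (at (c $ i))"
        using root_branch[OF t(1)] False by metis
      have "cdiff (H \<circ> (\<lambda>c. \<tau> (c $ i) *s chart_vec i c)) c"
      proof (rule cdiff_compose)
        show "cdiff (\<lambda>c. (\<tau> (c $ i) *s chart_vec i c) $ j) c" for j
          using cdiff_mult[OF cdiff_scalar_compose[OF cdiff_nth \<tau>(3)] cdiff_chart_vec] by simp
        show "cdiff H (\<tau> (c $ i) *s chart_vec i c)" using W(3)[OF cW] \<tau>(1) t(2) by simp
      qed
      moreover have "cdiff (h \<circ> blow_down \<circ> chart_inv i) c \<longleftrightarrow> cdiff (H \<circ> (\<lambda>c. \<tau> (c $ i) *s chart_vec i c)) c"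
        by (rule cdiff_cong[OF open_chart_domain[of i \<rho>]]) (use c gH \<tau>(2) in auto)
      ultimately show ?thesis by simp
    qed
  qed
  then show ?thesis unfolding blow_up_hol_iff[OF i] c0_def .
qed

lemma cs_morphism_blow_down:
  assumes "cs_points X = \<pi> ` B"
  shows "cs_morphism (blow_up TYPE('n) \<rho>) X blow_down"
  unfolding cs_morphism_def using continuous_blow_down[OF assms] blow_down_hol by auto

end

section \<open>Properness and the resolution\<close>

lemma norm_axis: "norm (axis i x :: complex^'n::finite) = cmod x"
proof -
  have "(\<Sum>j\<in>UNIV. (norm ((axis i x :: complex^'n) $ j))\<^sup>2) = (\<Sum>j\<in>UNIV. if j = i then (cmod x)\<^sup>2 else 0)"
    by (rule sum.cong) (auto simp: axis_def)
  then show ?thesis by (simp add: norm_vec_def L2_set_def)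
qed

lemma closedin_sequential_limits:
  fixes S T :: "'a::first_countable_topology set"
  shows "closedin (top_of_set S) T \<longleftrightarrow>
    T \<subseteq> S \<and> (\<forall>x l. (\<forall>n. x n \<in> T) \<and> l \<in> S \<and> x \<longlonglongrightarrow> l \<longrightarrow> l \<in> T)"
proof
  assume "closedin (top_of_set S) T"
  then obtain K where "closed K" "T = S \<inter> K" by (auto simp: closedin_closed)
  then show "T \<subseteq> S \<and> (\<forall>x l. (\<forall>n. x n \<in> T) \<and> l \<in> S \<and> x \<longlonglongrightarrow> l \<longrightarrow> l \<in> T)"
    by (auto intro: closed_sequentially)
next
  assume "T \<subseteq> S \<and> (\<forall>x l. (\<forall>n. x n \<in> T) \<and> l \<in> S \<and> x \<longlonglongrightarrow> l \<longrightarrow> l \<in> T)"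
  then show "closedin (top_of_set S) T"
    unfolding closedin_limpt islimpt_sequential by blast
qed

context sextic_model begin

text \<open>The image of C is that of the set \<open>A\<close> of all root multiples of t v with (v,
  t) in C. Compactness of the sphere and of the set of roots makes \<open>A\<close> closed in the
  ball, and the complement of its image is the image of the open set \<open>B - A\<close>.\<close>

lemma closed_map_polar:
  assumes full: "cs_points X = \<pi> ` B"
  shows "closed_map (top_of_set (sphere (0::complex^'n) 1 \<times> ball (0::complex) \<rho>)) (cs_top X) (\<lambda>(v, t). \<pi> (t *s v))"
  unfolding closed_map_def
proof (intro allI impI)
  define T where "T = sphere (0::complex^'n) 1 \<times> ball (0::complex) \<rho>"
  fix C assume "closedin (top_of_set (sphere (0::complex^'n) 1 \<times> ball (0::complex) \<rho>)) C"
  then have C: "closedin (top_of_set T) C" by (simp add: T_def)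
  then have CT: "C \<subseteq> T" using closedin_imp_subset by blast
  define A where "A = {z \<in> B. \<exists>v t e. (v, t) \<in> C \<and> e ^ 6 = 1 \<and> z = e *s (t *s v)}"
  have "closedin (top_of_set B) A"
    unfolding closedin_sequential_limits
  proof (intro conjI allI impI)
    show "A \<subseteq> B" by (auto simp: A_def)
    fix x l assume "(\<forall>n. x n \<in> A) \<and> l \<in> B \<and> x \<longlonglongrightarrow> l"
    then have xA: "\<And>n. x n \<in> A" and l: "l \<in> B" "x \<longlonglongrightarrow> l" by auto
    have "\<exists>p. (fst p, fst (snd p)) \<in> C \<and> snd (snd p) ^ 6 = 1 \<and> x n = snd (snd p) *s (fst (snd p) *s fst p)" for n
      using xA[of n] unfolding A_def by fastforce
    then obtain p where p: "\<And>n. (fst (p n), fst (snd (p n))) \<in> C" "\<And>n. snd (snd (p n)) ^ 6 = 1"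
      "\<And>n. x n = snd (snd (p n)) *s (fst (snd (p n)) *s fst (p n))" by metis
    \<comment> \<open>The closed disc makes \<open>Q\<close> compact. The limit parameter still lies
      in the open disc, because its modulus is the norm of the limit \<open>l\<close>, a point of
      the ball.\<close>
    define Q where "Q = sphere (0::complex^'n) 1 \<times> cball (0::complex) \<rho> \<times> {e::complex. e ^ 6 = 1}"
    have "compact Q" unfolding Q_def by (intro compact_Times compact_sphere compact_cball finite_imp_compact sixth_roots_finite)
    moreover have "p n \<in> Q" for n
      using p(1,2)[of n] CT by (cases "p n") (auto simp: Q_def T_def)
    ultimately obtain q f where q: "q \<in> Q" "strict_mono f" "(p \<circ> f) \<longlonglongrightarrow> q"
      unfolding compact_def by meson
    obtain v t e where q_eq: "q = (v, t, e)" by (cases q) auto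
    have lim: "(\<lambda>n. fst (p (f n))) \<longlonglongrightarrow> v" "(\<lambda>n. fst (snd (p (f n)))) \<longlonglongrightarrow> t" "(\<lambda>n. snd (snd (p (f n)))) \<longlonglongrightarrow> e"
      using tendsto_fst[OF q(3)] tendsto_fst[OF tendsto_snd[OF q(3)]] tendsto_snd[OF tendsto_snd[OF q(3)]]
      by (auto simp: q_eq comp_def)
    have "(\<lambda>n. snd (snd (p (f n))) *s (fst (snd (p (f n))) *s fst (p (f n)))) \<longlonglongrightarrow> e *s (t *s v)"
      by (intro tendsto_intros lim)
    then have "(\<lambda>n. x (f n)) \<longlonglongrightarrow> e *s (t *s v)" by (simp only: p(3)[symmetric])
    moreover have "(\<lambda>n. x (f n)) \<longlonglongrightarrow> l" using LIMSEQ_subseq_LIMSEQ[OF l(2) q(2)] by (simp add: comp_def)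
    ultimately have leq: "l = e *s (t *s v)" using LIMSEQ_unique by blast
    have ve: "norm v = 1" "e ^ 6 = 1" using q(1) by (auto simp: q_eq Q_def)
    then have "norm l = cmod t" by (simp add: leq norm_vector_smult norm_mult norm_sixth_root)
    then have "(v, t) \<in> T" using l(1) ve by (simp add: T_def)
    moreover have "(\<lambda>n. (fst (p (f n)), fst (snd (p (f n))))) \<longlonglongrightarrow> (v, t)" using lim by (intro tendsto_Pair)
    ultimately have "(v, t) \<in> C"
      using p(1) C[unfolded closedin_sequential_limits, THEN conjunct2, rule_format,
          of "\<lambda>n. (fst (p (f n)), fst (snd (p (f n))))" "(v, t)"] by simp
    then show "l \<in> A" using l(1) leq ve by (auto simp: A_def)
  qed
  then have "openin (top_of_set B) (B - A)" by (rule openin_diff[OF openin_subtopology_self])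
  then have "open (B - A)" using openin_open_eq[OF open_ball] by blast
  then have o: "openin (cs_top X) (\<pi> ` (B - A))" by (rule open_image) auto
  have AB: "A \<subseteq> B" by (auto simp: A_def)
  have sat: "z \<in> A" if zB: "z \<in> B" and zz: "\<pi> z = \<pi> z'" and zA: "z' \<in> A" for z z'
  proof -
    obtain v t e where z': "(v, t) \<in> C" "e ^ 6 = 1" "z' = e *s (t *s v)" "z' \<in> B" using zA by (auto simp: A_def)
    obtain d where "d ^ 6 = 1" "z = d *s z'" using fibre[of z' z] zB zz z'(4) by metis
    then have "z = (d * e) *s (t *s v)" "(d * e) ^ 6 = 1" using z' by (auto simp: vector_smult_assoc power_mult_distrib)
    then show ?thesis using zB z'(1) by (auto simp: A_def)
  qed
  have eq: "(\<lambda>(v, t). \<pi> (t *s v)) ` C = \<pi> ` A"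
  proof (intro equalityI subsetI)
    fix x assume "x \<in> (\<lambda>(v, t). \<pi> (t *s v)) ` C"
    then obtain v t where vt: "(v, t) \<in> C" "x = \<pi> (t *s v)" by auto
    have "t *s v \<in> B" using vt(1) CT by (auto simp: T_def norm_vector_smult)
    then have "t *s v \<in> A" unfolding A_def using vt(1) by (intro CollectI conjI exI[of _ v] exI[of _ t] exI[of _ 1]) auto
    then show "x \<in> \<pi> ` A" using vt by auto
  next
    fix x assume "x \<in> \<pi> ` A"
    then obtain v t e where z: "(v, t) \<in> C" "e ^ 6 = 1" "x = \<pi> (e *s (t *s v))" by (auto simp: A_def)
    have "t *s v \<in> B" using z(1) CT by (auto simp: T_def norm_vector_smult)
    then have "x = \<pi> (t *s v)" using pi_root z by blast
    then show "x \<in> (\<lambda>(v, t). \<pi> (t *s v)) ` C" using z(1) by force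
  qed
  have "cs_points X - \<pi> ` A = \<pi> ` (B - A)"
  proof (intro equalityI subsetI)
    fix x assume "x \<in> cs_points X - \<pi> ` A"
    then show "x \<in> \<pi> ` (B - A)" unfolding full by blast
  next
    fix x assume "x \<in> \<pi> ` (B - A)"
    then obtain z where z: "z \<in> B" "z \<notin> A" "x = \<pi> z" by blast
    have "x \<notin> \<pi> ` A"
    proof
      assume "x \<in> \<pi> ` A"
      then obtain z' where "z' \<in> A" "\<pi> z = \<pi> z'" unfolding z(3) by (rule imageE)
      then have "z \<in> A" by (rule sat[OF z(1), rotated])
      then show False using z(2) by simp
    qed
    moreover have "x \<in> \<pi> ` B" unfolding z(3) by (rule imageI) (rule z(1))
    ultimately show "x \<in> cs_points X - \<pi> ` A" unfolding full by (rule DiffI[rotated])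
  qed
  then show "closedin (cs_top X) ((\<lambda>(v, t). \<pi> (t *s v)) ` C)"
    unfolding eq closedin_def using o AB full by auto
qed

text \<open>Polar coordinates \<open>m\<close> map sphere times disc onto the blow-up. Their
  composite with the blow-down is closed with compact fibres, hence proper, and properness passes to
  the second factor of a composite whose first factor is continuous and onto.\<close>

lemma proper_map_blow_down:
  assumes full: "cs_points X = \<pi> ` B"
  shows "proper_map (cs_top (blow_up TYPE('n) \<rho>)) (cs_top X) blow_down"
proof -
  let ?T = "sphere (0::complex^'n) 1 \<times> ball (0::complex) \<rho>"
  define m where "m = (\<lambda>p :: (complex^'n) \<times> complex. blow_point (fst p) (snd p ^ 6))"
  have inB: "t *s v \<in> B" if "(v, t) \<in> ?T" for v and t :: complex
    using that by (auto simp: norm_vector_smult)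
  have bm: "blow_down (m (v, t)) = \<pi> (t *s v)" if "(v, t) \<in> ?T" for v t
    unfolding m_def fst_conv snd_conv by (rule blow_down_eq) (use inB[OF that] that in auto)
  have "compactin (top_of_set ?T) {p \<in> ?T. \<pi> (snd p *s fst p) = y}" if y: "y \<in> cs_points X" for y
  proof -
    obtain z where z: "z \<in> B" "y = \<pi> z" using y full by auto
    \<comment> \<open>Over \<open>\<pi> z\<close> the radius |t| is forced to be the norm of
      \<open>z\<close>, so the fibre lies over a closed disc smaller than the open one.\<close>
    have "{p \<in> ?T. \<pi> (snd p *s fst p) = y} = (sphere 0 1 \<times> cball 0 (norm z)) \<inter> (\<lambda>p. snd p *s fst p) -` ((\<lambda>e. e *s z) ` {e. e ^ 6 = 1})"
      (is "?L = ?R")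
    proof (intro equalityI subsetI)
      fix p assume "p \<in> ?L"
      then obtain v t where p: "p = (v, t)" "norm v = 1" "(v, t) \<in> ?T" "\<pi> z = \<pi> (t *s v)" using z(2) by (cases p) auto
      then obtain e where e: "e ^ 6 = 1" "t *s v = e *s z" using fibre[OF z(1) inB[OF p(3)]] by auto
      then have "cmod t = norm z" using p(2) norm_vector_smult[of t v] norm_vector_smult[of e z] by (simp add: norm_sixth_root)
      then show "p \<in> ?R" using p e by auto
    next
      fix p assume "p \<in> ?R"
      then obtain v t e where p: "p = (v, t)" "norm v = 1" "cmod t \<le> norm z" "e ^ 6 = 1" "t *s v = e *s z"
        by (cases p) auto
      then show "p \<in> ?L" using z pi_root[OF p(4) z(1)] by auto
    qed
    moreover have "compact ?R"
    proof (rule compact_Int_closed)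
      show "closed ((\<lambda>p. snd p *s fst p) -` ((\<lambda>e. e *s z) ` {e. e ^ 6 = 1}))"
        by (intro closed_vimage finite_imp_closed finite_imageI sixth_roots_finite continuous_intros)
    qed (intro compact_Times compact_sphere compact_cball)
    ultimately show ?thesis by (simp add: compactin_subtopology) blast
  qed
  moreover have "closed_map (top_of_set ?T) (cs_top X) (blow_down \<circ> m)"
    unfolding closed_map_def
  proof (intro allI impI)
    fix C assume C: "closedin (top_of_set ?T) C"
    then have "C \<subseteq> ?T" by (rule closedin_imp_subset)
    then have "(blow_down \<circ> m) ` C = (\<lambda>(v, t). \<pi> (t *s v)) ` C"
      by (intro image_cong[OF refl]) (use bm in auto)
    then show "closedin (cs_top X) ((blow_down \<circ> m) ` C)"
      using closed_map_polar[OF full] C unfolding closed_map_def by simp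
  qed
  moreover have "{p \<in> ?T. (blow_down \<circ> m) p = y} = {p \<in> ?T. \<pi> (snd p *s fst p) = y}" for y
    using bm by auto
  ultimately have "proper_map (top_of_set ?T) (cs_top X) (blow_down \<circ> m)"
    unfolding proper_map_def topspace_euclidean_subtopology by simp
  moreover have "continuous_map (top_of_set ?T) (top_of_set (blow_points TYPE('n) \<rho>)) m"
  proof -
    have "continuous_on ?T m" unfolding m_def
      by (rule continuous_on_blow_point) (auto intro!: continuous_intros)
    moreover have "m p \<in> blow_points TYPE('n) \<rho>" if "p \<in> ?T" for p
    proof -
      obtain v t where p: "p = (v, t)" by (cases p)
      then have "v \<noteq> 0" using that by auto
      then show ?thesis using blow_point_in_iff[of v t] inB[of v t] that unfolding p m_def by simp
    qed
    ultimately show ?thesis by (auto simp: continuous_map_in_subtopology)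
  qed
  moreover have "m ` topspace (top_of_set ?T) = topspace (top_of_set (blow_points TYPE('n) \<rho>))"
  proof -
    have "y \<in> m ` ?T" if y_in: "y \<in> blow_points TYPE('n) \<rho>" for y
    proof -
      obtain v :: "complex^'n" and t where y: "norm v = 1" "y = blow_point v (t ^ 6)" "t *s v \<in> B"
        by (rule blow_points_root[OF y_in])
      then have "(v, t) \<in> ?T" by (simp add: norm_vector_smult)
      then show ?thesis using y(2) by (auto simp: m_def intro!: image_eqI[of _ _ "(v, t)"])
    qed
    then show ?thesis using calculation(2) by (auto simp: continuous_map_def)
  qed
  ultimately show ?thesis
    using proper_map_from_composition_left by (metis cs_top_blow_up)
qed

lemma blow_down_regular:
  assumes "y \<in> blow_points TYPE('n) \<rho>" "blow_down y \<noteq> \<pi> 0"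
  obtains z where "z \<in> B" "z \<noteq> 0" "y = blow_point z 1" "blow_down y = \<pi> z"
proof -
  obtain v :: "complex^'n" and t where y: "norm v = 1" "y = blow_point v (t ^ 6)" "t *s v \<in> B"
    by (rule blow_points_root[OF assms(1)])
  have v0: "v \<noteq> 0" using y(1) by auto
  have b: "blow_down y = \<pi> (t *s v)" using blow_down_eq[OF v0 y(3)] y(2) by simp
  then have "t *s v \<noteq> 0" using assms(2) by metis
  then have t0: "t \<noteq> 0" by auto
  have "y = blow_point (t *s v) 1" using y(2) blow_point_scale[OF t0, of v 1] by simp
  then show thesis using that y(3) \<open>t *s v \<noteq> 0\<close> b by blast
qed

lemma blow_down_point:
  assumes "z \<in> B" "z \<noteq> 0"
  shows "blow_down (blow_point z 1) = \<pi> z" "blow_point z 1 \<in> blow_points TYPE('n) \<rho>"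
  using blow_down_eq[of z 1] blow_point_in_iff[of z 1] assms by auto

lemma blow_point_root: "e ^ 6 = 1 \<Longrightarrow> blow_point (e *s z) 1 = blow_point z 1"
  using blow_point_scale[of e z 1] by (cases "e = 0") auto

text \<open>Off the zero section the inverse is induced by z to \<open>blow_point z 1\<close>, since
  (t v, 1) and (v, t^6) are the same point. There the blow-down is a closed continuous bijection
  onto the regular locus.\<close>

lemma resolution_blow_down:
  assumes full: "cs_points X = \<pi> ` B" and n: "2 \<le> CARD('n)" "CARD('n) \<le> 5"
  shows "resolution TYPE('n) (blow_up TYPE('n) \<rho>) blow_down X"
proof -
  let ?Y = "blow_up TYPE('n) \<rho>"
  define R where "R = \<pi> ` (B - {0})"
  define R' where "R' = {y \<in> cs_points ?Y. blow_down y \<in> R}"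
  have Ro: "openin (cs_top X) R" unfolding R_def
    by (rule open_image) (auto intro!: open_Diff)
  have R_iff: "\<pi> z \<in> R \<longleftrightarrow> z \<noteq> 0" if "z \<in> B" for z
    using that pi_zero_iff unfolding R_def by (auto simp del: mem_ball) (metis pi_zero_iff)
  have cont: "continuous_map (cs_top ?Y) (cs_top X) blow_down" using continuous_blow_down[OF full] by simp
  have R'o: "openin (cs_top ?Y) R'" unfolding R'_def by (rule openin_continuous_map_preimage[OF cont Ro])
  have R'_eq: "R' = (\<lambda>z. blow_point z 1) ` (B - {0})"
  proof (intro equalityI subsetI)
    fix y assume "y \<in> R'"
    then have y: "y \<in> blow_points TYPE('n) \<rho>" "blow_down y \<in> R" by (auto simp: R'_def)
    have "blow_down y \<noteq> \<pi> 0" using y(2) R_iff[of 0] rho by auto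
    then obtain z where "z \<in> B" "z \<noteq> 0" "y = blow_point z 1" by (rule blow_down_regular[OF y(1)])
    then show "y \<in> (\<lambda>z. blow_point z 1) ` (B - {0})" by blast
  next
    fix y assume "y \<in> (\<lambda>z. blow_point z 1) ` (B - {0})"
    then show "y \<in> R'" unfolding R'_def R_def using blow_down_point by (auto simp del: mem_ball)
  qed
  have "cs_iso (cs_sub ?Y R') (cs_sub X R) blow_down"
    unfolding cs_iso_open[OF sheafy_blow_up sheafy R'o Ro]
  proof (intro conjI allI ballI)
    show "homeomorphic_map (subtopology (cs_top ?Y) R') (subtopology (cs_top X) R) blow_down"
    proof (rule bijective_closed_imp_homeomorphic_map)
      show "continuous_map (subtopology (cs_top ?Y) R') (subtopology (cs_top X) R) blow_down"
        unfolding continuous_map_in_subtopology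
        using continuous_map_from_subtopology[OF cont] by (auto simp: R'_def)
      show "closed_map (subtopology (cs_top ?Y) R') (subtopology (cs_top X) R) blow_down"
        by (rule closed_map_restriction[OF proper_imp_closed_map[OF proper_map_blow_down[OF full]]]) (simp add: R'_def)
      have tR': "topspace (subtopology (cs_top ?Y) R') = R'" using openin_subset[OF R'o] by auto
      have tR: "topspace (subtopology (cs_top X) R) = R" using openin_subset[OF Ro] by auto
      show "blow_down ` topspace (subtopology (cs_top ?Y) R') = topspace (subtopology (cs_top X) R)"
        unfolding tR tR' unfolding R'_eq R_def image_image by (rule image_cong[OF refl]) (use blow_down_point in blast)
      show "inj_on blow_down (topspace (subtopology (cs_top ?Y) R'))"
        unfolding tR' unfolding R'_eq
      proof (rule inj_onI)
        fix x y assume "x \<in> (\<lambda>z. blow_point z 1) ` (B - {0})" "y \<in> (\<lambda>z. blow_point z 1) ` (B - {0})"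
          and eq: "blow_down x = blow_down y"
        then obtain z z' where z: "z \<in> B" "z \<noteq> 0" "x = blow_point z 1" "z' \<in> B" "z' \<noteq> 0" "y = blow_point z' 1"
          by blast
        then have "\<pi> z = \<pi> z'" using eq blow_down_point by metis
        then obtain e where "e ^ 6 = 1" "z' = e *s z" using fibre z by blast
        then show "x = y" using z blow_point_root by metis
      qed
    qed
    fix h y assume y: "y \<in> R'"
    then obtain z where z: "z \<in> B" "z \<noteq> 0" "y = blow_point z 1" unfolding R'_eq by blast
    show "cs_hol X h (blow_down y) \<longleftrightarrow> cs_hol ?Y (h \<circ> blow_down) y"
    proof
      assume "cs_hol X h (blow_down y)"
      then show "cs_hol ?Y (h \<circ> blow_down) y" using blow_down_hol y by (auto simp: R'_def)
    next
      assume hy: "cs_hol ?Y (h \<circ> blow_down) y"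
      have "hol_at (\<lambda>x. (h \<circ> blow_down) (blow_point x 1)) z"
        by (rule hol_at_blow_point[OF open_UNIV UNIV_I, where \<rho> = \<rho>])
           (use z hy in \<open>simp_all add: comp_def\<close>)
      moreover have "hol_at (\<lambda>x. (h \<circ> blow_down) (blow_point x 1)) z \<longleftrightarrow> hol_at (h \<circ> \<pi>) z"
        by (rule hol_at_cong[of "B - {0}"]) (use z blow_down_point in \<open>auto simp del: mem_ball\<close>)
      ultimately show "cs_hol X h (blow_down y)" using hol[OF z(1)] z blow_down_point by metis
    qed
  qed
  moreover have "cs_top ?Y closure_of R' = cs_points ?Y"
  proof (intro equalityI closure_of_subset_topspace subsetI)
    fix y assume "y \<in> cs_points ?Y"
    then have y: "y \<in> blow_points TYPE('n) \<rho>" by simp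
    then obtain i :: 'n where i: "y \<in> chart_range i \<rho>" by (rule blow_points_chart)
    define c where "c = chart_map i y"
    have c: "c \<in> chart_domain i \<rho>" "chart_inv i c = y" using chart_map_in[OF i] by (auto simp: c_def)
    have "\<exists>y'. y' \<in> R' \<and> y' \<in> T" if T: "y \<in> T" "openin (cs_top ?Y) T" for T
    proof -
      have "open {c \<in> chart_domain i \<rho>. chart_inv i c \<in> T}" (is "open ?N")
        using open_chart_preimage T(2) by simp
      moreover have "c \<in> ?N" using c T by simp
      ultimately obtain d where d: "0 < d" "ball c d \<subseteq> ?N" by (meson open_contains_ball)
      \<comment> \<open>Density: a small shift of the fibre coordinate, which sits in position i,
        moves the point off the zero section.\<close>
      obtain s :: complex where s: "cmod s < d" "c $ i + s \<noteq> 0"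
      proof (cases "c $ i = 0")
        case True
        then show ?thesis using that[of "of_real (d / 2)"] d(1) by auto
      next
        case False
        then show ?thesis using that[of 0] d(1) by auto
      qed
      define c' where "c' = c + axis i s"
      have "dist c c' < d" using s(1) by (simp add: c'_def dist_norm norm_axis)
      then have c': "c' \<in> chart_domain i \<rho>" "chart_inv i c' \<in> T" using d(2) by auto
      obtain t where t: "t ^ 6 = c' $ i" using exists_sixth_root by blast
      have "c' $ i \<noteq> 0" using s(2) by (simp add: c'_def)
      then have "t \<noteq> 0" using t by auto
      then have "t *s chart_vec i c' \<noteq> 0" by (simp add: vector_mul_eq_0)
      then have "blow_down (chart_inv i c') \<in> R"
        using blow_down_chart_inv[OF c'(1) t] R_iff by metis
      then have "chart_inv i c' \<in> R'" using chart_inv_in[OF c'(1)] chart_range_subset by (auto simp: R'_def)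
      then show ?thesis using c'(2) by blast
    qed
    then show "y \<in> cs_top ?Y closure_of R'" using y by (auto simp: in_closure_of)
  qed
  ultimately show ?thesis
    unfolding resolution_def Let_def regular_locus_eq[OF n full] R_def[symmetric] R'_def[symmetric]
    using complex_manifold_blow_up cs_morphism_blow_down[OF full] proper_map_blow_down[OF full] by blast
qed

end

section \<open>Pluricanonical forms on the blow-up\<close>

lemma jacobian_det_cong_id:
  assumes "open U" "z \<in> U" "\<And>w. w \<in> U \<Longrightarrow> F w = w"
  shows "jacobian_det F z = 1"
proof -
  have "((\<lambda>w. w) has_derivative (\<lambda>w. w)) (at z)" by (rule has_derivative_ident)
  then have "(F has_derivative (\<lambda>w. w)) (at z)"
    by (rule has_derivative_transform_within_open[OF _ assms(1,2)]) (simp add: assms(3))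
  then have "frechet_derivative F (at z) = (\<lambda>w. w)" using frechet_derivative_at by metis
  moreover have "matrix (\<lambda>w::complex^'a. w) = mat 1"
    by (simp add: matrix_def mat_def vec_eq_iff axis_def)
  ultimately show ?thesis by (simp add: jacobian_det_def)
qed

text \<open>On the axis the Jacobian matrix is diagonal, with 6 e^5 for the fibre coordinate and n -
  1 entries 1/e for the ratios. The determinant 6 e^(6-n) carries the discrepancy.\<close>

lemma jacobian_det_chart_coord:
  fixes i :: "'n::finite"
  assumes "e \<noteq> 0" "open U" "axis i e \<in> U" "\<And>w. w \<in> U \<Longrightarrow> F w = chart_coord i w 1"
  shows "jacobian_det F (axis i e) = 6 * e ^ 5 / e ^ (CARD('n) - 1)"
proof -
  define L where "L h = (\<chi> j. if j = i then 6 * e ^ 5 * h $ i else h $ j / e)" for h :: "complex^'n"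
  have nth: "((\<lambda>w::complex^'n. w $ j) has_derivative (\<lambda>h. h $ j)) (at x)" for j x
    by (rule bounded_linear_imp_has_derivative) (rule bounded_linear_vec_nth)
  have "((\<lambda>w. chart_coord i w 1) has_derivative L) (at (axis i e))"
  proof (rule has_derivative_vec)
    fix j
    show "((\<lambda>w. chart_coord i w 1 $ j) has_derivative (\<lambda>h. L h $ j)) (at (axis i e))"
    proof (cases "j = i")
      case True
      have "((\<lambda>w::complex^'n. w $ i ^ 6) has_derivative (\<lambda>h. 6 * e ^ 5 * h $ i)) (at (axis i e))"
        by (rule has_derivative_eq_rhs[OF has_derivative_power[OF nth]]) (auto simp: fun_eq_iff)
      then show ?thesis using True by (simp add: chart_coord_def L_def)
    next
      case False
      have "((\<lambda>w::complex^'n. w $ j / w $ i) has_derivative (\<lambda>h. h $ j / e)) (at (axis i e))"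
        by (rule has_derivative_eq_rhs[OF has_derivative_divide[OF nth nth]])
           (use False assms(1) in \<open>auto simp: fun_eq_iff axis_def divide_inverse\<close>)
      then show ?thesis using False by (simp add: chart_coord_def L_def)
    qed
  qed
  then have "(F has_derivative L) (at (axis i e))"
    by (rule has_derivative_transform_within_open[OF _ assms(2,3)]) (simp add: assms(4))
  then have "frechet_derivative F (at (axis i e)) = L" using frechet_derivative_at by metis
  then have "jacobian_det F (axis i e) = det (matrix L)" by (simp add: jacobian_det_def)
  also have "\<dots> = (\<Prod>j\<in>UNIV. matrix L $ j $ j)"
    by (rule det_diagonal) (auto simp: matrix_def L_def axis_def)
  also have "\<dots> = (\<Prod>j\<in>UNIV. if j = i then 6 * e ^ 5 else 1 / e)"
    by (rule prod.cong) (auto simp: matrix_def L_def axis_def)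
  also have "\<dots> = 6 * e ^ 5 * (\<Prod>j\<in>UNIV - {i}. 1 / e)"
    by (subst prod.remove[of UNIV i]) auto
  also have "\<dots> = 6 * e ^ 5 / e ^ (CARD('n) - 1)"
    by (simp add: card_Diff_singleton power_divide)
  finally show ?thesis .
qed

context sextic_model begin

lemma zero_notin_piece: "z \<in> piece z0 \<Longrightarrow> z \<noteq> 0"
proof
  assume "z \<in> piece z0" "z = 0"
  then have "norm z0 < norm z0 / 4" by (simp add: piece_def dist_norm)
  then show False using norm_ge_zero[of z0] by linarith
qed

lemma piece_in_B: "z \<in> piece z0 \<Longrightarrow> z \<in> B" by (simp add: piece_def)

lemma inv_piece: "w \<in> piece z \<Longrightarrow> inv_into (piece z) \<pi> (\<pi> w) = w"
  by (rule inv_into_f_f[OF inj_piece])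

definition lifted_piece :: "complex^'n \<Rightarrow> (nat \<Rightarrow> complex) set" where
  "lifted_piece z = {y \<in> cs_points (blow_up TYPE('n) \<rho>). blow_down y \<in> \<pi> ` piece z}"

lemma lifted_piece_eq: "lifted_piece z = (\<lambda>w. blow_point w 1) ` piece z"
proof (intro equalityI subsetI)
  fix y assume "y \<in> lifted_piece z"
  then obtain w where y: "y \<in> blow_points TYPE('n) \<rho>" "w \<in> piece z" "blow_down y = \<pi> w"
    by (auto simp: lifted_piece_def)
  have w: "w \<noteq> 0" "w \<in> B" using zero_notin_piece[OF y(2)] piece_in_B[OF y(2)] by auto
  then have "blow_down y \<noteq> \<pi> 0" using y(3) pi_zero_iff by metis
  then obtain x where x: "x \<in> B" "x \<noteq> 0" "y = blow_point x 1" "blow_down y = \<pi> x"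
    by (rule blow_down_regular[OF y(1)])
  then obtain e where "e ^ 6 = 1" "w = e *s x" using fibre[OF x(1) w(2)] y(3) by metis
  then have "y = blow_point w 1" using x(3) blow_point_root by metis
  then show "y \<in> (\<lambda>w. blow_point w 1) ` piece z" using y(2) by blast
next
  fix y assume "y \<in> (\<lambda>w. blow_point w 1) ` piece z"
  then obtain w where w: "y = blow_point w 1" "w \<in> piece z" by blast
  have "w \<noteq> 0" "w \<in> B" using zero_notin_piece[OF w(2)] piece_in_B[OF w(2)] by auto
  then show "y \<in> lifted_piece z" using blow_down_point[of w] w by (auto simp: lifted_piece_def)
qed

lemma inv_piece_blow_down:
  assumes "w \<in> piece z" shows "(inv_into (piece z) \<pi> \<circ> blow_down) (blow_point w 1) = w"
  using assms blow_down_point(1)[OF piece_in_B[OF assms] zero_notin_piece[OF assms]] inv_piece by simp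

text \<open>\<open>extends_pullback\<close> prescribes the form on the blow-up in charts lifted from
  \<open>X\<close>. To compare it with an affine chart through the transition law, the lifts must be
  known to be charts.\<close>

lemma lifted_chart:
  assumes full: "cs_points X = \<pi> ` B"
  shows "(lifted_piece z, inv_into (piece z) \<pi> \<circ> blow_down) \<in> charts (blow_up TYPE('n) \<rho>)"
  unfolding charts_iff[OF sheafy_blow_up]
proof (intro conjI allI ballI)
  let ?\<phi> = "inv_into (piece z) \<pi> \<circ> blow_down"
  have cont: "continuous_map (cs_top (blow_up TYPE('n) \<rho>)) (cs_top X) blow_down"
    using continuous_blow_down[OF full] by simp
  have po: "openin (cs_top X) (\<pi> ` piece z)" by (rule open_image[OF open_piece piece_subset])
  show o: "openin (cs_top (blow_up TYPE('n) \<rho>)) (lifted_piece z)"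
    unfolding lifted_piece_def by (rule openin_continuous_map_preimage[OF cont po])
  have t: "topspace (subtopology (cs_top (blow_up TYPE('n) \<rho>)) (lifted_piece z)) = lifted_piece z"
    using openin_subset[OF o] by auto
  have "homeomorphic_maps (subtopology (cs_top (blow_up TYPE('n) \<rho>)) (lifted_piece z)) (top_of_set (piece z)) ?\<phi> (\<lambda>w. blow_point w 1)"
    unfolding homeomorphic_maps_def t
  proof (intro conjI)
    have "continuous_map (subtopology (cs_top (blow_up TYPE('n) \<rho>)) (lifted_piece z)) (subtopology (cs_top X) (\<pi> ` piece z)) blow_down"
      unfolding continuous_map_in_subtopology
      using continuous_map_from_subtopology[OF cont] by (auto simp: lifted_piece_def)
    moreover have "continuous_map (subtopology (cs_top X) (\<pi> ` piece z)) (top_of_set (piece z)) (inv_into (piece z) \<pi>)"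
      using homeomorphic_maps_inj[OF open_piece piece_subset inj_piece] by (simp add: homeomorphic_maps_def)
    ultimately show "continuous_map (subtopology (cs_top (blow_up TYPE('n) \<rho>)) (lifted_piece z)) (top_of_set (piece z)) ?\<phi>"
      by (rule continuous_map_compose)
    have "continuous_on (piece z) (\<lambda>w. blow_point w 1)"
      by (rule continuous_on_blow_point) (auto intro!: continuous_intros dest: zero_notin_piece)
    moreover have "subtopology (cs_top (blow_up TYPE('n) \<rho>)) (lifted_piece z) = top_of_set (lifted_piece z)"
      using openin_subset[OF o] by (simp add: subtopology_subtopology Int_absorb1)
    ultimately show "continuous_map (top_of_set (piece z)) (subtopology (cs_top (blow_up TYPE('n) \<rho>)) (lifted_piece z)) (\<lambda>w. blow_point w 1)"
      by (auto simp: continuous_map_in_subtopology lifted_piece_eq)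
    show "\<forall>x\<in>lifted_piece z. blow_point (?\<phi> x) 1 = x"
      unfolding lifted_piece_eq using inv_piece_blow_down by auto
    show "\<forall>y\<in>topspace (top_of_set (piece z)). ?\<phi> (blow_point y 1) = y"
      using inv_piece_blow_down by auto
  qed
  then show "\<exists>V. open V \<and> homeomorphic_map (subtopology (cs_top (blow_up TYPE('n) \<rho>)) (lifted_piece z)) (top_of_set V) ?\<phi>"
    using homeomorphic_maps_imp_map open_piece by blast
  fix h y assume "y \<in> lifted_piece z"
  then obtain w where w: "w \<in> piece z" "y = blow_point w 1" unfolding lifted_piece_eq by blast
  have wB: "w \<in> B" "w \<noteq> 0" using piece_in_B[OF w(1)] zero_notin_piece[OF w(1)] by auto
  have \<phi>y: "?\<phi> y = w" using w inv_piece_blow_down by simp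
  show "hol_at h (?\<phi> y) \<longleftrightarrow> cs_hol (blow_up TYPE('n) \<rho>) (h \<circ> ?\<phi>) y"
  proof
    assume h: "hol_at h (?\<phi> y)"
    have "hol_at ((h \<circ> inv_into (piece z) \<pi>) \<circ> \<pi>) w \<longleftrightarrow> hol_at h w"
      by (rule hol_at_cong[OF open_piece w(1)]) (simp add: inv_piece)
    then have "cs_hol X (h \<circ> inv_into (piece z) \<pi>) (blow_down y)"
      using h hol[OF wB(1)] blow_down_point[OF wB] w(2) \<phi>y by simp
    then have "cs_hol (blow_up TYPE('n) \<rho>) ((h \<circ> inv_into (piece z) \<pi>) \<circ> blow_down) y"
      by (rule blow_down_hol[rotated]) (use blow_down_point[OF wB] w in auto)
    then show "cs_hol (blow_up TYPE('n) \<rho>) (h \<circ> ?\<phi>) y" by (simp add: comp_assoc)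
  next
    assume h: "cs_hol (blow_up TYPE('n) \<rho>) (h \<circ> ?\<phi>) y"
    have "hol_at (\<lambda>x. (h \<circ> ?\<phi>) (blow_point x 1)) w"
      by (rule hol_at_blow_point[OF open_UNIV UNIV_I, where \<rho> = \<rho>])
         (use h w wB in \<open>simp_all add: comp_def\<close>)
    moreover have "hol_at (\<lambda>x. (h \<circ> ?\<phi>) (blow_point x 1)) w \<longleftrightarrow> hol_at h w"
      by (rule hol_at_cong[OF open_piece w(1)]) (use inv_piece_blow_down in simp)
    ultimately show "hol_at h (?\<phi> y)" using \<phi>y by simp
  qed
qed

text \<open>
  \<open>S\<close> is the coefficient of the pluricanonical form with respect to \<open>z\<^sub>1, \<dots>, z\<^sub>n\<close>.  In the chart
  \<open>u = z\<^sub>a\<^sup>6, z\<^sub>j / z\<^sub>a\<close> of the blow-up the form acquires the factor \<open>z\<^sub>a\<close> to the power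
  \<open>r (n - 6) < 0\<close>, so a holomorphic extension forces \<open>S \<rightarrow> 0\<close> along the \<open>a\<close>-axis.  The maximum
  principle for \<open>1 / S\<close> on discs parallel to the \<open>b\<close>-axis excludes this.
\<close>

lemma no_holomorphic_extension:
  fixes s :: "('a, 'n) form_coeffs" and t :: "(nat \<Rightarrow> complex, 'n) form_coeffs"
  assumes full: "cs_points X = \<pi> ` B" and n: "2 \<le> CARD('n)" "CARD('n) \<le> 5" and r: "1 \<le> r"
    and s: "pluricanonical_form X r s" "nowhere_vanishing X s"
    and t: "extends_pullback (blow_up TYPE('n) \<rho>) blow_down X r s t"
  shows False
proof -
  define \<kappa> where "\<kappa> z = (\<pi> ` piece z, inv_into (piece z) \<pi>)" for z
  define S where "S z = s (\<kappa> z) (\<pi> z)" for z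
  have \<kappa>: "\<kappa> z \<in> charts X" for z unfolding \<kappa>_def by (rule piece_chart)
  have s_trans: "s (U, \<phi>) x = s (V, \<psi>) x * jacobian_det (\<psi> \<circ> inv_into U \<phi>) (\<phi> x) ^ r"
    if "(U, \<phi>) \<in> charts X" "(V, \<psi>) \<in> charts X" "x \<in> U \<inter> V" for U \<phi> V \<psi> x
    using s(1) that unfolding pluricanonical_form_def by blast
  have t': "pluricanonical_form (blow_up TYPE('n) \<rho>) r t"
    and t_pull: "\<And>U \<phi> y. (U, \<phi>) \<in> charts X \<Longrightarrow> y \<in> cs_points (blow_up TYPE('n) \<rho>) \<Longrightarrow> blow_down y \<in> U \<Longrightarrow>
        t ({y \<in> cs_points (blow_up TYPE('n) \<rho>). blow_down y \<in> U}, \<phi> \<circ> blow_down) y = s (U, \<phi>) (blow_down y)"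
    using t unfolding extends_pullback_def by blast+
  have t_trans: "t (U, \<phi>) x = t (V, \<psi>) x * jacobian_det (\<psi> \<circ> inv_into U \<phi>) (\<phi> x) ^ r"
    if "(U, \<phi>) \<in> charts (blow_up TYPE('n) \<rho>)" "(V, \<psi>) \<in> charts (blow_up TYPE('n) \<rho>)" "x \<in> U \<inter> V" for U \<phi> V \<psi> x
    using t' that unfolding pluricanonical_form_def by blast
  \<comment> \<open>Inverse branches of \<open>\<pi>\<close> over two pieces agree on the overlap,
    so the transition is the identity with Jacobian 1 and the local coefficients glue to one
    function on the punctured ball.\<close>
  have S_local: "S z = s (\<kappa> z0) (\<pi> z)" if z: "z \<in> piece z0" for z z0
  proof -
    have z0: "z \<noteq> 0" "z \<in> B" using zero_notin_piece[OF z] piece_in_B[OF z] by auto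
    have zz: "z \<in> piece z" using in_piece z0 by blast
    have "S z = s (\<pi> ` piece z0, inv_into (piece z0) \<pi>) (\<pi> z) *
        jacobian_det (inv_into (piece z0) \<pi> \<circ> inv_into (\<pi> ` piece z) (inv_into (piece z) \<pi>)) (inv_into (piece z) \<pi> (\<pi> z)) ^ r"
      unfolding S_def \<kappa>_def by (rule s_trans[OF piece_chart piece_chart]) (use z zz in auto)
    moreover have "jacobian_det (inv_into (piece z0) \<pi> \<circ> inv_into (\<pi> ` piece z) (inv_into (piece z) \<pi>)) z = 1"
    proof (rule jacobian_det_cong_id)
      show "open (piece z \<inter> piece z0)" by (intro open_Int open_piece)
      show "z \<in> piece z \<inter> piece z0" using z zz by simp
      fix w assume w: "w \<in> piece z \<inter> piece z0"
      have "inj_on (inv_into (piece z) \<pi>) (\<pi> ` piece z)" by (rule inj_on_inv_into) simp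
      then have "inv_into (\<pi> ` piece z) (inv_into (piece z) \<pi>) (inv_into (piece z) \<pi> (\<pi> w)) = \<pi> w"
        by (rule inv_into_f_f) (use w in auto)
      then show "(inv_into (piece z0) \<pi> \<circ> inv_into (\<pi> ` piece z) (inv_into (piece z) \<pi>)) w = w"
        using w inv_piece by simp
    qed
    ultimately show ?thesis using inv_piece[OF zz] by (simp add: \<kappa>_def)
  qed
  have S_hol: "hol_at S z" if "z \<in> B" "z \<noteq> 0" for z
  proof -
    have zz: "z \<in> piece z" using in_piece that by blast
    have "cs_hol X (s (\<kappa> z)) (\<pi> z)"
      using s(1) piece_chart[of z] zz unfolding pluricanonical_form_def \<kappa>_def by blast
    then have "hol_at (s (\<kappa> z) \<circ> \<pi>) z" using hol[OF that(1)] by simp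
    moreover have "hol_at (s (\<kappa> z) \<circ> \<pi>) z \<longleftrightarrow> hol_at S z"
      by (rule hol_at_cong[OF open_piece zz]) (simp add: S_local)
    ultimately show ?thesis by simp
  qed
  have S_nz: "S z \<noteq> 0" if "z \<in> B" "z \<noteq> 0" for z
    using s(2) piece_chart[of z] in_piece[OF that] unfolding nowhere_vanishing_def S_def \<kappa>_def by blast
  obtain a b :: 'n where ab: "a \<noteq> b" using n(1) by (metis card_2_iff' ex_card)
  define T where "T = t (chart_range a \<rho>, chart_map a) \<circ> chart_inv a"
  have T_hol: "hol_at T 0"
  proof -
    have 0: "0 \<in> chart_domain a \<rho>" using rho by (simp add: chart_domain_def)
    have "cs_hol (blow_up TYPE('n) \<rho>) (t (chart_range a \<rho>, chart_map a)) (chart_inv a 0)"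
      using t' blow_up_chart[of a \<rho>] chart_inv_in[OF 0] unfolding pluricanonical_form_def by blast
    then show ?thesis using blow_up_hol_iff[OF chart_inv_in[OF 0]] by (simp add: T_def)
  qed
  \<comment> \<open>The point over \<open>axis a e\<close> lies both in a lifted chart and in the
    affine chart \<open>a\<close>. Here T is bounded near 0, and the Jacobian 6 e^(6-n) is a
    positive power of e up to the factor 6.\<close>
  have ST: "S (axis a e) = T (axis a (e ^ 6)) * (6 * e ^ 5 / e ^ (CARD('n) - 1)) ^ r" if e: "e \<noteq> 0" "cmod e < \<rho>" for e
  proof -
    define z where "z = axis a e"
    have z: "z \<in> B" "z \<noteq> 0" using e by (auto simp: z_def norm_axis)
    have zz: "z \<in> piece z" using in_piece z by blast
    define y where "y = blow_point z 1"
    have y: "y \<in> blow_points TYPE('n) \<rho>" "blow_down y = \<pi> z" using blow_down_point[OF z] by (auto simp: y_def)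
    have za: "z $ a = e" by (simp add: z_def)
    have "S z = t (lifted_piece z, inv_into (piece z) \<pi> \<circ> blow_down) y"
      using t_pull[OF piece_chart[of z], of y] y zz unfolding S_def \<kappa>_def lifted_piece_def by simp
    also have "\<dots> = t (chart_range a \<rho>, chart_map a) y *
      jacobian_det (chart_map a \<circ> inv_into (lifted_piece z) (inv_into (piece z) \<pi> \<circ> blow_down)) ((inv_into (piece z) \<pi> \<circ> blow_down) y) ^ r"
    proof (rule t_trans[OF lifted_chart[OF full] blow_up_chart])
      have "y \<in> lifted_piece z" unfolding lifted_piece_eq y_def using zz by blast
      moreover have "y \<in> chart_range a \<rho>" unfolding chart_range_def using y(1) za e z by (simp add: y_def)
      ultimately show "y \<in> lifted_piece z \<inter> chart_range a \<rho>" by simp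
    qed
    also have "(inv_into (piece z) \<pi> \<circ> blow_down) y = axis a e"
      using inv_piece_blow_down[OF zz] by (simp only: y_def z_def)
    also have "jacobian_det (chart_map a \<circ> inv_into (lifted_piece z) (inv_into (piece z) \<pi> \<circ> blow_down)) (axis a e)
        = 6 * e ^ 5 / e ^ (CARD('n) - 1)"
    proof (rule jacobian_det_chart_coord[OF e(1)])
      have "open {w :: complex^'n. w $ a \<noteq> 0}" by (rule open_Collect_neq) (auto intro!: continuous_intros)
      then show "open (piece z \<inter> {w. w $ a \<noteq> 0})" by (intro open_Int open_piece)
      show "axis a e \<in> piece z \<inter> {w. w $ a \<noteq> 0}" using zz e(1) by (simp add: z_def)
      fix w assume w: "w \<in> piece z \<inter> {w. w $ a \<noteq> 0}"
      have "inj_on (inv_into (piece z) \<pi> \<circ> blow_down) (lifted_piece z)"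
        unfolding lifted_piece_eq using inv_piece_blow_down by (auto intro!: inj_onI)
      then have "inv_into (lifted_piece z) (inv_into (piece z) \<pi> \<circ> blow_down) ((inv_into (piece z) \<pi> \<circ> blow_down) (blow_point w 1)) = blow_point w 1"
        by (rule inv_into_f_f) (use w in \<open>auto simp: lifted_piece_eq\<close>)
      then show "(chart_map a \<circ> inv_into (lifted_piece z) (inv_into (piece z) \<pi> \<circ> blow_down)) w = chart_coord a w 1"
        using inv_piece_blow_down[of w z] w chart_map_blow_point[of w a 1] by simp
    qed
    also have "t (chart_range a \<rho>, chart_map a) y = T (axis a (e ^ 6))"
    proof -
      have "chart_coord a z 1 = axis a (e ^ 6)"
        by (auto simp: chart_coord_def z_def vec_eq_iff axis_def)
      then have "chart_inv a (axis a (e ^ 6)) = y" using chart_inv_coord[of z a 1] za e(1) by (simp add: y_def)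
      then show ?thesis by (simp add: T_def)
    qed
    finally show ?thesis by (simp add: z_def)
  qed
  \<comment> \<open>The norm of \<open>l (e, x)\<close> is at most 2 d, and a third of the radius
    keeps it inside the ball.\<close>
  define d where "d = \<rho> / 3"
  have d: "0 < d" using rho by (simp add: d_def)
  define l where "l p = axis a (fst p) + axis b (snd p)" for p :: "complex \<times> complex"
  have lB: "l (e, x) \<in> B" if "cmod e \<le> d" "cmod x \<le> d" for e x
  proof -
    have "norm (l (e, x)) \<le> cmod e + cmod x" unfolding l_def using norm_triangle_ineq[of "axis a e" "axis b x"] by (simp add: norm_axis)
    then show ?thesis using that rho by (simp add: d_def)
  qed
  have l_nth: "l (e, x) $ a = e" "l (e, x) $ b = x" for e x using ab by (auto simp: l_def axis_def)
  have l_nz: "l (e, x) \<noteq> 0" if "e \<noteq> 0 \<or> x \<noteq> 0" for e x using that l_nth by (metis zero_index)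
  have l_cont: "continuous_on A l" for A
    unfolding l_def by (intro continuous_intros bounded_linear.continuous_on[OF bounded_linear_axis])
  have S_cont: "isCont S z" if "z \<in> B" "z \<noteq> 0" for z
    by (rule cdiff_continuous[OF hol_at_imp_cdiff[OF S_hol[OF that]]])
  \<comment> \<open>The compact set |e| \<le> d, |x| = d avoids the origin, so |S| has a positive
    minimum on it. As e = 0 is included, the bound is uniform in e.\<close>
  obtain m where m: "0 < m" "\<And>e x. cmod e \<le> d \<Longrightarrow> cmod x = d \<Longrightarrow> m \<le> cmod (S (l (e, x)))"
  proof -
    let ?K = "cball (0::complex) d \<times> sphere (0::complex) d"
    have "compact ?K" by (intro compact_Times compact_cball compact_sphere)
    moreover have "continuous_on ?K (\<lambda>p. cmod (S (l p)))"
    proof (rule continuous_on_norm, rule continuous_on_compose2[OF _ l_cont])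
      show "continuous_on (l ` ?K) S"
      proof (intro continuous_at_imp_continuous_on ballI)
        fix z assume "z \<in> l ` ?K"
        then obtain e x where "z = l (e, x)" "cmod e \<le> d" "cmod x = d" by auto
        then show "isCont S z" using S_cont lB[of e x] l_nz[of e x] d by auto
      qed
    qed auto
    moreover have "(0, of_real d) \<in> ?K" using d by simp
    ultimately obtain p where p: "p \<in> ?K" "\<And>q. q \<in> ?K \<Longrightarrow> cmod (S (l p)) \<le> cmod (S (l q))"
      using continuous_attains_inf[of ?K "\<lambda>p. cmod (S (l p))"] by blast
    show thesis
    proof (rule that)
      obtain e x where "p = (e, x)" "cmod e \<le> d" "cmod x = d" using p(1) by (cases p) auto
      then show "0 < cmod (S (l p))" using S_nz lB[of e x] l_nz[of e x] d by auto
      show "cmod (S (l p)) \<le> cmod (S (l (e, x)))" if "cmod e \<le> d" "cmod x = d" for e x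
        by (rule p(2)) (use that in auto)
    qed
  qed
  \<comment> \<open>For e nonzero the whole disc of points \<open>l (e, x)\<close> misses the
    origin, so 1/S is holomorphic on it and its value at x = 0 is bounded by the boundary value
    1/m.\<close>
  have lower: "m \<le> cmod (S (axis a e))" if e: "e \<noteq> 0" "cmod e \<le> d" for e
  proof -
    have fd: "(\<lambda>x. 1 / S (l (e, x))) field_differentiable (at x)" if "cmod x \<le> d" for x
    proof -
      have "(\<lambda>x. S (l (e, x))) field_differentiable (at x)"
      proof (rule cdiff_along_curve)
        show "cdiff S (l (e, x))" using S_hol lB e that l_nz by (intro hol_at_imp_cdiff) auto
        show "(\<lambda>x. l (e, x) $ i) field_differentiable (at x)" for i
          by (cases "i = b"; cases "i = a") (auto simp: l_def axis_def intro!: derivative_intros field_differentiable_add)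
      qed
      then show ?thesis
        using S_nz[of "l (e, x)"] lB[OF e(2) that] l_nz e(1) by (intro field_differentiable_divide) auto
    qed
    have "cmod (1 / S (l (e, 0))) \<le> 1 / m"
    proof (rule maximum_modulus_frontier[where S = "cball 0 d" and f = "\<lambda>x. 1 / S (l (e, x))" and \<xi> = 0])
      show "(\<lambda>x. 1 / S (l (e, x))) holomorphic_on interior (cball 0 d)"
        unfolding holomorphic_on_def using fd by (auto intro: field_differentiable_at_within)
      show "continuous_on (closure (cball 0 d)) (\<lambda>x. 1 / S (l (e, x)))"
        using fd by (auto intro!: continuous_at_imp_continuous_on field_differentiable_imp_continuous_at)
      show "cmod (1 / S (l (e, x))) \<le> 1 / m" if "x \<in> frontier (cball 0 d)" for x
        using frac_le[of 1 1 m "cmod (S (l (e, x)))"] m(1) m(2)[OF e(2), of x] that d by (simp add: norm_divide)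
    qed (use d in auto)
    moreover have "l (e, 0) = axis a e" by (simp add: l_def axis_def vec_eq_iff)
    moreover have "S (axis a e) \<noteq> 0" using S_nz lB[OF e(2), of 0] l_nz[of e 0] d e(1) calculation(2) by auto
    ultimately show ?thesis using m(1) by (simp add: norm_divide field_simps)
  qed
  have "isCont T 0" by (rule cdiff_continuous[OF hol_at_imp_cdiff[OF T_hol]])
  then obtain \<delta> where \<delta>: "0 < \<delta>" "\<And>c. norm c < \<delta> \<Longrightarrow> cmod (T c - T 0) < 1"
    unfolding continuous_at_eps_delta dist_norm by (metis diff_zero zero_less_one)
  define M where "M = cmod (T 0) + 1"
  have TM: "cmod (T c) \<le> M" if "norm c < \<delta>" for c
    using \<delta>(2)[OF that] norm_triangle_ineq2[of "T c" "T 0"] by (simp add: M_def)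
  have M0: "0 < M" by (simp add: M_def add_nonneg_pos)
  have min4: "min (min p q) (min x y) \<le> p \<and> min (min p q) (min x y) \<le> q \<and>
      min (min p q) (min x y) \<le> x \<and> min (min p q) (min x y) \<le> y" for p q x y :: real
    by (auto simp: min_le_iff_disj)
  \<comment> \<open>Besides keeping the point within reach of both bounds, e \<le> 1/6 makes 6 e
    \<le> 1, so that raising to the power r \<ge> 1 only decreases it, and e \<le> m / (12 M) makes
    M * 6 e at most m/2, contradicting the lower bound.\<close>
  define e where "e = min (min (d / 2) (1 / 6)) (min (\<delta> / 2) (m / (12 * M)))"
  have e_pos: "0 < e" using d \<delta>(1) m(1) M0 by (simp add: e_def)
  have e: "0 < e" "e < d" "e \<le> 1 / 6" "e < \<delta>" "e \<le> m / (12 * M)"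
    using e_pos min4[of "d / 2" "1 / 6" "\<delta> / 2" "m / (12 * M)", folded e_def] d \<delta>(1) by linarith+
  define c where "c = complex_of_real e"
  have cn: "cmod c = e" "c \<noteq> 0" using e(1) by (auto simp: c_def)
  have "e ^ 6 \<le> e ^ 1" using e by (intro power_decreasing) auto
  then have "norm (axis a (c ^ 6) :: complex^'n) < \<delta>" using e cn by (simp add: norm_axis norm_power)
  then have T1: "cmod (T (axis a (c ^ 6))) \<le> M" by (rule TM)
  have "cmod (6 * c ^ 5 / c ^ (CARD('n) - 1)) = 6 * e ^ (6 - CARD('n))"
  proof -
    have "5 - (CARD('n) - 1) = 6 - CARD('n)" "CARD('n) - 1 \<le> 5" using n by auto
    then have "c ^ 5 / c ^ (CARD('n) - 1) = c ^ (6 - CARD('n))" using cn(2) by (metis power_diff)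
    then show ?thesis using cn by (simp add: norm_mult norm_power flip: times_divide_eq_right)
  qed
  also have "\<dots> \<le> 6 * e"
    using power_decreasing[of 1 "6 - CARD('n)" e] e n by simp
  finally have J: "cmod (6 * c ^ 5 / c ^ (CARD('n) - 1)) \<le> 6 * e" .
  have "cmod (S (axis a c)) = cmod (T (axis a (c ^ 6))) * cmod (6 * c ^ 5 / c ^ (CARD('n) - 1)) ^ r"
    using ST[of c] cn e rho by (simp add: d_def norm_mult norm_power)
  also have "\<dots> \<le> M * (6 * e) ^ r"
    using T1 J M0 by (intro mult_mono power_mono) auto
  also have "\<dots> \<le> M * (6 * e) ^ 1"
    using M0 e r by (intro mult_left_mono power_decreasing) auto
  also have "\<dots> \<le> m / 2" using e(5) M0 by (simp add: field_simps)
  finally show False using lower[of c] cn e(1,2) m(1) by simp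
qed

text \<open>Inside the given neighbourhood \<open>W\<close> lies the image \<open>V\<close> of a
  smaller ball. The form restricts to \<open>V\<close>, and the blow-down over \<open>V\<close> is a
  resolution to which canonicity must apply.\<close>

lemma center_not_canonical:
  assumes n: "2 \<le> CARD('n)" "CARD('n) \<le> 5"
  shows "\<not> canonical_at TYPE('n) X (\<pi> 0)"
proof
  assume "canonical_at TYPE('n) X (\<pi> 0)"
  from this[unfolded canonical_at_def] obtain W r and s :: "('a, 'n) form_coeffs" where
    *: "openin (cs_top X) W \<and> \<pi> 0 \<in> W \<and> r \<ge> 1 \<and>
        pluricanonical_form (cs_sub X W) r s \<and> nowhere_vanishing (cs_sub X W) s \<and>
        (\<forall>V. \<forall>Y :: (nat \<Rightarrow> complex) cspace. \<forall>f.
           openin (cs_top X) V \<and> V \<subseteq> W \<and> resolution TYPE('n) Y f (cs_sub X V) \<longrightarrow>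
           (\<exists>t :: (nat \<Rightarrow> complex, 'n) form_coeffs. extends_pullback Y f (cs_sub X V) r s t))"
    by (elim exE) (rule that)
  have W: "openin (cs_top X) W" "\<pi> 0 \<in> W" and r: "r \<ge> 1"
    and s: "pluricanonical_form (cs_sub X W) r s" "nowhere_vanishing (cs_sub X W) s"
    using * by simp_all
  have ext: "\<exists>t :: (nat \<Rightarrow> complex, 'n) form_coeffs. extends_pullback Y f (cs_sub X V) r s t"
    if "openin (cs_top X) V" "V \<subseteq> W" "resolution TYPE('n) Y f (cs_sub X V)"
    for V and Y :: "(nat \<Rightarrow> complex) cspace" and f
    using * that by simp
  have "open {z \<in> B. \<pi> z \<in> W}" by (rule open_vimage[OF W(1)])
  moreover have "0 \<in> {z \<in> B. \<pi> z \<in> W}" using rho W(2) by simp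
  ultimately obtain R1 where R1: "0 < R1" "ball 0 R1 \<subseteq> {z \<in> B. \<pi> z \<in> W}"
    by (meson open_contains_ball)
  define R where "R = min R1 \<rho>"
  have R: "0 < R" "R \<le> \<rho>" using R1(1) rho by (auto simp: R_def)
  define V where "V = \<pi> ` ball 0 R"
  have VW: "V \<subseteq> W" using R1(2) by (auto simp: V_def R_def)
  have Vo: "openin (cs_top X) V" unfolding V_def by (rule open_image) (use R in auto)
  interpret V: sextic_model "cs_sub X V" \<pi> R unfolding V_def by (rule restrict[OF R])
  have full: "cs_points (cs_sub X V) = \<pi> ` V.B" using openin_subset[OF Vo] by (auto simp: V_def)
  obtain t :: "(nat \<Rightarrow> complex, 'n) form_coeffs"
    where t: "extends_pullback (blow_up TYPE('n) R) V.blow_down (cs_sub X V) r s t"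
    using ext[OF Vo VW V.resolution_blow_down[OF full n]] by blast
  have ch: "(U, \<phi>) \<in> charts (cs_sub X V) \<Longrightarrow> (U, \<phi>) \<in> charts (cs_sub X W) \<and> U \<subseteq> V" for U and \<phi> :: "'a \<Rightarrow> complex^'n"
    unfolding charts_sub[OF sheafy Vo] charts_sub[OF sheafy W(1)] using VW by auto
  have "cs_hol (cs_sub X W) f x \<longleftrightarrow> cs_hol (cs_sub X V) f x" if "x \<in> V" for f x
    using hol_sub_open[OF sheafy Vo that] hol_sub_open[OF sheafy W(1) subsetD[OF VW that]] by simp
  then have hol_eq: "cs_hol (cs_sub X V) f x" if "cs_hol (cs_sub X W) f x" "x \<in> V" for f x
    using that by simp
  have s_trans: "s (U, \<phi>) x = s (U', \<psi>) x * jacobian_det (\<psi> \<circ> inv_into U \<phi>) (\<phi> x) ^ r"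
    if "(U, \<phi>) \<in> charts (cs_sub X W)" "(U', \<psi>) \<in> charts (cs_sub X W)" "x \<in> U \<inter> U'" for U \<phi> U' \<psi> x
    using s(1) that unfolding pluricanonical_form_def by blast
  have "pluricanonical_form (cs_sub X V) r s"
    unfolding pluricanonical_form_def
  proof (intro conjI ballI; clarify)
    fix U x and \<phi> :: "'a \<Rightarrow> complex^'n" assume U: "(U, \<phi>) \<in> charts (cs_sub X V)" "x \<in> U"
    then have "cs_hol (cs_sub X W) (s (U, \<phi>)) x" "x \<in> V"
      using s(1) ch[OF U(1)] unfolding pluricanonical_form_def by auto
    then show "cs_hol (cs_sub X V) (s (U, \<phi>)) x" by (rule hol_eq)
  next
    fix U U' x and \<phi> \<phi>' :: "'a \<Rightarrow> complex^'n"
    assume U: "(U, \<phi>) \<in> charts (cs_sub X V)" and U': "(U', \<phi>') \<in> charts (cs_sub X V)"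
      and x: "x \<in> U" "x \<in> U'"
    show "s (U, \<phi>) x = s (U', \<phi>') x * jacobian_det (\<phi>' \<circ> inv_into U \<phi>) (\<phi> x) ^ r"
      by (rule s_trans) (use ch[OF U] ch[OF U'] x in auto)
  qed
  moreover have "nowhere_vanishing (cs_sub X V) s"
    unfolding nowhere_vanishing_def
  proof (intro ballI; clarify)
    fix U x and \<phi> :: "'a \<Rightarrow> complex^'n"
    assume "(U, \<phi>) \<in> charts (cs_sub X V)" "x \<in> U" "s (U, \<phi>) x = 0"
    then show False using s(2) ch[of U \<phi>] unfolding nowhere_vanishing_def by auto
  qed
  ultimately show False by (rule V.no_holomorphic_extension[OF full n r _ _ t])
qed

lemma center_noncanonical_singularity:
  assumes "2 \<le> CARD('n)" "CARD('n) \<le> 5"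
  shows "noncanonical_singularity TYPE('n) X (\<pi> 0)"
  unfolding noncanonical_singularity_def
  using center_not_regular[OF assms] center_not_canonical[OF assms] pi_in[of 0] rho by auto

end

subsection \<open>The lattice\<close>

lemma UNIV_two: "(UNIV :: 2 set) = {0, 1}"
proof -
  have "(2::2) = 0" by simp
  then show ?thesis using UNIV_2 by (metis insert_commute)
qed

lemma sum_block:
  fixes f :: "'n::finite + 2 \<Rightarrow> 'a::comm_monoid_add"
  shows "(\<Sum>i\<in>UNIV. f i) = (\<Sum>a\<in>UNIV. f (Inl a)) + f (Inr 0) + f (Inr 1)"
proof -
  have "(\<Sum>i\<in>UNIV. f i) = (\<Sum>i\<in>(UNIV :: 'n set) <+> (UNIV :: 2 set). f i)" by (simp add: UNIV_Plus_UNIV)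
  then show ?thesis by (simp add: sum.Plus UNIV_two add.assoc del: UNIV_Plus_UNIV)
qed

lemma all_block: "(\<forall>i :: 'n + 2. P i) \<longleftrightarrow> (\<forall>a. P (Inl a)) \<and> P (Inr 0) \<and> P (Inr 1)"
proof (intro iffI allI)
  fix i assume *: "(\<forall>a. P (Inl a)) \<and> P (Inr 0) \<and> P (Inr 1)"
  show "P i"
  proof (cases i)
    case (Inr c)
    have "c = 0 \<or> c = 1" using UNIV_two by auto
    then show ?thesis using * Inr by auto
  qed (use * in simp)
qed auto

lemma two_cases: "(c::2) = 0 \<or> c = 1" using UNIV_two by auto

text \<open>\<open>A\<^sub>2\<close> (on the two indices \<open>Inr 0\<close> and \<open>Inr 1\<close>) plus a sum of copies of \<open>\<langle>-1\<rangle>\<close>.\<close>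

definition gram :: "int ^ ('n::finite + 2) ^ ('n + 2)" where
  "gram = (\<chi> i j. case i of
      Inl a \<Rightarrow> (case j of Inl b \<Rightarrow> if a = b then -1 else 0 | Inr _ \<Rightarrow> 0)
    | Inr c \<Rightarrow> (case j of Inl _ \<Rightarrow> 0 | Inr d \<Rightarrow> if c = d then 2 else 1))"

lemma gram_nth [simp]:
  "gram $ Inl a $ Inl b = (if a = b then -1 else 0)" "gram $ Inl a $ Inr d = 0"
  "gram $ Inr c $ Inl b = 0" "gram $ Inr c $ Inr d = (if c = d then 2 else 1)"
  by (simp_all add: gram_def)

lemma lattice_form_gram:
  fixes x y :: "'a::comm_ring_1 ^ ('n::finite + 2)"
  shows "lattice_form gram x y =
    2 * x $ Inr 0 * y $ Inr 0 + x $ Inr 0 * y $ Inr 1 + x $ Inr 1 * y $ Inr 0 + 2 * x $ Inr 1 * y $ Inr 1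
    - (\<Sum>a\<in>UNIV. x $ Inl a * y $ Inl a)"
proof -
  have "(\<Sum>b\<in>UNIV. of_int (if a = b then -1 else 0) * x $ Inl a * y $ Inl b) = - (x $ Inl a * y $ Inl a)" for a
  proof -
    have "(\<Sum>b\<in>UNIV. of_int (if a = b then -1 else 0) * x $ Inl a * y $ Inl b)
        = (\<Sum>b\<in>UNIV. if a = b then - (x $ Inl a * y $ Inl b) else 0)"
      by (rule sum.cong) auto
    then show ?thesis by simp
  qed
  then show ?thesis
    by (simp add: lattice_form_def sum_block gram_def sum_negf algebra_simps)
qed

definition of_int_mat :: "int ^ 'm ^ 'k \<Rightarrow> 'a::comm_ring_1 ^ 'm ^ 'k" where
  "of_int_mat A = (\<chi> i j. of_int (A $ i $ j))"

lemma of_int_mat_mult: "of_int_mat (A ** B) = of_int_mat A ** of_int_mat B"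
  by (simp add: of_int_mat_def matrix_matrix_mult_def vec_eq_iff)

lemma of_int_mat_one [simp]: "of_int_mat (mat 1) = mat 1"
  by (simp add: of_int_mat_def mat_def vec_eq_iff)

lemma lattice_form_matrix:
  "lattice_form G x y = (\<Sum>i\<in>UNIV. x $ i * (of_int_mat G *v y) $ i)"
  by (simp add: lattice_form_def of_int_mat_def matrix_vector_mult_def sum_distrib_left mult_ac)

lemma dot_transpose:
  fixes A :: "'a::comm_ring_1 ^ 'm::finite ^ 'k::finite"
  shows "(\<Sum>i\<in>UNIV. (A *v x) $ i * y $ i) = (\<Sum>j\<in>UNIV. x $ j * (transpose A *v y) $ j)"
proof -
  have "(\<Sum>i\<in>UNIV. (A *v x) $ i * y $ i) = (\<Sum>i\<in>UNIV. \<Sum>j\<in>UNIV. A $ i $ j * x $ j * y $ i)"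
    by (simp add: matrix_vector_mult_def sum_distrib_right)
  also have "\<dots> = (\<Sum>j\<in>UNIV. \<Sum>i\<in>UNIV. A $ i $ j * x $ j * y $ i)" by (rule sum.swap)
  finally show ?thesis
    by (simp add: matrix_vector_mult_def transpose_def sum_distrib_left mult_ac)
qed

lemma lattice_form_isometry:
  fixes G h :: "int ^ 'm::finite ^ 'm" and x y :: "'a::comm_ring_1 ^ 'm"
  assumes "transpose h ** G ** h = G"
  shows "lattice_form G (of_int_mat h *v x) (of_int_mat h *v y) = lattice_form G x y"
proof -
  have "transpose (of_int_mat h :: 'a ^ 'm ^ 'm) = of_int_mat (transpose h)"
    by (simp add: of_int_mat_def transpose_def vec_eq_iff)
  then have "transpose (of_int_mat h) *v (of_int_mat G *v (of_int_mat h *v y)) = of_int_mat (transpose h ** G ** h) *v y"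
    by (simp add: of_int_mat_mult matrix_vector_mul_assoc matrix_mul_assoc)
  then have "transpose (of_int_mat h) *v (of_int_mat G *v (of_int_mat h *v y)) = of_int_mat G *v y"
    by (simp only: assms)
  then show ?thesis unfolding lattice_form_matrix by (simp add: dot_transpose)
qed

lemma mult_axis_eq_column:
  fixes A :: "'a::comm_ring_1 ^ 'm::finite ^ 'k"
  shows "A *v axis i 1 = column i A"
  by (simp add: vec_eq_iff matrix_vector_mult_def column_def axis_def if_distrib[of "\<lambda>x. _ * x"] cong: if_cong)

lemma isometry_columns:
  fixes G h :: "int ^ 'm::finite ^ 'm"
  assumes "transpose h ** G ** h = G"
  shows "lattice_form G (column j h) (column k h) = G $ j $ k"
proof -
  have col: "(of_int_mat h :: int ^ 'm ^ 'm) *v axis i 1 = column i h" for i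
    by (simp add: mult_axis_eq_column) (simp add: column_def of_int_mat_def)
  have "lattice_form G (axis j 1) (axis k (1::int)) = G $ j $ k"
    by (simp add: lattice_form_def axis_def if_distrib[of "\<lambda>x. _ * x"] if_distrib[of "\<lambda>x. x * _"] cong: if_cong)
  then show ?thesis using lattice_form_isometry[OF assms, of "axis j (1::int)" "axis k 1"] by (simp add: col)
qed

lemma integral_lattice_gram: "integral_lattice (gram :: int ^ ('n::finite + 2) ^ ('n + 2))"
proof -
  \<comment> \<open>Three times the inverse of the Gram matrix, so that the product is 3 times the
    identity and its determinant is not zero.\<close>
  define K :: "int ^ ('n + 2) ^ ('n + 2)" where "K = (\<chi> i j. case i of
      Inl a \<Rightarrow> (case j of Inl b \<Rightarrow> if a = b then -3 else 0 | Inr _ \<Rightarrow> 0)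
    | Inr c \<Rightarrow> (case j of Inl _ \<Rightarrow> 0 | Inr d \<Rightarrow> if c = d then 2 else -1))"
  have "gram ** K = (\<chi> i j. if i = j then 3 else 0)"
    unfolding vec_eq_iff all_block
    by (auto simp: matrix_matrix_mult_def sum_block gram_def K_def if_distrib[of "\<lambda>x. _ * x"] if_distrib[of "\<lambda>x. x * _"] cong: if_cong)
  then have "det (gram ** K) = (\<Prod>i\<in>(UNIV :: ('n + 2) set). 3)"
    by (simp add: det_diagonal)
  then have "det (gram :: int ^ ('n + 2) ^ ('n + 2)) * det K = (\<Prod>i\<in>(UNIV :: ('n + 2) set). 3)" by (simp only: det_mul)
  then have "det (gram :: int ^ ('n + 2) ^ ('n + 2)) \<noteq> 0" by auto
  moreover have "transpose gram = (gram :: int ^ ('n + 2) ^ ('n + 2))"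
    unfolding vec_eq_iff all_block by (auto simp: transpose_def gram_def)
  ultimately show ?thesis by (simp add: integral_lattice_def)
qed

text \<open>Pairing a linear relation with \<open>b i\<close> leaves only its i-th coefficient times
  a nonzero number.\<close>

lemma orthogonal_basis_independent:
  fixes b :: "'m \<Rightarrow> real ^ 'm::finite"
  assumes orth: "\<And>i j. i \<noteq> j \<Longrightarrow> lattice_form G (b i) (b j) = 0" and nz: "\<And>i. lattice_form G (b i) (b i) \<noteq> 0"
  shows "inj b" "independent (range b)"
proof -
  show inj: "inj b"
  proof (rule injI)
    fix i j assume "b i = b j"
    then show "i = j" using orth[of i j] nz[of i] by (cases "i = j") auto
  qed
  show "independent (range b)"
  proof
    assume "dependent (range b)"
    then obtain u i where u: "u (b i) \<noteq> 0" "(\<Sum>v\<in>range b. u v *\<^sub>R v) = 0"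
      using dependent_finite[of "range b"] by auto
    have "(\<Sum>v\<in>range b. u v *\<^sub>R v) = (\<Sum>j\<in>UNIV. u (b j) *\<^sub>R b j)"
      by (subst sum.reindex[OF inj]) simp
    then have "lattice_form G (\<Sum>j\<in>UNIV. u (b j) *\<^sub>R b j) (b i) = 0"
      using u(2) by (simp add: lattice_form_def)
    moreover have "lattice_form G (\<Sum>j\<in>A. u (b j) *\<^sub>R b j) (b i) = (\<Sum>j\<in>A. u (b j) * lattice_form G (b j) (b i))"
      if "finite A" for A
      using that
      by (induction A) (simp_all add: lattice_form_def algebra_simps sum.distrib sum_distrib_left)
    ultimately have "(\<Sum>j\<in>UNIV. u (b j) * lattice_form G (b j) (b i)) = 0" by simp
    moreover have "(\<Sum>j\<in>UNIV. u (b j) * lattice_form G (b j) (b i)) = (\<Sum>j\<in>UNIV. if j = i then u (b i) * lattice_form G (b i) (b i) else 0)"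
      by (rule sum.cong) (auto simp: orth)
    ultimately show False using u(1) nz[of i] by simp
  qed
qed

lemma has_signature_gram: "has_signature (gram :: int ^ ('n::finite + 2) ^ ('n + 2)) (2, CARD('n))"
proof -
  \<comment> \<open>Orthogonalisation in A_2: the first basis vector minus twice the second is
    orthogonal to the first and has square 6.\<close>
  define b :: "'n + 2 \<Rightarrow> real ^ ('n + 2)" where
    "b i = (if i = Inr 1 then axis (Inr 0) 1 - 2 *\<^sub>R axis (Inr 1) 1 else axis i 1)" for i
  have orth: "\<forall>i j. i \<noteq> j \<longrightarrow> lattice_form gram (b i) (b j) = 0"
    unfolding all_block by (auto simp: b_def lattice_form_gram axis_def if_distrib[of "\<lambda>x. _ * x"] cong: if_cong)
  have val: "lattice_form gram (b (Inl a)) (b (Inl a)) = -1" "lattice_form gram (b (Inr 0)) (b (Inr 0)) = 2"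
    "lattice_form gram (b (Inr 1)) (b (Inr 1)) = 6" for a
    by (auto simp: b_def lattice_form_gram axis_def if_distrib[of "\<lambda>x. _ * x"] cong: if_cong)
  have "\<forall>i. lattice_form gram (b i) (b i) \<noteq> 0" unfolding all_block by (simp add: val)
  then have "inj b" "independent (range b)" using orth orthogonal_basis_independent[of gram b] by auto
  moreover have "{i. lattice_form gram (b i) (b i) > 0} = {Inr 0, Inr 1}"
  proof -
    have "\<forall>i. lattice_form gram (b i) (b i) > 0 \<longleftrightarrow> i \<in> {Inr 0, Inr 1}" unfolding all_block by (simp add: val)
    then show ?thesis by blast
  qed
  moreover have "{i. lattice_form gram (b i) (b i) < 0} = range Inl"
  proof -
    have "\<forall>i. lattice_form gram (b i) (b i) < 0 \<longleftrightarrow> i \<in> range Inl" unfolding all_block by (auto simp: val)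
    then show ?thesis by blast
  qed
  moreover have "card (range (Inl :: 'n \<Rightarrow> 'n + 2)) = CARD('n)" by (simp add: card_image)
  ultimately show ?thesis unfolding has_signature_def using orth by (intro exI[of _ b]) simp
qed

text \<open>Multiplication by the Eisenstein integer \<open>a + b\<omega>\<close>, \<open>\<omega>\<^sup>2 = \<omega> - 1\<close>, on \<open>A\<^sub>2\<close>.\<close>

definition rot :: "int \<Rightarrow> int \<Rightarrow> int ^ ('n::finite + 2) ^ ('n + 2)" where
  "rot a b = (\<chi> i j. case i of
      Inl s \<Rightarrow> (case j of Inl t \<Rightarrow> if s = t then 1 else 0 | Inr _ \<Rightarrow> 0)
    | Inr c \<Rightarrow> (case j of Inl _ \<Rightarrow> 0 | Inr d \<Rightarrow>
        if c = 0 then (if d = 0 then a else -b) else (if d = 0 then b else a + b)))"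

text \<open>The form \<open>a\<^sup>2 + a * b + b\<^sup>2\<close> is the norm of a + b\<omega>; norm
  one singles out the six units.\<close>

definition eisenstein_unit :: "int \<Rightarrow> int \<Rightarrow> bool" where
  "eisenstein_unit a b \<longleftrightarrow> a\<^sup>2 + a * b + b\<^sup>2 = 1"

lemma rot_mult: "rot a b ** rot c d = rot (a * c - b * d) (a * d + b * c + b * d)"
  unfolding vec_eq_iff all_block
  by (auto simp: matrix_matrix_mult_def sum_block rot_def algebra_simps if_distrib[of "\<lambda>x. _ * x"] if_distrib[of "\<lambda>x. x * _"] cong: if_cong)

lemma rot_one: "rot 1 0 = mat 1"
  unfolding vec_eq_iff all_block by (auto simp: rot_def mat_def)

lemma eisenstein_unit_mult:
  "eisenstein_unit a b \<Longrightarrow> eisenstein_unit c d \<Longrightarrow> eisenstein_unit (a * c - b * d) (a * d + b * c + b * d)"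
  unfolding eisenstein_unit_def by algebra

text \<open>The conjugate of \<omega> is 1 - \<omega>, so a + b\<omega> has conjugate (a + b) -
  b\<omega>, which is the inverse of a unit.\<close>

lemma eisenstein_unit_conj: "eisenstein_unit a b \<Longrightarrow> eisenstein_unit (a + b) (-b)"
  unfolding eisenstein_unit_def by algebra

lemma rot_conj: "eisenstein_unit a b \<Longrightarrow> rot a b ** rot (a + b) (-b) = mat 1"
  "eisenstein_unit a b \<Longrightarrow> rot (a + b) (-b) ** rot a b = mat 1"
  unfolding rot_mult rot_one[symmetric] eisenstein_unit_def
  by (auto intro!: arg_cong2[of _ _ _ _ rot] simp: power2_eq_square algebra_simps)

text \<open>Four times the norm is a square plus three times the square of a, of b, or of a + b.
  These are, up to sign, the entries of the A_2-block of \<open>rot a b\<close>, later recovered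
  from their residues modulo 3.\<close>

lemma eisenstein_unit_bound:
  assumes "eisenstein_unit a b" shows "\<bar>a\<bar> \<le> 1" "\<bar>b\<bar> \<le> 1" "\<bar>a + b\<bar> \<le> 1"
proof -
  have sq: "\<bar>x\<bar> \<le> 1" if "3 * x\<^sup>2 \<le> 4" for x :: int
  proof (rule ccontr)
    assume "\<not> \<bar>x\<bar> \<le> 1"
    then have "2\<^sup>2 \<le> \<bar>x\<bar>\<^sup>2" by (intro power_mono) auto
    then show False using that by simp
  qed
  have e: "a\<^sup>2 + a * b + b\<^sup>2 = 1" using assms by (simp add: eisenstein_unit_def)
  have "3 * b\<^sup>2 = 4 - (2 * a + b)\<^sup>2" "3 * a\<^sup>2 = 4 - (a + 2 * b)\<^sup>2" "3 * (a + b)\<^sup>2 = 4 - (a - b)\<^sup>2"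
    using e by algebra+
  then show "\<bar>a\<bar> \<le> 1" "\<bar>b\<bar> \<le> 1" "\<bar>a + b\<bar> \<le> 1" using sq[of b] sq[of a] sq[of "a + b"] by simp_all
qed

text \<open>The adjoint of multiplication by an Eisenstein integer is multiplication by its
  conjugate, and for a unit the conjugate is the inverse.\<close>

lemma rot_isometry:
  assumes "eisenstein_unit a b"
  shows "transpose (rot a b) ** gram ** rot a b = (gram :: int ^ ('n::finite + 2) ^ ('n + 2))"
proof -
  let ?r = "rot a b :: int ^ ('n + 2) ^ ('n + 2)" and ?r' = "rot (a + b) (-b) :: int ^ ('n + 2) ^ ('n + 2)"
  have e: "a\<^sup>2 + a * b + b\<^sup>2 = 1" using assms by (simp add: eisenstein_unit_def)
  have "gram ** ?r = transpose (?r') ** gram"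
    unfolding vec_eq_iff all_block
    by (auto simp: matrix_matrix_mult_def sum_block rot_def gram_def transpose_def algebra_simps
        if_distrib[of "\<lambda>x. _ * x"] if_distrib[of "\<lambda>x. x * _"] cong: if_cong)
  then have "transpose (?r) ** (gram ** ?r) = transpose (?r) ** (transpose (?r') ** gram)"
    by simp
  then have "transpose (?r) ** gram ** ?r = transpose (?r) ** transpose (?r') ** gram"
    by (simp only: matrix_mul_assoc)
  also have "transpose (?r) ** transpose (?r') = transpose (?r' ** ?r)"
    by (simp add: matrix_transpose_mul)
  finally show ?thesis by (simp add: rot_conj[OF assms] transpose_mat)
qed

lemma rot_nth:
  fixes x :: "'a::comm_ring_1 ^ ('n::finite + 2)"
  shows "(of_int_mat (rot a b) *v x) $ Inl s = x $ Inl s"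
    "(of_int_mat (rot a b) *v x) $ Inr 0 = of_int a * x $ Inr 0 - of_int b * x $ Inr 1"
    "(of_int_mat (rot a b) *v x) $ Inr 1 = of_int b * x $ Inr 0 + of_int (a + b) * x $ Inr 1"
proof -
  have "(\<Sum>t\<in>UNIV. of_int (if s = t then 1 else 0) * x $ Inl t) = (\<Sum>t\<in>UNIV. if s = t then x $ Inl t else 0)"
    by (rule sum.cong) auto
  then show "(of_int_mat (rot a b) *v x) $ Inl s = x $ Inl s"
    by (simp add: matrix_vector_mult_def sum_block of_int_mat_def rot_def)
qed (simp_all add: matrix_vector_mult_def sum_block of_int_mat_def rot_def)

definition cong3 :: "int ^ 'm ^ 'k \<Rightarrow> int ^ 'm ^ 'k \<Rightarrow> bool" where
  "cong3 A A' \<longleftrightarrow> (\<forall>i j. 3 dvd (A $ i $ j - A' $ i $ j))"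

lemma cong3_refl: "cong3 A A" by (simp add: cong3_def)

lemma cong3_sym: "cong3 A A' \<Longrightarrow> cong3 A' A"
  unfolding cong3_def by (metis dvd_minus_iff minus_diff_eq)

lemma cong3_mult:
  assumes "cong3 A A'" "cong3 C C'"
  shows "cong3 (A ** C) (A' ** C')"
  unfolding cong3_def
proof (intro allI)
  fix i j
  have "(A ** C) $ i $ j - (A' ** C') $ i $ j = (\<Sum>k\<in>UNIV. (A $ i $ k - A' $ i $ k) * C $ k $ j + A' $ i $ k * (C $ k $ j - C' $ k $ j))"
    by (simp add: matrix_matrix_mult_def algebra_simps flip: sum_subtractf)
  also have "3 dvd \<dots>" using assms unfolding cong3_def by (intro dvd_sum dvd_add dvd_mult dvd_mult2) auto
  finally show "3 dvd (A ** C) $ i $ j - (A' ** C') $ i $ j" .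
qed

lemma int_eq_of_cong3: "\<bar>x\<bar> \<le> 1 \<Longrightarrow> \<bar>y\<bar> \<le> 1 \<Longrightarrow> 3 dvd (x - y) \<Longrightarrow> x = (y::int)"
  by presburger

text \<open>Both \<open>h\<close> and its inverse map the negative definite part to itself, hence
  \<open>h\<close> also preserves its orthogonal complement A_2. Columns of the negative block are
  integral unit vectors and columns of the A_2-block are Eisenstein units, so all entries are 0 or
  \<plusminus>1 and the congruence determines them.\<close>

lemma block_isometry_eq_rot:
  fixes h h' :: "int ^ ('n::finite + 2) ^ ('n + 2)"
  assumes iso: "transpose h ** gram ** h = gram" and inv: "h ** h' = mat 1"
    and z: "\<And>i. h $ Inr 0 $ Inl i = 0" "\<And>i. h $ Inr 1 $ Inl i = 0"
    and z': "\<And>i. h' $ Inr 0 $ Inl i = 0" "\<And>i. h' $ Inr 1 $ Inl i = 0"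
    and c: "cong3 h (rot a b)" and u: "eisenstein_unit a b"
  shows "h = rot a b"
proof -
  \<comment> \<open>The preimage \<open>m\<close> of the i-th basis vector lies in the negative
    part, by the assumption on \<open>h'\<close>, and is therefore orthogonal to A_2. Applying the
    isometry \<open>h\<close> to this orthogonality gives the entry up to sign.\<close>
  have z2: "h $ Inl i $ Inr c = 0" for i c
  proof -
    define m :: "int ^ ('n + 2)" where "m = of_int_mat h' *v axis (Inl i) 1"
    have m: "m $ Inr 0 = 0" "m $ Inr 1 = 0"
      using z' by (simp_all add: m_def mult_axis_eq_column column_def of_int_mat_def)
    have hm: "of_int_mat h *v m = axis (Inl i) 1"
      unfolding m_def matrix_vector_mul_assoc by (simp add: inv flip: of_int_mat_mult)
    have "lattice_form gram (of_int_mat h *v m) (of_int_mat h *v axis (Inr c) 1) = lattice_form gram m (axis (Inr c) 1)"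
      by (rule lattice_form_isometry[OF iso])
    also have "\<dots> = 0" using m by (simp add: lattice_form_gram axis_def)
    finally show ?thesis unfolding hm
      by (simp add: lattice_form_gram mult_axis_eq_column column_def of_int_mat_def)
         (simp add: axis_def if_distrib[of "\<lambda>x. x * _"] cong: if_cong)
  qed
  have M: "h $ Inl s $ Inl t = rot a b $ Inl s $ Inl t" for s t
  proof (rule int_eq_of_cong3)
    have "(\<Sum>r\<in>UNIV. (h $ Inl r $ Inl t)\<^sup>2) = 1"
      using isometry_columns[OF iso, of "Inl t" "Inl t"] z
      by (simp add: lattice_form_gram column_def power2_eq_square)
    moreover have "(h $ Inl s $ Inl t)\<^sup>2 \<le> (\<Sum>r\<in>UNIV. (h $ Inl r $ Inl t)\<^sup>2)"
      by (rule member_le_sum) auto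
    ultimately show "\<bar>h $ Inl s $ Inl t\<bar> \<le> 1" using abs_square_le_1[of "h $ Inl s $ Inl t"] by simp
    show "\<bar>rot a b $ Inl s $ Inl t\<bar> \<le> 1" by (simp add: rot_def)
    show "3 dvd (h $ Inl s $ Inl t - rot a b $ Inl s $ Inl t)" using c by (simp add: cong3_def)
  qed
  have E: "eisenstein_unit (h $ Inr 0 $ Inr c) (h $ Inr 1 $ Inr c)" for c
    using isometry_columns[OF iso, of "Inr c" "Inr c"] z2
    by (simp add: lattice_form_gram column_def power2_eq_square eisenstein_unit_def algebra_simps)
  have A: "h $ Inr d $ Inr c = (rot a b :: int ^ ('n + 2) ^ ('n + 2)) $ Inr d $ Inr c" for c d
  proof (rule int_eq_of_cong3)
    show "\<bar>h $ Inr d $ Inr c\<bar> \<le> 1" using eisenstein_unit_bound[OF E[of c]] two_cases[of d] by auto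
    show "\<bar>(rot a b :: int ^ ('n + 2) ^ ('n + 2)) $ Inr d $ Inr c\<bar> \<le> 1" using eisenstein_unit_bound[OF u] by (simp add: rot_def)
  qed (use c in \<open>auto simp: cong3_def\<close>)
  show ?thesis unfolding vec_eq_iff all_block
    using M A z z2 by (auto simp: rot_def)
qed

subsection \<open>The period domain\<close>

lemma line_through_eq_iff:
  assumes "x \<noteq> 0"
  shows "line_through x = line_through y \<longleftrightarrow> (\<exists>c. c \<noteq> 0 \<and> y = c *s x)"
proof
  assume eq: "line_through x = line_through y"
  have "y \<in> line_through y" "x \<in> line_through x"
    unfolding line_through_def by (auto intro!: image_eqI[of _ _ 1])
  then have "y \<in> line_through x" "x \<in> line_through y" using eq by auto
  then obtain c where c: "y = c *s x" unfolding line_through_def by auto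
  have "c \<noteq> 0"
  proof
    assume "c = 0"
    then have "x \<in> line_through 0" using \<open>x \<in> line_through y\<close> c by simp
    then show False using assms by (auto simp: line_through_def)
  qed
  then show "\<exists>c. c \<noteq> 0 \<and> y = c *s x" using c by auto
next
  assume "\<exists>c. c \<noteq> 0 \<and> y = c *s x"
  then obtain c where c: "c \<noteq> 0" "y = c *s x" by auto
  show "line_through x = line_through y"
    unfolding line_through_def c(2)
  proof (intro equalityI subsetI; elim rangeE)
    fix v d assume "v = d *s x"
    then show "v \<in> range (\<lambda>d. d *s (c *s x))" using c(1) by (intro range_eqI[of _ _ "d / c"]) (simp add: vector_smult_assoc)
  next
    fix v d assume "v = d *s (c *s x)"
    then show "v \<in> range (\<lambda>d. d *s x)" by (intro range_eqI[of _ _ "d * c"]) (simp add: vector_smult_assoc)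
  qed
qed

lemma line_through_scale: "c \<noteq> 0 \<Longrightarrow> line_through (c *s x) = line_through x"
  using line_through_eq_iff[of x "c *s x"] by (cases "x = 0") auto

lemma openin_projective:
  "openin (cs_top (projective_space :: (complex^'m::finite) set cspace)) U \<longleftrightarrow>
    U \<subseteq> line_through ` (- {0}) \<and> open {x. x \<noteq> 0 \<and> line_through x \<in> U}"
proof -
  have "openin (top_of_set (- {0 :: complex^'m})) S \<longleftrightarrow> open S \<and> S \<subseteq> - {0}" for S
    by (rule openin_open_eq) auto
  moreover have "{x \<in> - {0}. line_through x \<in> U} = {x. x \<noteq> 0 \<and> line_through x \<in> U}" by auto
  ultimately show ?thesis unfolding projective_space_def by (auto simp: openin_quotient_top)
qed

lemma openin_projective_cone:
  fixes C :: "(complex^'m::finite) set"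
  assumes "open C" "0 \<notin> C" "\<And>c x. c \<noteq> 0 \<Longrightarrow> x \<in> C \<Longrightarrow> c *s x \<in> C"
  shows "openin (cs_top projective_space) (line_through ` C)"
    and "\<And>x. x \<noteq> 0 \<Longrightarrow> line_through x \<in> line_through ` C \<longleftrightarrow> x \<in> C"
proof -
  show *: "line_through x \<in> line_through ` C \<longleftrightarrow> x \<in> C" if "x \<noteq> 0" for x
  proof
    assume "line_through x \<in> line_through ` C"
    then obtain y where y: "y \<in> C" "line_through y = line_through x" by auto
    then have "y \<noteq> 0" using assms(2) by auto
    then obtain c where "c \<noteq> 0" "x = c *s y" using line_through_eq_iff[of y x] y(2) by auto
    then show "x \<in> C" using y(1) assms(3) by simp
  qed auto
  have "{x. x \<noteq> 0 \<and> line_through x \<in> line_through ` C} = C" using * assms(2) by auto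
  moreover have "C \<subseteq> - {0}" using assms(2) by auto
  ultimately show "openin (cs_top projective_space) (line_through ` C)"
    unfolding openin_projective using assms(1) by auto
qed

lemma cs_hol_projective:
  fixes F :: "(complex^'m::finite) set \<Rightarrow> complex"
  shows "cs_hol projective_space F l \<longleftrightarrow>
   (\<exists>V. openin (cs_top (projective_space :: (complex^'m) set cspace)) V \<and> l \<in> V \<and>
      (\<forall>x. x \<noteq> 0 \<longrightarrow> line_through x \<in> V \<longrightarrow> hol_at (F \<circ> line_through) x))"
proof -
  have "cs_hol (cs_sub affine_cs (- {0})) f x \<longleftrightarrow> hol_at f x" if "x \<noteq> 0" for f and x :: "complex^'m"
    by (rule hol_sub_open[OF sheafy_affine]) (use that in auto)
  then show ?thesis unfolding projective_space_def cs_hol_quotient by auto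
qed

section \<open>Eigencoordinates and the Lie ball\<close>

text \<open>The two primitive sixth roots of unity, \<theta> and its conjugate 1 - \<theta>.
  Exchanging them exchanges the two components of the period space.\<close>

definition hexroot :: "complex \<Rightarrow> bool" where "hexroot \<theta> \<longleftrightarrow> \<theta>\<^sup>2 - \<theta> + 1 = 0"

lemma hexroot_compl: "hexroot \<theta> \<Longrightarrow> hexroot (1 - \<theta>)"
  unfolding hexroot_def by algebra

lemma hexroot_nz: "hexroot \<theta> \<Longrightarrow> 1 - 2 * \<theta> \<noteq> 0"
proof
  assume "hexroot \<theta>" "1 - 2 * \<theta> = 0"
  then have "(-3::complex) = 0" unfolding hexroot_def by algebra
  then show False by simp
qed

lemma hexroot_cnj:
  assumes "hexroot \<theta>" shows "cnj \<theta> = 1 - \<theta>"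
proof -
  have "(cnj \<theta>)\<^sup>2 - cnj \<theta> + 1 = cnj (\<theta>\<^sup>2 - \<theta> + 1)" by simp
  also have "\<dots> = cnj 0" using assms by (simp only: hexroot_def)
  finally have "(cnj \<theta>)\<^sup>2 - cnj \<theta> + 1 = 0" by simp
  then have "(cnj \<theta> - \<theta>) * (cnj \<theta> - (1 - \<theta>)) = 0" using assms unfolding hexroot_def by algebra
  moreover have "cnj \<theta> \<noteq> \<theta>"
  proof
    assume "cnj \<theta> = \<theta>"
    then have "Im \<theta> = 0" by (metis cnj.sel(2) neg_equal_zero)
    then have "Re (\<theta>\<^sup>2 - \<theta> + 1) = (Re \<theta> - 1/2)\<^sup>2 + 3/4" by (simp add: power2_eq_square algebra_simps)
    moreover have "\<dots> > 0" by (simp add: add_nonneg_pos)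
    moreover have "Re (\<theta>\<^sup>2 - \<theta> + 1) = 0" using assms by (simp only: hexroot_def zero_complex.sel)
    ultimately show False by linarith
  qed
  ultimately show ?thesis by simp
qed

lemma exists_hexroot: "\<exists>\<theta>. hexroot \<theta>"
proof
  show "hexroot (Complex (1/2) (sqrt 3 / 2))"
    unfolding hexroot_def by (simp add: complex_eq_iff power2_eq_square)
qed

text \<open>
  The rotation of \<open>A\<^sub>2\<close> has the eigenvectors \<open>w = (1, -\<theta>)\<close> and \<open>w' = (1, \<theta> - 1)\<close>, the second being
  the conjugate of the first.  They are isotropic with \<open>(w, w') = 3\<close>; \<open>eigen_coord \<theta>\<close> is the
  coefficient of \<open>w\<close>, and \<open>tube z = w + \<beta>(z) w' + z\<close> is the isotropic vector over \<open>z\<close>.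
\<close>

definition eigen_coord :: "complex \<Rightarrow> complex ^ ('n::finite + 2) \<Rightarrow> complex" where
  "eigen_coord \<theta> x = (x $ Inr 1 + (1 - \<theta>) * x $ Inr 0) / (1 - 2 * \<theta>)"

text \<open>The factor 1/6 comes from isotropy: as (w, w') = 3, the square of w + \<beta> w' + z is
  6 \<beta> minus the sum of the squares of the coordinates of z.\<close>

definition quad :: "complex ^ 'n::finite \<Rightarrow> complex" where
  "quad z = (\<Sum>a\<in>UNIV. (z $ a)\<^sup>2) / 6"

definition tube :: "complex \<Rightarrow> complex ^ 'n::finite \<Rightarrow> complex ^ ('n + 2)" where
  "tube \<theta> z = (\<chi> i. case i of Inl a \<Rightarrow> z $ a
     | Inr c \<Rightarrow> if c = 0 then 1 + quad z else - \<theta> - (1 - \<theta>) * quad z)"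

definition affine_coord :: "complex \<Rightarrow> complex ^ ('n::finite + 2) \<Rightarrow> complex ^ 'n" where
  "affine_coord \<theta> x = (\<chi> a. x $ Inl a / eigen_coord \<theta> x)"

text \<open>The bounded symmetric domain of type IV, up to scaling of the coordinates. At
  \<open>tube \<theta> z\<close> the second inequality is the positivity of the hermitian form; the
  first selects the component.\<close>

definition lie_ball :: "(complex ^ 'n::finite) set" where
  "lie_ball = {z. cmod (quad z) < 1 \<and> (norm z)\<^sup>2 < 3 * (1 + (cmod (quad z))\<^sup>2)}"

lemma tube_nth [simp]:
  "tube \<theta> z $ Inl a = z $ a" "tube \<theta> z $ Inr 0 = 1 + quad z" "tube \<theta> z $ Inr 1 = - \<theta> - (1 - \<theta>) * quad z"
  by (simp_all add: tube_def)

lemma eigen_expansion: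
  assumes "hexroot \<theta>"
  shows "x $ Inr 0 = eigen_coord \<theta> x + eigen_coord (1 - \<theta>) x"
    "x $ Inr 1 = - \<theta> * eigen_coord \<theta> x - (1 - \<theta>) * eigen_coord (1 - \<theta>) x"
proof -
  have nz: "1 - 2 * \<theta> \<noteq> 0" by (rule hexroot_nz[OF assms])
  have e: "(1 - 2 * \<theta>) * eigen_coord \<theta> x = x $ Inr 1 + (1 - \<theta>) * x $ Inr 0"
    using nz by (simp add: eigen_coord_def)
  have "(1 - 2 * (1 - \<theta>)) * eigen_coord (1 - \<theta>) x = x $ Inr 1 + \<theta> * x $ Inr 0"
    using hexroot_nz[OF hexroot_compl[OF assms]] by (simp add: eigen_coord_def)
  then have f: "(1 - 2 * \<theta>) * eigen_coord (1 - \<theta>) x = - (x $ Inr 1 + \<theta> * x $ Inr 0)" by algebra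
  have "(1 - 2 * \<theta>) * (x $ Inr 0) = (1 - 2 * \<theta>) * (eigen_coord \<theta> x + eigen_coord (1 - \<theta>) x)"
    using e f by algebra
  then show "x $ Inr 0 = eigen_coord \<theta> x + eigen_coord (1 - \<theta>) x" using nz by simp
  have "(1 - 2 * \<theta>) * (x $ Inr 1) = (1 - 2 * \<theta>) * (- \<theta> * eigen_coord \<theta> x - (1 - \<theta>) * eigen_coord (1 - \<theta>) x)"
    using e f by algebra
  then show "x $ Inr 1 = - \<theta> * eigen_coord \<theta> x - (1 - \<theta>) * eigen_coord (1 - \<theta>) x"
    using nz by (simp only: mult_cancel_left) auto
qed

lemma eigen_coord_tube [simp]:
  assumes "hexroot \<theta>"
  shows "eigen_coord \<theta> (tube \<theta> z) = 1" "eigen_coord (1 - \<theta>) (tube \<theta> z) = quad z"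
proof -
  have nz: "1 - 2 * \<theta> \<noteq> 0" "1 - 2 * (1 - \<theta>) \<noteq> 0"
    using hexroot_nz[OF assms] hexroot_nz[OF hexroot_compl[OF assms]] by auto
  show "eigen_coord \<theta> (tube \<theta> z) = 1"
    unfolding eigen_coord_def using nz(1) by (simp add: divide_eq_eq) algebra
  show "eigen_coord (1 - \<theta>) (tube \<theta> z) = quad z"
    unfolding eigen_coord_def using nz(2) by (simp add: divide_eq_eq) algebra
qed

lemma tube_nonzero [simp]: "hexroot \<theta> \<Longrightarrow> tube \<theta> z \<noteq> 0"
proof
  assume "hexroot \<theta>" "tube \<theta> z = 0"
  then have "eigen_coord \<theta> (0 :: complex ^ ('a + 2)) = 1" using eigen_coord_tube(1)[of \<theta> z] by (simp only:)
  then show False by (simp add: eigen_coord_def)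
qed

lemma eigen_coord_scale [simp]: "eigen_coord \<theta> (c *s x) = c * eigen_coord \<theta> x"
  by (simp add: eigen_coord_def algebra_simps)

lemma affine_coord_scale: "c \<noteq> 0 \<Longrightarrow> affine_coord \<theta> (c *s x) = affine_coord \<theta> x"
  by (simp add: affine_coord_def vec_eq_iff)

lemma affine_coord_tube [simp]: "hexroot \<theta> \<Longrightarrow> affine_coord \<theta> (tube \<theta> z) = z"
  by (simp add: affine_coord_def vec_eq_iff)

lemma form_eigen:
  assumes "hexroot \<theta>"
  shows "lattice_form gram x y = 3 * (eigen_coord \<theta> x * eigen_coord (1 - \<theta>) y + eigen_coord (1 - \<theta>) x * eigen_coord \<theta> y)
    - (\<Sum>a\<in>UNIV. x $ Inl a * y $ Inl a)"
proof -
  define a b c d where "a = eigen_coord \<theta> x" and "b = eigen_coord (1 - \<theta>) x"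
    and "c = eigen_coord \<theta> y" and "d = eigen_coord (1 - \<theta>) y"
  have l: "\<theta>\<^sup>2 - \<theta> + 1 = 0" using assms by (simp add: hexroot_def)
  have "2 * (a + b) * (c + d) + (a + b) * (- \<theta> * c - (1 - \<theta>) * d) + (- \<theta> * a - (1 - \<theta>) * b) * (c + d)
      + 2 * (- \<theta> * a - (1 - \<theta>) * b) * (- \<theta> * c - (1 - \<theta>) * d) = 3 * (a * d + b * c)"
    using l by algebra
  then show ?thesis
    unfolding lattice_form_gram eigen_expansion[OF assms, of x] eigen_expansion[OF assms, of y]
      a_def[symmetric] b_def[symmetric] c_def[symmetric] d_def[symmetric] by simp
qed

lemma eigen_coord_cnj:
  assumes "hexroot \<theta>"
  shows "eigen_coord \<theta> (\<chi> i. cnj (x $ i)) = cnj (eigen_coord (1 - \<theta>) x)"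
  by (simp add: eigen_coord_def hexroot_cnj[OF assms])

lemma form_cnj_eigen:
  assumes "hexroot \<theta>"
  shows "lattice_form gram x (\<chi> i. cnj (x $ i)) =
    of_real (3 * ((cmod (eigen_coord \<theta> x))\<^sup>2 + (cmod (eigen_coord (1 - \<theta>) x))\<^sup>2) - (\<Sum>a\<in>UNIV. (cmod (x $ Inl a))\<^sup>2))"
proof -
  have 1: "eigen_coord \<theta> (\<chi> i. cnj (x $ i)) = cnj (eigen_coord (1 - \<theta>) x)"
    by (rule eigen_coord_cnj[OF assms])
  have 2: "eigen_coord (1 - \<theta>) (\<chi> i. cnj (x $ i)) = cnj (eigen_coord \<theta> x)"
    using eigen_coord_cnj[OF hexroot_compl[OF assms], of x] by simp
  show ?thesis
    unfolding form_eigen[OF assms] 1 2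
    by (simp add: complex_norm_square del: of_real_power)
qed

lemma norm_square_sum: "(norm (z :: complex ^ 'n::finite))\<^sup>2 = (\<Sum>a\<in>UNIV. (cmod (z $ a))\<^sup>2)"
  by (simp add: norm_vec_def L2_set_def sum_nonneg)

lemma cmod_sum_squares_le: "cmod (\<Sum>a\<in>A. (f a)\<^sup>2) \<le> (\<Sum>a\<in>A. (cmod (f a))\<^sup>2)"
  using norm_sum[of "\<lambda>a. (f a)\<^sup>2" A] by (simp add: norm_power)

lemma cmod_quad_le: "cmod (quad z) \<le> (norm z)\<^sup>2 / 6"
  using cmod_sum_squares_le[of "\<lambda>a. z $ a" UNIV] by (simp add: quad_def norm_divide norm_square_sum)

definition positive_cone :: "(complex ^ ('n::finite + 2)) set" where
  "positive_cone = {x. x \<noteq> 0 \<and> lattice_form gram x x = 0 \<and> Re (lattice_form gram x (\<chi> i. cnj (x $ i))) > 0}"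

lemma period_space_gram: "period_space gram = line_through ` positive_cone"
  by (auto simp: period_space_def positive_cone_def)

lemma tube_in_positive_cone:
  assumes "hexroot \<theta>" "z \<in> lie_ball"
  shows "tube \<theta> z \<in> positive_cone"
proof -
  have "lattice_form gram (tube \<theta> z) (tube \<theta> z) = 0"
    unfolding form_eigen[OF assms(1)] using assms(1) by (simp add: quad_def power2_eq_square)
  moreover have "Re (lattice_form gram (tube \<theta> z) (\<chi> i. cnj (tube \<theta> z $ i))) > 0"
    unfolding form_cnj_eigen[OF assms(1)] using assms by (simp add: lie_ball_def norm_square_sum)
  ultimately show ?thesis using assms(1) by (simp add: positive_cone_def)
qed

lemma tube_affine_coord:
  assumes l: "hexroot \<theta>" and x: "lattice_form gram x x = 0" and nz: "eigen_coord \<theta> x \<noteq> 0"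
  shows "x = eigen_coord \<theta> x *s tube \<theta> (affine_coord \<theta> x)"
    and "quad (affine_coord \<theta> x) = eigen_coord (1 - \<theta>) x / eigen_coord \<theta> x"
proof -
  have "6 * eigen_coord \<theta> x * eigen_coord (1 - \<theta>) x = (\<Sum>a\<in>UNIV. (x $ Inl a)\<^sup>2)"
    using x unfolding form_eigen[OF l] by (simp add: power2_eq_square algebra_simps)
  moreover have "quad (affine_coord \<theta> x) = (\<Sum>a\<in>UNIV. (x $ Inl a)\<^sup>2) / (eigen_coord \<theta> x)\<^sup>2 / 6"
    by (simp add: quad_def affine_coord_def power_divide sum_divide_distrib)
  ultimately have "quad (affine_coord \<theta> x) = (6 * eigen_coord \<theta> x * eigen_coord (1 - \<theta>) x) / (eigen_coord \<theta> x)\<^sup>2 / 6"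
    by simp
  then show q: "quad (affine_coord \<theta> x) = eigen_coord (1 - \<theta>) x / eigen_coord \<theta> x"
    using nz by (simp add: power2_eq_square)
  have "\<forall>i. x $ i = (eigen_coord \<theta> x *s tube \<theta> (affine_coord \<theta> x)) $ i"
    unfolding all_block
  proof (intro conjI allI)
    show "x $ Inl a = (eigen_coord \<theta> x *s tube \<theta> (affine_coord \<theta> x)) $ Inl a" for a
      using nz by (simp add: affine_coord_def)
    show "x $ Inr 0 = (eigen_coord \<theta> x *s tube \<theta> (affine_coord \<theta> x)) $ Inr 0"
      using nz eigen_expansion(1)[OF l, of x] by (simp add: q distrib_left)
    show "x $ Inr 1 = (eigen_coord \<theta> x *s tube \<theta> (affine_coord \<theta> x)) $ Inr 1"
      using nz eigen_expansion(2)[OF l, of x] by (simp add: q right_diff_distrib)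
  qed
  then show "x = eigen_coord \<theta> x *s tube \<theta> (affine_coord \<theta> x)" by (simp add: vec_eq_iff)
qed

text \<open>If both moduli were equal to s, isotropy would bound 6 s^2 by the hermitian norm of the
  negative part, while positivity makes that norm smaller than 6 s^2. Comparing the two moduli thus
  splits the period space into two parts.\<close>

lemma positive_cone_eigen:
  assumes l: "hexroot \<theta>" and x: "x \<in> positive_cone"
  shows "cmod (eigen_coord \<theta> x) \<noteq> cmod (eigen_coord (1 - \<theta>) x)"
proof
  assume eq: "cmod (eigen_coord \<theta> x) = cmod (eigen_coord (1 - \<theta>) x)"
  have "6 * eigen_coord \<theta> x * eigen_coord (1 - \<theta>) x = (\<Sum>a\<in>UNIV. (x $ Inl a)\<^sup>2)"
    using x unfolding positive_cone_def form_eigen[OF l] by (simp add: power2_eq_square algebra_simps)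
  then have "cmod (6 * eigen_coord \<theta> x * eigen_coord (1 - \<theta>) x) \<le> (\<Sum>a\<in>UNIV. (cmod (x $ Inl a))\<^sup>2)"
    using cmod_sum_squares_le by metis
  moreover have "0 < 3 * ((cmod (eigen_coord \<theta> x))\<^sup>2 + (cmod (eigen_coord (1 - \<theta>) x))\<^sup>2) - (\<Sum>a\<in>UNIV. (cmod (x $ Inl a))\<^sup>2)"
    using x unfolding positive_cone_def form_cnj_eigen[OF l] by simp
  ultimately show False by (simp add: eq norm_mult power2_eq_square)
qed

lemma affine_coord_in_lie_ball:
  assumes l: "hexroot \<theta>" and x: "x \<in> positive_cone" and lt: "cmod (eigen_coord (1 - \<theta>) x) < cmod (eigen_coord \<theta> x)"
  shows "affine_coord \<theta> x \<in> lie_ball" "line_through x = line_through (tube \<theta> (affine_coord \<theta> x))"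
proof -
  have nz: "eigen_coord \<theta> x \<noteq> 0" using lt by auto
  have x0: "lattice_form gram x x = 0" using x by (simp add: positive_cone_def)
  note t = tube_affine_coord[OF l x0 nz]
  show "line_through x = line_through (tube \<theta> (affine_coord \<theta> x))"
    using t(1) line_through_scale[OF nz] by metis
  have pos: "(\<Sum>a\<in>UNIV. (cmod (x $ Inl a))\<^sup>2) < 3 * ((cmod (eigen_coord \<theta> x))\<^sup>2 + (cmod (eigen_coord (1 - \<theta>) x))\<^sup>2)"
    using x unfolding positive_cone_def form_cnj_eigen[OF l] by simp
  have "(norm (affine_coord \<theta> x))\<^sup>2 = (\<Sum>a\<in>UNIV. (cmod (x $ Inl a))\<^sup>2) / (cmod (eigen_coord \<theta> x))\<^sup>2"
    by (simp add: norm_square_sum affine_coord_def norm_divide power_divide sum_divide_distrib)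
  also have "\<dots> < 3 * ((cmod (eigen_coord \<theta> x))\<^sup>2 + (cmod (eigen_coord (1 - \<theta>) x))\<^sup>2) / (cmod (eigen_coord \<theta> x))\<^sup>2"
    using pos nz by (intro divide_strict_right_mono) auto
  also have "\<dots> = 3 * (1 + (cmod (quad (affine_coord \<theta> x)))\<^sup>2)"
    using nz by (simp add: t(2) norm_divide power_divide field_simps)
  finally show "affine_coord \<theta> x \<in> lie_ball"
    using lt nz by (simp add: lie_ball_def t(2) norm_divide)
qed

definition domain_of :: "complex \<Rightarrow> (complex ^ ('n::finite + 2)) set set" where
  "domain_of \<theta> = (\<lambda>z. line_through (tube \<theta> z)) ` lie_ball"

lemma domain_of_eq:
  assumes l: "hexroot \<theta>"
  shows "domain_of \<theta> = line_through ` {x \<in> positive_cone. cmod (eigen_coord (1 - \<theta>) x) < cmod (eigen_coord \<theta> x)}"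
proof (intro equalityI subsetI)
  fix y assume "y \<in> domain_of \<theta>"
  then obtain z where z: "z \<in> lie_ball" "y = line_through (tube \<theta> z)" by (auto simp: domain_of_def)
  then show "y \<in> line_through ` {x \<in> positive_cone. cmod (eigen_coord (1 - \<theta>) x) < cmod (eigen_coord \<theta> x)}"
    using tube_in_positive_cone[OF l z(1)] l by (auto simp: lie_ball_def)
next
  fix y assume "y \<in> line_through ` {x \<in> positive_cone. cmod (eigen_coord (1 - \<theta>) x) < cmod (eigen_coord \<theta> x)}"
  then show "y \<in> domain_of \<theta>"
    using affine_coord_in_lie_ball[OF l] unfolding domain_of_def by blast
qed

lemma period_space_eq:
  assumes "hexroot \<theta>"
  shows "period_space (gram :: int ^ ('n::finite + 2) ^ ('n + 2)) = domain_of \<theta> \<union> domain_of (1 - \<theta>)"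
proof -
  have "(positive_cone :: (complex ^ ('n + 2)) set) = {x \<in> positive_cone. cmod (eigen_coord (1 - \<theta>) x) < cmod (eigen_coord \<theta> x)} \<union>
      {x \<in> positive_cone. cmod (eigen_coord \<theta> x) < cmod (eigen_coord (1 - \<theta>) x)}"
    using positive_cone_eigen[OF assms] by (auto simp: neq_iff)
  then show ?thesis
    unfolding period_space_gram domain_of_eq[OF assms] domain_of_eq[OF hexroot_compl[OF assms]]
    by (simp flip: image_Un)
qed

lemma continuous_on_eigen_coord [continuous_intros]:
  "continuous_on S f \<Longrightarrow> continuous_on S (\<lambda>x. eigen_coord \<theta> (f x))"
  unfolding eigen_coord_def divide_inverse by (intro continuous_intros)

lemma continuous_on_quad [continuous_intros]:
  "continuous_on S f \<Longrightarrow> continuous_on S (\<lambda>x. quad (f x))"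
  unfolding quad_def by (intro continuous_intros) auto

lemma cdiff_quad [simp]: "cdiff quad z"
  unfolding quad_def by (intro cdiff_intros) auto

lemma cdiff_tube: "cdiff (\<lambda>z. tube \<theta> z $ i) z"
proof -
  have "cdiff (\<lambda>z. - \<theta> - (1 - \<theta>) * quad z) z"
    using cdiff_add[OF cdiff_const[of "- \<theta>"] cdiff_mult[OF cdiff_const[of "\<theta> - 1"] cdiff_quad], of z]
    by (simp add: algebra_simps)
  then have "\<forall>i. cdiff (\<lambda>z. tube \<theta> z $ i) z"
    unfolding all_block by (auto intro: cdiff_add)
  then show ?thesis by blast
qed

lemma continuous_on_tube: "continuous_on S (tube \<theta>)"
proof -
  have "continuous_on S (\<lambda>z. tube \<theta> z $ i)" for i
    using cdiff_continuous[OF cdiff_tube] continuous_at_imp_continuous_on by blast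
  then have "continuous_on S (\<lambda>z. \<chi> i. tube \<theta> z $ i)" by (rule continuous_on_vec_lambda)
  then show ?thesis by simp
qed

lemma open_lie_ball: "open (lie_ball :: (complex ^ 'n::finite) set)"
proof -
  have "open {z :: complex ^ 'n. cmod (quad z) < 1}" by (rule open_Collect_less) (intro continuous_intros)+
  moreover have "open {z :: complex ^ 'n. (norm z)\<^sup>2 < 3 * (1 + (cmod (quad z))\<^sup>2)}"
    by (rule open_Collect_less) (intro continuous_intros)+
  ultimately show ?thesis unfolding lie_ball_def by (simp add: open_Collect_conj)
qed

text \<open>With Q the squared modulus of \<open>quad z\<close>, the identity 3 (1 + t^4 Q) - 3 t^2
  (1 + Q) = 3 (1 - t^2)(1 - t^2 Q) and Q \<le> 1 show that the second inequality survives shrinking.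
  So the Lie ball is starlike, which gives its connectedness.\<close>

lemma scale_in_lie_ball:
  assumes "z \<in> lie_ball" "0 \<le> t" "t \<le> 1"
  shows "complex_of_real t *s z \<in> lie_ball"
proof -
  define Q where "Q = (cmod (quad z))\<^sup>2"
  have q: "quad (complex_of_real t *s z) = of_real (t\<^sup>2) * quad z"
    by (simp add: quad_def power_mult_distrib sum_distrib_left)
  have z: "cmod (quad z) < 1" "(norm z)\<^sup>2 < 3 * (1 + Q)" using assms(1) by (auto simp: lie_ball_def Q_def)
  have Q: "0 \<le> Q" "Q \<le> 1" using z(1) by (auto simp: Q_def abs_square_le_1)
  have t2: "0 \<le> t\<^sup>2" "t\<^sup>2 \<le> 1" using assms by (auto simp: power_le_one)
  have "cmod (quad (complex_of_real t *s z)) = t\<^sup>2 * cmod (quad z)" by (simp add: q norm_mult norm_power)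
  moreover have "t\<^sup>2 * cmod (quad z) \<le> 1 * cmod (quad z)" using t2 by (intro mult_right_mono) auto
  ultimately have 1: "cmod (quad (complex_of_real t *s z)) < 1" using z(1) by simp
  have 2: "(cmod (quad (complex_of_real t *s z)))\<^sup>2 = t\<^sup>2 * t\<^sup>2 * Q"
    by (simp add: q norm_mult norm_power Q_def power2_eq_square)
  have n: "(norm (complex_of_real t *s z))\<^sup>2 = t\<^sup>2 * (norm z)\<^sup>2" using assms by (simp add: norm_vector_smult power_mult_distrib)
  have "t\<^sup>2 * (norm z)\<^sup>2 < 3 * (1 + t\<^sup>2 * t\<^sup>2 * Q)"
  proof (cases "t = 0")
    case False
    then have "t\<^sup>2 * (norm z)\<^sup>2 < t\<^sup>2 * (3 * (1 + Q))" using z(2) by simp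
    moreover have "t\<^sup>2 * Q \<le> 1 * 1" using t2 Q by (intro mult_mono) auto
    then have "0 \<le> 3 * ((1 - t\<^sup>2) * (1 - t\<^sup>2 * Q))" using t2 by simp
    ultimately show ?thesis by (simp add: algebra_simps)
  qed simp
  then show ?thesis using 1 by (simp add: lie_ball_def n 2)
qed

lemma zero_in_lie_ball [simp]: "0 \<in> lie_ball" by (simp add: lie_ball_def quad_def)

lemma connected_lie_ball: "connected (lie_ball :: (complex ^ 'n::finite) set)"
proof (rule starlike_imp_connected)
  have "closed_segment 0 z \<subseteq> lie_ball" if z: "z \<in> lie_ball" for z :: "complex ^ 'n"
  proof
    fix x assume "x \<in> closed_segment 0 z"
    then obtain t where t: "0 \<le> t" "t \<le> 1" "x = t *\<^sub>R z" by (auto simp: closed_segment_def)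
    have "x = complex_of_real t *s z" unfolding t(3) vec_eq_iff by (simp add: scaleR_conv_of_real[where 'a = complex])
    then show "x \<in> lie_ball" using scale_in_lie_ball[OF z t(1,2)] by simp
  qed
  then show "starlike (lie_ball :: (complex ^ 'n) set)" unfolding starlike_def using zero_in_lie_ball by blast
qed

lemma open_image_coord:
  fixes N :: "(complex ^ 'n::finite) set"
  assumes "open N"
  shows "open {x. eigen_coord \<theta> x \<noteq> 0 \<and> affine_coord \<theta> x \<in> N}"
proof -
  have "open {x :: complex ^ ('n + 2). eigen_coord \<theta> x \<noteq> 0}"
    by (rule open_Collect_neq) (intro continuous_intros)+
  moreover have "continuous_on {x. eigen_coord \<theta> x \<noteq> 0} (affine_coord \<theta> :: complex ^ ('n + 2) \<Rightarrow> complex ^ 'n)"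
    unfolding affine_coord_def by (rule continuous_on_vec_lambda) (auto intro!: continuous_intros)
  ultimately have "open ({x :: complex ^ ('n + 2). eigen_coord \<theta> x \<noteq> 0} \<inter> affine_coord \<theta> -` N)"
    using assms by (intro continuous_open_preimage) auto
  then show ?thesis by (simp add: vimage_def Int_def)
qed

text \<open>An open set of the ambient space, invariant under nonzero scalars, by which an open set
  of affine coordinates is thickened to an open set of projective space.\<close>

definition cone_over :: "complex \<Rightarrow> (complex ^ 'n::finite) set \<Rightarrow> (complex ^ ('n + 2)) set" where
  "cone_over \<theta> N = {x. eigen_coord \<theta> x \<noteq> 0 \<and> affine_coord \<theta> x \<in> N}"

lemma cone_over:
  assumes "open N"
  shows "openin (cs_top projective_space) (line_through ` cone_over \<theta> N)"
    and "\<And>x. x \<noteq> 0 \<Longrightarrow> line_through x \<in> line_through ` cone_over \<theta> N \<longleftrightarrow> x \<in> cone_over \<theta> N"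
proof -
  have "open (cone_over \<theta> N)" unfolding cone_over_def by (rule open_image_coord[OF assms])
  moreover have "0 \<notin> cone_over \<theta> N" by (simp add: cone_over_def eigen_coord_def)
  moreover have "c *s x \<in> cone_over \<theta> N" if "c \<noteq> 0" "x \<in> cone_over \<theta> N" for c x
    using that by (simp add: cone_over_def affine_coord_scale)
  ultimately show "openin (cs_top projective_space) (line_through ` cone_over \<theta> N)"
    and "\<And>x. x \<noteq> 0 \<Longrightarrow> line_through x \<in> line_through ` cone_over \<theta> N \<longleftrightarrow> x \<in> cone_over \<theta> N"
    using openin_projective_cone by blast+
qed

lemma tube_in_cone_over: "hexroot \<theta> \<Longrightarrow> tube \<theta> z \<in> cone_over \<theta> N \<longleftrightarrow> z \<in> N"
  by (simp add: cone_over_def)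

lemma inj_line_tube: 
  assumes l: "hexroot \<theta>" and eq: "line_through (tube \<theta> z) = line_through (tube \<theta> z')"
  shows "z = z'"
proof -
  obtain c where c: "c \<noteq> 0" "tube \<theta> z' = c *s tube \<theta> z" using eq line_through_eq_iff l tube_nonzero by metis
  then have "affine_coord \<theta> (tube \<theta> z') = affine_coord \<theta> (tube \<theta> z)" using affine_coord_scale by metis
  then show ?thesis using l by simp
qed

lemma topspace_projective: "cs_points (projective_space :: (complex^'m::finite) set cspace) = line_through ` (- {0})"
  by (simp add: projective_space_def)

lemma domain_subset: "hexroot \<theta> \<Longrightarrow> domain_of \<theta> \<subseteq> cs_points projective_space"
  unfolding topspace_projective domain_of_def using tube_nonzero by auto

lemma open_tube_preimage:
  fixes T :: "(complex ^ ('n::finite + 2)) set set"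
  assumes l: "hexroot \<theta>" and T: "openin (cs_top projective_space) T"
  shows "open {z \<in> lie_ball. line_through (tube \<theta> z) \<in> T}"
proof -
  have o: "open {x. x \<noteq> 0 \<and> line_through x \<in> T}" using T by (simp add: openin_projective)
  have "open (lie_ball \<inter> tube \<theta> -` {x. x \<noteq> 0 \<and> line_through x \<in> T})"
    by (rule continuous_open_preimage[OF continuous_on_tube open_lie_ball o])
  moreover have "lie_ball \<inter> tube \<theta> -` {x. x \<noteq> 0 \<and> line_through x \<in> T} = {z \<in> lie_ball. line_through (tube \<theta> z) \<in> T}"
    using l by auto
  ultimately show ?thesis by simp
qed

lemma openin_domain:
  fixes S :: "(complex ^ ('n::finite + 2)) set set"
  assumes l: "hexroot \<theta>"
  shows "openin (subtopology (cs_top projective_space) (domain_of \<theta>)) S \<longleftrightarrow>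
    S \<subseteq> domain_of \<theta> \<and> open {z \<in> lie_ball. line_through (tube \<theta> z) \<in> S}"
proof
  assume "openin (subtopology (cs_top projective_space) (domain_of \<theta>)) S"
  then obtain T where T: "openin (cs_top projective_space) T" "S = T \<inter> domain_of \<theta>" by (auto simp: openin_subtopology)
  have "{z \<in> lie_ball. line_through (tube \<theta> z) \<in> S} = {z \<in> lie_ball. line_through (tube \<theta> z) \<in> T}"
    by (auto simp: T domain_of_def)
  then show "S \<subseteq> domain_of \<theta> \<and> open {z \<in> lie_ball. line_through (tube \<theta> z) \<in> S}"
    using open_tube_preimage[OF l T(1)] T(2) by simp
next
  assume S: "S \<subseteq> domain_of \<theta> \<and> open {z \<in> lie_ball. line_through (tube \<theta> z) \<in> S}"
  define N where "N = {z \<in> lie_ball. line_through (tube \<theta> z) \<in> S}"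
  have N: "open N" using S by (simp add: N_def)
  have "S = line_through ` cone_over \<theta> N \<inter> domain_of \<theta>"
  proof (intro equalityI subsetI)
    fix x assume x: "x \<in> S"
    then obtain z where z: "z \<in> lie_ball" "x = line_through (tube \<theta> z)" using S by (auto simp: domain_of_def)
    then have "z \<in> N" using x by (simp add: N_def)
    then have "tube \<theta> z \<in> cone_over \<theta> N" using tube_in_cone_over[OF l] by blast
    then show "x \<in> line_through ` cone_over \<theta> N \<inter> domain_of \<theta>" using z by (auto simp: domain_of_def)
  next
    fix x assume x: "x \<in> line_through ` cone_over \<theta> N \<inter> domain_of \<theta>"
    then obtain z where z: "z \<in> lie_ball" "x = line_through (tube \<theta> z)" by (auto simp: domain_of_def)
    then have "tube \<theta> z \<in> cone_over \<theta> N" using x cone_over(2)[OF N] tube_nonzero[OF l] by blast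
    then have "z \<in> N" using tube_in_cone_over[OF l] by blast
    then show "x \<in> S" using z by (simp add: N_def)
  qed
  then show "openin (subtopology (cs_top projective_space) (domain_of \<theta>)) S"
    using cone_over(1)[OF N] by (auto simp: openin_subtopology)
qed

lemma cdiff_affine_coord:
  assumes "eigen_coord \<theta> x \<noteq> 0"
  shows "cdiff (\<lambda>x. affine_coord \<theta> x $ a) x"
proof -
  have "cdiff (\<lambda>x. x $ Inl a * (1 - 2 * \<theta>) / (x $ Inr 1 + (1 - \<theta>) * x $ Inr 0)) x"
    using assms by (intro cdiff_intros) (auto simp: eigen_coord_def)
  then show ?thesis by (simp add: affine_coord_def eigen_coord_def)
qed

text \<open>The subspace structure asks for an extension to an open set of projective space. It is
  obtained by retracting along \<open>affine_coord\<close>, which makes sense on the whole cone and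
  not only on isotropic vectors.\<close>

lemma cs_hol_domain:
  fixes h :: "(complex ^ ('n::finite + 2)) set \<Rightarrow> complex"
  assumes l: "hexroot \<theta>" and z: "z \<in> lie_ball"
  shows "cs_hol (cs_sub projective_space (domain_of \<theta>)) h (line_through (tube \<theta> z)) \<longleftrightarrow>
    hol_at (\<lambda>z. h (line_through (tube \<theta> z))) z"
proof
  assume "cs_hol (cs_sub projective_space (domain_of \<theta>)) h (line_through (tube \<theta> z))"
  then obtain V F where V: "openin (cs_top projective_space) V" "line_through (tube \<theta> z) \<in> V"
    "\<forall>y\<in>V. cs_hol projective_space F y" "\<forall>y\<in>V \<inter> domain_of \<theta>. F y = h y"
    by (auto simp: cs_hol_sub)
  then have "hol_at (F \<circ> line_through) (tube \<theta> z)"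
    using tube_nonzero[OF l] unfolding cs_hol_projective by blast
  then have "hol_at (F \<circ> line_through \<circ> tube \<theta>) z"
    by (intro hol_at_compose[OF open_UNIV UNIV_I] cdiff_tube)
  moreover have "hol_at (F \<circ> line_through \<circ> tube \<theta>) z \<longleftrightarrow> hol_at (\<lambda>z. h (line_through (tube \<theta> z))) z"
  proof (rule hol_at_cong[OF open_tube_preimage[OF l V(1)]])
    fix y assume "y \<in> {z \<in> lie_ball. line_through (tube \<theta> z) \<in> V}"
    then show "(F \<circ> line_through \<circ> tube \<theta>) y = h (line_through (tube \<theta> y))"
      using V(4) by (simp add: domain_of_def)
  qed (use z V(2) in simp)
  ultimately show "hol_at (\<lambda>z. h (line_through (tube \<theta> z))) z" by simp
next
  assume "hol_at (\<lambda>z. h (line_through (tube \<theta> z))) z"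
  then obtain N where N: "open N" "z \<in> N" "\<And>y. y \<in> N \<Longrightarrow> cdiff (\<lambda>z. h (line_through (tube \<theta> z))) y"
    by (auto simp: hol_at_def)
  \<comment> \<open>The choice selects a vector on the line \<open>l\<close>;
    \<open>affine_coord\<close> does not depend on its scale.\<close>
  define F where "F l = h (line_through (tube \<theta> (affine_coord \<theta> (SOME x. x \<noteq> 0 \<and> line_through x = l))))" for l
  have F: "F (line_through x) = h (line_through (tube \<theta> (affine_coord \<theta> x)))" if x: "x \<noteq> 0" for x
  proof -
    define y where "y = (SOME y. y \<noteq> 0 \<and> line_through y = line_through x)"
    have y: "y \<noteq> 0 \<and> line_through y = line_through x" unfolding y_def by (rule someI[of _ x]) (use x in simp)
    then obtain c where "c \<noteq> 0" "x = c *s y" using line_through_eq_iff by blast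
    then show ?thesis unfolding F_def y_def[symmetric] by (simp add: affine_coord_scale)
  qed
  define V where "V = line_through ` cone_over \<theta> N"
  have V: "openin (cs_top projective_space) V" unfolding V_def by (rule cone_over(1)[OF N(1)])
  have Fh: "hol_at (F \<circ> line_through) x" if x: "x \<noteq> 0" "line_through x \<in> V" for x
  proof -
    have xc: "x \<in> cone_over \<theta> N" using x cone_over(2)[OF N(1)] unfolding V_def by blast
    have o: "open (cone_over \<theta> N)" unfolding cone_over_def by (rule open_image_coord[OF N(1)])
    have nz: "y \<noteq> 0" if "y \<in> cone_over \<theta> N" for y using that by (auto simp: cone_over_def eigen_coord_def)
    have "hol_at ((\<lambda>z. h (line_through (tube \<theta> z))) \<circ> affine_coord \<theta>) x"
    proof (rule hol_at_compose[OF o xc])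
      show "cdiff (\<lambda>x. affine_coord \<theta> x $ i) y" if "y \<in> cone_over \<theta> N" for i y
        by (rule cdiff_affine_coord) (use that in \<open>simp add: cone_over_def\<close>)
      show "hol_at (\<lambda>z. h (line_through (tube \<theta> z))) (affine_coord \<theta> x)"
        using N xc by (intro hol_atI[of N]) (auto simp: cone_over_def)
    qed
    moreover have "hol_at ((\<lambda>z. h (line_through (tube \<theta> z))) \<circ> affine_coord \<theta>) x \<longleftrightarrow> hol_at (F \<circ> line_through) x"
      by (rule hol_at_cong[OF o xc]) (use nz F in simp)
    ultimately show ?thesis by simp
  qed
  have "line_through (tube \<theta> z) \<in> V" unfolding V_def using tube_in_cone_over[OF l] N(2) by blast
  moreover have "\<forall>y\<in>V. cs_hol projective_space F y" unfolding cs_hol_projective using V Fh by blast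
  moreover have "\<forall>y\<in>V \<inter> domain_of \<theta>. F y = h y"
    using F tube_nonzero[OF l] l by (auto simp: domain_of_def)
  ultimately show "cs_hol (cs_sub projective_space (domain_of \<theta>)) h (line_through (tube \<theta> z))"
    unfolding cs_hol_sub using V by blast
qed

subsection \<open>The components of the period space\<close>

lemma domain_connectedin:
  fixes P :: "(complex ^ ('n::finite + 2)) set set"
  assumes l: "hexroot \<theta>" and P: "domain_of \<theta> \<subseteq> P"
  shows "connectedin (subtopology (cs_top projective_space) P) (domain_of \<theta>)"
proof -
  have "continuous_map (top_of_set lie_ball) (cs_top projective_space) (\<lambda>z::complex^'n. line_through (tube \<theta> z))"
    unfolding continuous_map_def
  proof (intro conjI allI impI)
    show "(\<lambda>z::complex^'n. line_through (tube \<theta> z)) \<in> topspace (top_of_set lie_ball) \<rightarrow> cs_points projective_space"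
      using tube_nonzero[OF l] by (auto simp: topspace_projective)
    fix U :: "(complex ^ ('n + 2)) set set" assume "openin (cs_top projective_space) U"
    then show "openin (top_of_set lie_ball) {x \<in> topspace (top_of_set lie_ball). line_through (tube \<theta> (x::complex^'n)) \<in> U}"
      using open_tube_preimage[OF l] openin_open_eq[OF open_lie_ball] by auto
  qed
  moreover have "connectedin (top_of_set lie_ball) (lie_ball :: (complex^'n) set)"
    using connected_lie_ball by (simp add: connectedin_subtopology)
  ultimately have "connectedin (cs_top projective_space) (domain_of \<theta> :: (complex ^ ('n + 2)) set set)"
    unfolding domain_of_def by (rule connectedin_continuous_map_image)
  then show ?thesis using P by (simp add: connectedin_subtopology)
qed

lemma domain_openin:
  assumes l: "hexroot \<theta>"
  shows "openin (subtopology (cs_top projective_space) (period_space gram)) (domain_of \<theta> :: (complex ^ ('n::finite + 2)) set set)"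
proof -
  define C where "C = {x :: complex ^ ('n + 2). cmod (eigen_coord (1 - \<theta>) x) < cmod (eigen_coord \<theta> x)}"
  have "open C" unfolding C_def by (rule open_Collect_less) (intro continuous_intros)+
  moreover have "0 \<notin> C" by (simp add: C_def eigen_coord_def)
  moreover have "c *s x \<in> C" if "c \<noteq> 0" "x \<in> C" for c x using that by (simp add: C_def norm_mult)
  ultimately have C: "openin (cs_top projective_space) (line_through ` C)"
    "\<And>x. x \<noteq> 0 \<Longrightarrow> line_through x \<in> line_through ` C \<longleftrightarrow> x \<in> C"
    using openin_projective_cone[of C] by blast+
  have "(domain_of \<theta> :: (complex ^ ('n + 2)) set set) = line_through ` C \<inter> period_space gram"
  proof (intro equalityI subsetI)
    fix y :: "(complex ^ ('n + 2)) set" assume "y \<in> domain_of \<theta>"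
    then show "y \<in> line_through ` C \<inter> period_space gram"
      unfolding domain_of_eq[OF l] period_space_gram C_def by blast
  next
    fix y :: "(complex ^ ('n + 2)) set" assume y: "y \<in> line_through ` C \<inter> period_space gram"
    then obtain x where x: "x \<in> positive_cone" "y = line_through x" unfolding period_space_gram by blast
    then have "x \<noteq> 0" by (simp add: positive_cone_def)
    then have "x \<in> C" using C(2) y x by blast
    then show "y \<in> domain_of \<theta>" unfolding domain_of_eq[OF l] C_def using x by blast
  qed
  then show ?thesis using C(1) by (auto simp: openin_subtopology)
qed

lemma domain_disjoint:
  assumes l: "hexroot \<theta>"
  shows "domain_of \<theta> \<inter> domain_of (1 - \<theta>) = ({} :: (complex ^ ('n::finite + 2)) set set)"
proof (rule ccontr)
  assume "domain_of \<theta> \<inter> domain_of (1 - \<theta>) \<noteq> ({} :: (complex ^ ('n + 2)) set set)"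
  then obtain x y :: "complex ^ ('n + 2)" where x: "cmod (eigen_coord (1 - \<theta>) x) < cmod (eigen_coord \<theta> x)" "x \<in> positive_cone"
    and y: "cmod (eigen_coord \<theta> y) < cmod (eigen_coord (1 - \<theta>) y)" and eq: "line_through x = line_through y"
    unfolding domain_of_eq[OF l] domain_of_eq[OF hexroot_compl[OF l]] by auto
  have "x \<noteq> 0" using x(2) by (simp add: positive_cone_def)
  then obtain c where "c \<noteq> 0" "y = c *s x" using eq line_through_eq_iff by blast
  then show False using x(1) y by (simp add: norm_mult)
qed

text \<open>The domains of \<theta> and 1 - \<theta> are connected, open, disjoint and cover the
  period space, so the given component is one of them and dictates the choice of \<theta>.\<close>

lemma period_domains_gram:
  assumes D: "D \<in> period_domains (gram :: int ^ ('n::finite + 2) ^ ('n + 2))"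
  obtains \<theta> where "hexroot \<theta>" "D = domain_of \<theta>"
proof -
  let ?T = "subtopology (cs_top projective_space) (period_space (gram :: int ^ ('n + 2) ^ ('n + 2)))"
  have D': "D \<in> connected_components_of ?T" using D by (simp add: period_domains_def)
  obtain \<omega> where \<omega>: "hexroot \<omega>" using exists_hexroot by blast
  have "D \<noteq> {}" "D \<subseteq> topspace ?T" using D' nonempty_connected_components_of connected_components_of_subset by blast+
  then obtain p where p: "p \<in> D" "p \<in> period_space gram" by auto
  then have "p \<in> domain_of \<omega> \<or> p \<in> domain_of (1 - \<omega>)" using period_space_eq[OF \<omega>] by blast
  then obtain \<theta> where l: "hexroot \<theta>" "p \<in> domain_of \<theta>" using \<omega> hexroot_compl by metis
  have sub: "domain_of \<theta> \<subseteq> period_space gram" using period_space_eq[OF l(1)] by blast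
  have "domain_of \<theta> \<subseteq> D"
    by (rule connected_components_of_maximal[OF D' domain_connectedin[OF l(1) sub]]) (use p l in \<open>auto simp: disjnt_def\<close>)
  moreover have "D \<subseteq> domain_of \<theta>"
  proof (rule ccontr)
    assume "\<not> D \<subseteq> domain_of \<theta>"
    moreover have DP: "D \<subseteq> domain_of \<theta> \<union> domain_of (1 - \<theta>)"
      using \<open>D \<subseteq> topspace ?T\<close> period_space_eq[OF l(1)] by auto
    ultimately have "domain_of (1 - \<theta>) \<inter> D \<noteq> {}" by blast
    moreover have "connectedin ?T D" by (rule connectedin_connected_components_of[OF D'])
    moreover have "domain_of \<theta> \<inter> D \<noteq> {}" using p l by blast
    ultimately show False
      unfolding connectedin using domain_openin[OF l(1)] domain_openin[OF hexroot_compl[OF l(1)]] DP domain_disjoint[OF l(1)]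
      by (metis inf_bot_left)
  qed
  ultimately show thesis using that l by blast
qed

lemma period_domains_gram_nonempty: "period_domains (gram :: int ^ ('n::finite + 2) ^ ('n + 2)) \<noteq> {}"
proof -
  let ?T = "subtopology (cs_top projective_space) (period_space (gram :: int ^ ('n + 2) ^ ('n + 2)))"
  obtain \<theta> where l: "hexroot \<theta>" using exists_hexroot by blast
  have "line_through (tube \<theta> (0 :: complex ^ 'n)) \<in> domain_of \<theta>" by (simp add: domain_of_def)
  then have "topspace ?T \<noteq> {}"
    using period_space_eq[OF l] domain_subset[OF l] by auto
  then show ?thesis unfolding period_domains_def by (simp add: connected_components_of_eq_empty flip: null_topspace_iff_trivial)
qed

subsection \<open>The action of the orthogonal group\<close>

lemma of_int_mat_scale:
  fixes x :: "'a::comm_ring_1 ^ 'm::finite"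
  shows "of_int_mat h *v (c *s x) = c *s (of_int_mat h *v x)"
  by (simp add: vec_eq_iff matrix_vector_mult_def sum_distrib_left mult_ac)

lemma lattice_act_line: "lattice_act h (line_through x) = line_through (of_int_mat h *v x)"
proof -
  have "lattice_act h (line_through x) = range (\<lambda>c. of_int_mat h *v (c *s x))"
    by (simp add: lattice_act_def line_through_def image_image of_int_mat_def)
  then show ?thesis by (simp add: of_int_mat_scale line_through_def)
qed

lemma lattice_act_mult: "lattice_act (h ** h') l = lattice_act h (lattice_act h' l)"
proof -
  have "lattice_act h'' l = (*v) (of_int_mat h'') ` l" for h'' :: "int ^ 'a ^ 'a" and l
    by (simp add: lattice_act_def of_int_mat_def)
  then show ?thesis by (simp add: image_image of_int_mat_mult matrix_vector_mul_assoc)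
qed

lemma lattice_act_one [simp]: "lattice_act (mat 1) l = l"
proof -
  have "lattice_act (mat 1) l = (*v) (of_int_mat (mat 1)) ` l"
    unfolding lattice_act_def of_int_mat_def ..
  then show ?thesis by simp
qed

lemma group_O_plus: "group (O_plus (G :: int ^ 'm::finite ^ 'm) D)"
proof (rule groupI)
  fix x y assume x: "x \<in> carrier (O_plus G D)" and y: "y \<in> carrier (O_plus G D)"
  have "transpose (x ** y) ** G ** (x ** y) = transpose y ** (transpose x ** G ** x) ** y"
    by (simp add: matrix_transpose_mul matrix_mul_assoc)
  also have "\<dots> = G" using x y by (simp add: O_plus_def)
  finally have "transpose (x ** y) ** G ** (x ** y) = G" .
  moreover have "invertible (x ** y)" using x y by (simp add: O_plus_def invertible_mult)
  moreover have "lattice_act (x ** y) ` D = lattice_act x ` (lattice_act y ` D)"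
    by (simp add: lattice_act_mult image_image)
  ultimately show "x \<otimes>\<^bsub>O_plus G D\<^esub> y \<in> carrier (O_plus G D)" using x y by (simp add: O_plus_def)
next
  have "invertible (mat 1 :: int ^ 'm ^ 'm)" unfolding invertible_def by (intro exI[of _ "mat 1"]) simp
  then show "\<one>\<^bsub>O_plus G D\<^esub> \<in> carrier (O_plus G D)"
    by (simp add: O_plus_def transpose_mat)
next
  fix x assume x: "x \<in> carrier (O_plus G D)"
  then obtain y where y: "x ** y = mat 1" "y ** x = mat 1" unfolding O_plus_def invertible_def by auto
  have iso: "transpose x ** G ** x = G" and xD: "lattice_act x ` D = D" using x by (auto simp: O_plus_def)
  have "transpose y ** G ** y = transpose y ** (transpose x ** G ** x) ** y" by (simp only: iso)
  also have "\<dots> = transpose (x ** y) ** G ** (x ** y)" by (simp only: matrix_transpose_mul matrix_mul_assoc)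
  also have "\<dots> = G" by (simp add: y transpose_mat)
  finally have "transpose y ** G ** y = G" .
  moreover have "lattice_act y ` D = D"
  proof -
    have "lattice_act y ` (lattice_act x ` D) = D" by (simp add: image_image y flip: lattice_act_mult)
    then show ?thesis by (simp only: xD)
  qed
  moreover have "invertible y" unfolding invertible_def using y by blast
  ultimately have "y \<in> carrier (O_plus G D)" by (simp add: O_plus_def)
  then show "\<exists>y\<in>carrier (O_plus G D). y \<otimes>\<^bsub>O_plus G D\<^esub> x = \<one>\<^bsub>O_plus G D\<^esub>"
    using y by (auto simp: O_plus_def)
qed (simp_all add: O_plus_def matrix_mul_assoc)

lemma hexroot_pow6:
  assumes "hexroot \<theta>" shows "\<theta> ^ 6 = 1"
proof -
  have "\<theta> ^ 6 - 1 = (\<theta>\<^sup>2 - \<theta> + 1) * ((\<theta> - 1) * (\<theta> + 1) * (\<theta>\<^sup>2 + \<theta> + 1))" by algebra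
  then show ?thesis using assms by (simp add: hexroot_def)
qed

lemma eisenstein_unit_cases:
  assumes "eisenstein_unit a b"
  shows "(a, b) \<in> {(1, 0), (-1, 0), (0, 1), (0, -1), (1, -1), (-1, 1)}"
proof -
  have "\<bar>a\<bar> \<le> 1" "\<bar>b\<bar> \<le> 1" using eisenstein_unit_bound[OF assms] by auto
  then have "a = -1 \<or> a = 0 \<or> a = 1" "b = -1 \<or> b = 0 \<or> b = 1" by linarith+
  then show ?thesis using assms by (auto simp: eisenstein_unit_def)
qed

lemma eisenstein_unit_pow6:
  assumes "hexroot \<theta>" "eisenstein_unit a b"
  shows "(of_int a + of_int b * \<theta>) ^ 6 = 1"
proof -
  have 1: "\<theta> ^ 6 = 1" "(1 - \<theta>) ^ 6 = 1" using hexroot_pow6 hexroot_compl assms(1) by auto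
  have "(- x) ^ 6 = x ^ 6" for x :: complex by simp
  from this[of \<theta>] this[of "1 - \<theta>"] 1 have 2: "(-\<theta>) ^ 6 = 1" "(\<theta> - 1) ^ 6 = 1" by simp_all
  have "- 1 + \<theta> = \<theta> - 1" by simp
  then show ?thesis using eisenstein_unit_cases[OF assms(2)] 1 2 by auto
qed

text \<open>Both quadratic factors split with the help of \<theta>: the primitive cube roots are
  -\<theta> and \<theta> - 1, the primitive sixth roots \<theta> and 1 - \<theta>. Every scalar of
  \<mu>_6 therefore comes from a rotation.\<close>

lemma sixth_root_eisenstein:
  assumes \<theta>: "hexroot \<theta>" and e: "e ^ 6 = 1"
  obtains a b where "eisenstein_unit a b" "e = of_int a + of_int b * \<theta>"
proof -
  consider "e = 1" | "e = -1" | "e\<^sup>2 + e + 1 = 0" | "e\<^sup>2 - e + 1 = 0" using sixth_root_cases[OF e] by blast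
  then show thesis
  proof cases
    case 1 then show thesis using that[of 1 0] by (simp add: eisenstein_unit_def)
  next
    case 2 then show thesis using that[of "-1" 0] by (simp add: eisenstein_unit_def)
  next
    case 3
    then have "(e + \<theta>) * (e - (\<theta> - 1)) = 0" using \<theta> unfolding hexroot_def by algebra
    then have "e = - \<theta> \<or> e = -1 + \<theta>" by (auto simp: eq_neg_iff_add_eq_0)
    then show thesis using that[of 0 "-1"] that[of "-1" 1] by (auto simp: eisenstein_unit_def)
  next
    case 4
    then have "(e - \<theta>) * (e - (1 - \<theta>)) = 0" using \<theta> unfolding hexroot_def by algebra
    then have "e = \<theta> \<or> e = 1 - \<theta>" by auto
    then show thesis using that[of 0 1] that[of 1 "-1"] by (auto simp: eisenstein_unit_def)
  qed
qed

lemma quad_scale: "quad (c *s z) = c\<^sup>2 * quad z"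
  by (simp add: quad_def power_mult_distrib sum_distrib_left)

text \<open>The eigenvectors w and w' are multiplied by e and its inverse, and the negative part is
  fixed. Normalising the coefficient of w back to 1 divides z by e, so rotations act on the Lie ball
  by scalars.\<close>

lemma rot_tube:
  fixes z :: "complex ^ 'n::finite"
  assumes \<theta>: "hexroot \<theta>" and u: "eisenstein_unit a b"
  defines "e \<equiv> of_int a + of_int b * \<theta>"
  shows "of_int_mat (rot a b) *v tube \<theta> z = e *s tube \<theta> (inverse e *s z)"
proof -
  define e' where "e' = of_int a + of_int b * (1 - \<theta>)"
  have h: "\<theta>\<^sup>2 - \<theta> + 1 = 0" using \<theta> by (simp add: hexroot_def)
  have u': "(of_int a)\<^sup>2 + of_int a * of_int b + (of_int b)\<^sup>2 = (1::complex)"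
    using u unfolding eisenstein_unit_def by (metis of_int_1 of_int_add of_int_mult of_int_power)
  have ee: "e * e' = 1" unfolding e_def e'_def using h u' by algebra
  then have e0: "e \<noteq> 0" and inv: "inverse e = e'" by (auto simp: inverse_unique)
  have q: "quad (e' *s z) = e'\<^sup>2 * quad z" by (rule quad_scale)
  have "\<forall>i. (of_int_mat (rot a b) *v tube \<theta> z) $ i = (e *s tube \<theta> (e' *s z)) $ i"
    unfolding all_block
  proof (intro conjI allI)
    show "(of_int_mat (rot a b) *v tube \<theta> z) $ Inl s = (e *s tube \<theta> (e' *s z)) $ Inl s" for s
      using ee by (simp add: rot_nth mult.assoc[symmetric])
    have "of_int a * (1 + quad z) - of_int b * (- \<theta> - (1 - \<theta>) * quad z) = e * (1 + e'\<^sup>2 * quad z)"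
      using ee e_def e'_def by algebra
    then show "(of_int_mat (rot a b) *v tube \<theta> z) $ Inr 0 = (e *s tube \<theta> (e' *s z)) $ Inr 0"
      by (simp add: rot_nth q)
    have "of_int b * (1 + quad z) + (of_int a + of_int b) * (- \<theta> - (1 - \<theta>) * quad z) = e * (- \<theta> - (1 - \<theta>) * (e'\<^sup>2 * quad z))"
      using ee e_def e'_def h by algebra
    then show "(of_int_mat (rot a b) *v tube \<theta> z) $ Inr 1 = (e *s tube \<theta> (e' *s z)) $ Inr 1"
      by (simp add: rot_nth q)
  qed
  then show ?thesis by (simp add: vec_eq_iff inv)
qed

lemma root_scale_lie_ball: "e ^ 6 = 1 \<Longrightarrow> z \<in> lie_ball \<Longrightarrow> e *s z \<in> lie_ball"
  by (simp add: lie_ball_def quad_scale norm_mult norm_power norm_vector_smult norm_sixth_root)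

lemma rot_domain:
  assumes \<theta>: "hexroot \<theta>" and u: "eisenstein_unit a b"
  shows "lattice_act (rot a b) ` domain_of \<theta> = (domain_of \<theta> :: (complex ^ ('n::finite + 2)) set set)"
proof -
  have sub: "lattice_act (rot a b) ` domain_of \<theta> \<subseteq> (domain_of \<theta> :: (complex ^ ('n + 2)) set set)"
    if u: "eisenstein_unit a b" for a b
  proof
    fix l :: "(complex ^ ('n + 2)) set" assume "l \<in> lattice_act (rot a b) ` domain_of \<theta>"
    then obtain z :: "complex ^ 'n" where z: "z \<in> lie_ball" "l = lattice_act (rot a b) (line_through (tube \<theta> z))"
      unfolding domain_of_def by blast
    define e where "e = of_int a + of_int b * \<theta>"
    have e6: "e ^ 6 = 1" unfolding e_def by (rule eisenstein_unit_pow6[OF \<theta> u])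
    then have "e \<noteq> 0" by auto
    then have "l = line_through (tube \<theta> (inverse e *s z))"
      unfolding z(2) lattice_act_line rot_tube[OF \<theta> u] e_def[symmetric] by (rule line_through_scale)
    moreover have "inverse e *s z \<in> lie_ball" by (rule root_scale_lie_ball) (use e6 z in \<open>auto simp: power_inverse\<close>)
    ultimately show "l \<in> domain_of \<theta>" unfolding domain_of_def by blast
  qed
  show ?thesis
  proof (rule equalityI[OF sub[OF u]])
    have "lattice_act (rot a b) ` (lattice_act (rot (a + b) (-b)) ` domain_of \<theta>) = (domain_of \<theta> :: (complex ^ ('n + 2)) set set)"
      by (simp add: image_image rot_conj[OF u] flip: lattice_act_mult)
    then show "domain_of \<theta> \<subseteq> lattice_act (rot a b) ` (domain_of \<theta> :: (complex ^ ('n + 2)) set set)"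
      using sub[OF eisenstein_unit_conj[OF u]] by (metis image_mono)
  qed
qed

text \<open>
  If \<open>h\<close> moves \<open>z\<close> to \<open>z'\<close>, both close to the centre, then the image \<open>e\<close> of a basis vector of the
  negative definite part is almost orthogonal to \<open>w\<close>.  As \<open>e\<close> is integral, its \<open>A\<^sub>2\<close>-component,
  which has norm \<open>2N\<close>, must vanish.
\<close>

lemma isometry_near_center:
  fixes h :: "int ^ ('n::finite + 2) ^ ('n + 2)" and z z' :: "complex ^ 'n"
  assumes iso: "transpose h ** gram ** h = gram" and \<theta>: "hexroot \<theta>"
    and z: "norm z < 1 / 10" "norm z' < 1 / 10" and c: "of_int_mat h *v tube \<theta> z = c *s tube \<theta> z'"
  shows "h $ Inr 0 $ Inl i = 0" "h $ Inr 1 $ Inl i = 0"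
proof -
  define p q where "p = h $ Inr 0 $ Inl i" and "q = h $ Inr 1 $ Inl i"
  define m where "m a = h $ Inl a $ Inl i" for a
  define N where "N = p\<^sup>2 + p * q + q\<^sup>2"
  define e where "e = of_int_mat h *v (axis (Inl i) 1 :: complex ^ ('n + 2))"
  have e: "e $ Inr 0 = of_int p" "e $ Inr 1 = of_int q" "e $ Inl a = of_int (m a)" for a
    by (simp_all add: e_def mult_axis_eq_column column_def of_int_mat_def p_def q_def m_def)
  have sum_m: "(\<Sum>a\<in>UNIV. (m a)\<^sup>2) = 2 * N + 1"
    using isometry_columns[OF iso, of "Inl i" "Inl i"]
    by (simp add: lattice_form_gram column_def p_def q_def m_def N_def power2_eq_square algebra_simps)
  have N4: "4 * N = (2 * p + q)\<^sup>2 + 3 * q\<^sup>2" by (simp add: N_def power2_eq_square algebra_simps)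
  then have N0: "0 \<le> N" by (smt (verit) zero_le_power2)
  define A where "A = eigen_coord (1 - \<theta>) e"
  have "(\<chi> j. cnj (e $ j)) = e"
  proof -
    have "\<forall>j. cnj (e $ j) = e $ j" unfolding all_block by (simp add: e)
    then show ?thesis by (simp add: vec_eq_iff)
  qed
  then have cA: "eigen_coord \<theta> e = cnj A" using eigen_coord_cnj[OF \<theta>, of e] by (simp add: A_def)
  \<comment> \<open>The modulus of the A_2-contribution 3 A to the pairing \<open>F\<close> below;
    its square 3 N can be compared with the sum 2 N + 1 of the squares of the
    \<open>m a\<close>.\<close>
  define U where "U = 3 * cmod A"
  have U2: "U\<^sup>2 = 3 * of_int N"
  proof -
    have "6 * (cnj A * A) = of_int (2 * N)"
      using form_eigen[OF \<theta>, of e e] by (simp add: lattice_form_gram e cA A_def[symmetric] N_def power2_eq_square algebra_simps)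
    then have "complex_of_real (6 * (cmod A)\<^sup>2) = complex_of_real (of_int (2 * N))"
      by (simp add: complex_norm_square mult.commute del: of_real_power)
    then have "6 * (cmod A)\<^sup>2 = of_int (2 * N)" by (simp only: of_real_eq_iff)
    then show ?thesis by (simp add: U_def power_mult_distrib)
  qed
  have quad_small: "cmod (quad x) \<le> 1 / 600" if "norm x < 1 / 10" for x :: "complex ^ 'n"
  proof -
    have "(norm x)\<^sup>2 \<le> (1 / 10)\<^sup>2" using that by (intro power_mono) auto
    then show ?thesis using cmod_quad_le[of x] by (simp add: power2_eq_square)
  qed
  \<comment> \<open>The hermitian square of \<open>tube \<theta> x\<close>, close to 3 near the
    centre. As \<open>h\<close> preserves it, the scalar \<open>c\<close> cannot be small.\<close>
  define T where "T x = 3 * (1 + (cmod (quad x))\<^sup>2) - (norm x)\<^sup>2" for x :: "complex ^ 'n"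
  have T: "lattice_form gram (tube \<theta> x) (\<chi> i. cnj (tube \<theta> x $ i)) = of_real (T x)" for x :: "complex ^ 'n"
    unfolding form_cnj_eigen[OF \<theta>] by (simp add: \<theta> T_def norm_square_sum)
  have T_bounds: "2 \<le> T x" "T x \<le> 4" if "norm x < 1 / 10" for x
  proof -
    have "(norm x)\<^sup>2 \<le> (1 / 10)\<^sup>2" using that by (intro power_mono) auto
    moreover have "(cmod (quad x))\<^sup>2 \<le> (1 / 600)\<^sup>2" using quad_small[OF that] by (intro power_mono) auto
    ultimately have "(norm x)\<^sup>2 \<le> 1" "(cmod (quad x))\<^sup>2 \<le> 1 / 3" by (simp_all add: power_divide)
    moreover have "0 \<le> (norm x)\<^sup>2" "0 \<le> (cmod (quad x))\<^sup>2" by simp_all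
    ultimately show "2 \<le> T x" "T x \<le> 4" unfolding T_def by argo+
  qed
  have "of_real (T z) = lattice_form gram (of_int_mat h *v tube \<theta> z) (of_int_mat h *v (\<chi> i. cnj (tube \<theta> z $ i)))"
    by (simp add: lattice_form_isometry[OF iso] T)
  also have "of_int_mat h *v (\<chi> i. cnj (tube \<theta> z $ i)) = (\<chi> i. cnj ((of_int_mat h *v tube \<theta> z) $ i))"
    by (simp add: vec_eq_iff matrix_vector_mult_def of_int_mat_def)
  also have "lattice_form gram (of_int_mat h *v tube \<theta> z) (\<chi> i. cnj ((of_int_mat h *v tube \<theta> z) $ i))
      = c * cnj c * lattice_form gram (tube \<theta> z') (\<chi> i. cnj (tube \<theta> z' $ i))"
    unfolding c by (simp add: lattice_form_def sum_distrib_left mult_ac)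
  also have "\<dots> = of_real ((cmod c)\<^sup>2 * T z')"
    by (simp only: T complex_norm_square of_real_mult)
  finally have "T z = (cmod c)\<^sup>2 * T z'" by (simp only: of_real_eq_iff)
  also have "\<dots> \<le> (cmod c)\<^sup>2 * 4" using T_bounds(2)[OF z(2)] by (intro mult_left_mono) auto
  finally have "(1/2)\<^sup>2 \<le> (cmod c)\<^sup>2" using T_bounds(1)[OF z(1)] by (simp add: power2_eq_square)
  then have c_half: "1 / 2 \<le> cmod c" by (rule power2_le_imp_le) simp
  \<comment> \<open>By the isometry property c F is the pairing of the basis vector with
    \<open>tube \<theta> z\<close>, which is minus the i-th coordinate of z and hence less than 1/10
    in modulus.\<close>
  define F where "F = lattice_form gram e (tube \<theta> z')"
  have "c * F = lattice_form gram e (c *s tube \<theta> z')"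
    by (simp add: F_def lattice_form_def sum_distrib_left mult_ac)
  also have "\<dots> = lattice_form gram (axis (Inl i) 1) (tube \<theta> z)"
    unfolding c[symmetric] e_def by (rule lattice_form_isometry[OF iso])
  also have "\<dots> = - z $ i"
    by (simp add: lattice_form_gram) (simp add: axis_def if_distrib[of "\<lambda>x. x * _"] cong: if_cong)
  finally have "cmod c * cmod F = cmod (z $ i)" by (metis norm_minus_cancel norm_mult)
  then have cF: "cmod c * cmod F < 1 / 10" using Finite_Cartesian_Product.norm_nth_le[of z i] z(1) by simp
  \<comment> \<open>If N \<ge> 1 then U \<ge> 1, while the terms of F other than 3 A are at most
    U/600 and U/10. So |F| \<ge> 1/2, and with |c| \<ge> 1/2 the product is at least 1/4, against
    the bound 1/10.\<close>
  have "N = 0"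
  proof (rule ccontr)
    assume "N \<noteq> 0"
    then have N1: "1 \<le> N" using N0 by simp
    have U0: "0 \<le> U" by (simp add: U_def)
    have "1\<^sup>2 \<le> U\<^sup>2" using N1 unfolding U2 by simp
    then have U1: "1 \<le> U" using U0 by (rule power2_le_imp_le)
    have S: "cmod (\<Sum>a\<in>UNIV. of_int (m a) * z' $ a) \<le> U / 10"
    proof -
      have "cmod (\<Sum>a\<in>UNIV. of_int (m a) * z' $ a) \<le> (\<Sum>a\<in>UNIV. \<bar>of_int (m a)\<bar> * \<bar>cmod (z' $ a)\<bar>)"
        by (rule order_trans[OF norm_sum]) (simp add: norm_mult)
      also have "\<dots> \<le> L2_set (\<lambda>a. of_int (m a)) UNIV * L2_set (\<lambda>a. cmod (z' $ a)) UNIV"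
        by (rule L2_set_mult_ineq)
      also have "L2_set (\<lambda>a. cmod (z' $ a)) UNIV = norm z'" by (simp add: norm_vec_def)
      \<comment> \<open>By \<open>sum_m\<close> this is 2 N + 1 \<le> 3 N, valid as N \<ge>
        1.\<close>
      also have "L2_set (\<lambda>a. real_of_int (m a)) UNIV \<le> U"
      proof (rule power2_le_imp_le[OF _ U0])
        have "(L2_set (\<lambda>a. real_of_int (m a)) UNIV)\<^sup>2 = of_int (\<Sum>a\<in>UNIV. (m a)\<^sup>2)"
          by (simp add: L2_set_def sum_nonneg)
        then show "(L2_set (\<lambda>a. real_of_int (m a)) UNIV)\<^sup>2 \<le> U\<^sup>2" using N1 by (simp add: sum_m U2)
      qed
      finally have "cmod (\<Sum>a\<in>UNIV. of_int (m a) * z' $ a) \<le> U * norm z'" by (simp add: mult_right_mono)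
      also have "\<dots> \<le> U * (1 / 10)" using z(2) U0 by (intro mult_left_mono) auto
      finally show ?thesis by simp
    qed
    have F_eq: "F = 3 * A + 3 * (cnj A * quad z') - (\<Sum>a\<in>UNIV. of_int (m a) * z' $ a)"
      unfolding F_def form_eigen[OF \<theta>] by (simp add: \<theta> cA A_def[symmetric] e algebra_simps)
    have q: "cmod (3 * (cnj A * quad z')) \<le> U / 600"
    proof -
      have "cmod (3 * (cnj A * quad z')) = U * cmod (quad z')" by (simp add: norm_mult U_def)
      also have "\<dots> \<le> U * (1 / 600)" using quad_small[OF z(2)] U0 by (intro mult_left_mono)
      finally show ?thesis by simp
    qed
    have "3 * A = F - 3 * (cnj A * quad z') + (\<Sum>a\<in>UNIV. of_int (m a) * z' $ a)" by (simp add: F_eq)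
    moreover have "cmod (3 * A) = U" by (simp add: U_def norm_mult)
    ultimately have "U \<le> cmod F + cmod (3 * (cnj A * quad z')) + cmod (\<Sum>a\<in>UNIV. of_int (m a) * z' $ a)"
      using norm_triangle_ineq[of "F - 3 * (cnj A * quad z')" "\<Sum>a\<in>UNIV. of_int (m a) * z' $ a"]
        norm_triangle_ineq4[of F "3 * (cnj A * quad z')"] by simp
    then have "1 / 2 \<le> cmod F" using S q U1 by linarith
    then have "1 / 2 * (1 / 2) \<le> cmod c * cmod F" using c_half by (intro mult_mono) auto
    then show False using cF by simp
  qed
  then have "q\<^sup>2 = 0 \<and> (2 * p + q)\<^sup>2 = 0" using N4 by (smt (verit) zero_le_power2)
  then show "h $ Inr 0 $ Inl i = 0" "h $ Inr 1 $ Inl i = 0" by (auto simp: p_def q_def)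
qed

subsection \<open>The modular variety\<close>

text \<open>Reduces the analytic statement to \<open>fib\<close>, a question about which group
  elements relate two points near the centre. Openness and holomorphy on the quotient hold because
  the group acts on the Lie ball by holomorphic maps.\<close>

lemma modular_variety_sextic_model:
  fixes \<Gamma> :: "(int ^ ('n::finite + 2) ^ ('n + 2)) set"
  assumes \<theta>: "hexroot \<theta>" and one: "mat 1 \<in> \<Gamma>"
    and mult: "\<And>g h. g \<in> \<Gamma> \<Longrightarrow> h \<in> \<Gamma> \<Longrightarrow> g ** h \<in> \<Gamma>"
    and inv: "\<And>g. g \<in> \<Gamma> \<Longrightarrow> \<exists>h\<in>\<Gamma>. h ** g = mat 1"
    and act: "\<And>g. g \<in> \<Gamma> \<Longrightarrow> lattice_act g ` domain_of \<theta> = domain_of \<theta>"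
    and r: "0 < r" "ball 0 r \<subseteq> (lie_ball :: (complex ^ 'n) set)"
    and fib: "\<And>z z' :: complex ^ 'n. z \<in> ball 0 r \<Longrightarrow> z' \<in> ball 0 r \<Longrightarrow>
      (\<exists>g\<in>\<Gamma>. line_through (tube \<theta> z') = lattice_act g (line_through (tube \<theta> z))) \<longleftrightarrow> (\<exists>e. e ^ 6 = 1 \<and> z' = e *s z)"
  shows "sextic_model (modular_variety (domain_of \<theta>) \<Gamma>)
    (\<lambda>z :: complex ^ 'n. (\<lambda>g. lattice_act g (line_through (tube \<theta> z))) ` \<Gamma>) r"
proof -
  define L where "L z = line_through (tube \<theta> z)" for z :: "complex ^ 'n"
  define orb where "orb l = (\<lambda>g. lattice_act g l) ` \<Gamma>" for l
  define \<pi> where "\<pi> z = orb (L z)" for z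
  define M where "M = cs_sub (projective_space :: (complex ^ ('n + 2)) set cspace) (domain_of \<theta>)"
  define X where "X = cs_quotient M orb"
  have X: "modular_variety (domain_of \<theta>) \<Gamma> = X"
    unfolding modular_variety_def X_def M_def orb_def ..
  have topM: "topspace (cs_top M) = domain_of \<theta>"
    using domain_subset[OF \<theta>] by (auto simp: M_def)
  have M_open: "openin (cs_top M) S \<longleftrightarrow> S \<subseteq> domain_of \<theta> \<and> open {z \<in> lie_ball. L z \<in> S}" for S
    unfolding M_def cs_top_sub L_def by (rule openin_domain[OF \<theta>])
  have M_hol: "cs_hol M h (L z) \<longleftrightarrow> hol_at (\<lambda>z. h (L z)) z" if "z \<in> lie_ball" for h z
    unfolding M_def L_def by (rule cs_hol_domain[OF \<theta> that])
  have L_in: "L z \<in> domain_of \<theta>" if "z \<in> lie_ball" for z using that by (auto simp: L_def domain_of_def)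
  have domL: "\<exists>z\<in>lie_ball. l = L z" if "l \<in> domain_of \<theta>" for l using that by (auto simp: L_def domain_of_def)
  have orb_eq: "orb l = orb l' \<longleftrightarrow> (\<exists>g\<in>\<Gamma>. l' = lattice_act g l)" for l l'
  proof
    assume eq: "orb l = orb l'"
    have "l' = lattice_act (mat 1) l'" by simp
    then have "l' \<in> orb l'" unfolding orb_def using one by blast
    then show "\<exists>g\<in>\<Gamma>. l' = lattice_act g l" unfolding eq[symmetric] by (auto simp: orb_def)
  next
    assume "\<exists>g\<in>\<Gamma>. l' = lattice_act g l"
    then obtain g where g: "g \<in> \<Gamma>" "l' = lattice_act g l" by blast
    obtain h where h: "h \<in> \<Gamma>" "h ** g = mat 1" using inv[OF g(1)] by blast
    show "orb l = orb l'"
    proof (intro equalityI subsetI)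
      fix x assume "x \<in> orb l"
      then obtain k where k: "k \<in> \<Gamma>" "x = lattice_act k l" by (auto simp: orb_def)
      have "lattice_act (k ** h) l' = lattice_act k (lattice_act (h ** g) l)" unfolding g(2) by (simp only: lattice_act_mult)
      then have "x = lattice_act (k ** h) l'" using k h by simp
      then show "x \<in> orb l'" using mult[OF k(1) h(1)] by (auto simp: orb_def)
    next
      fix x assume "x \<in> orb l'"
      then obtain k where k: "k \<in> \<Gamma>" "x = lattice_act k l'" by (auto simp: orb_def)
      then have "x = lattice_act (k ** g) l" by (simp add: g(2) lattice_act_mult)
      then show "x \<in> orb l" using mult[OF k(1) g(1)] by (auto simp: orb_def)
    qed
  qed
  \<comment> \<open>The action of \<open>g\<close> on the Lie ball in affine coordinates, a
    fractional linear map in the entries of \<open>tube \<theta> z\<close>.\<close>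
  define \<sigma> where "\<sigma> g z = affine_coord \<theta> (of_int_mat g *v tube \<theta> z)" for g :: "int ^ ('n + 2) ^ ('n + 2)" and z :: "complex ^ 'n"
  have \<sigma>: "\<sigma> g z \<in> lie_ball" "L (\<sigma> g z) = lattice_act g (L z)" "eigen_coord \<theta> (of_int_mat g *v tube \<theta> z) \<noteq> 0"
    if g: "g \<in> \<Gamma>" and z: "z \<in> lie_ball" for g z
  proof -
    have "lattice_act g (L z) \<in> domain_of \<theta>" using act[OF g] L_in[OF z] by blast
    then obtain z' where z': "z' \<in> lie_ball" "lattice_act g (L z) = L z'" using domL by blast
    then have "line_through (tube \<theta> z') = line_through (of_int_mat g *v tube \<theta> z)" by (simp add: L_def lattice_act_line)
    then obtain c where c: "c \<noteq> 0" "of_int_mat g *v tube \<theta> z = c *s tube \<theta> z'"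
      using line_through_eq_iff[OF tube_nonzero[OF \<theta>]] by blast
    then have "\<sigma> g z = z'" by (simp add: \<sigma>_def affine_coord_scale \<theta>)
    then show "\<sigma> g z \<in> lie_ball" "L (\<sigma> g z) = lattice_act g (L z)" using z' by simp_all
    show "eigen_coord \<theta> (of_int_mat g *v tube \<theta> z) \<noteq> 0" using c by (simp add: \<theta>)
  qed
  have cd: "cdiff (\<lambda>z. (of_int_mat g *v tube \<theta> z) $ i) z" for g :: "int ^ ('n + 2) ^ ('n + 2)" and i and z :: "complex ^ 'n"
    unfolding matrix_vector_mult_def by (simp, intro cdiff_intros cdiff_tube)
  have cont: "continuous_on S (\<lambda>z. of_int_mat g *v tube \<theta> z)" for S and g :: "int ^ ('n + 2) ^ ('n + 2)"
  proof -
    have "continuous_on S (\<lambda>z. (of_int_mat g *v tube \<theta> z) $ i)" for i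
      using cdiff_continuous[OF cd] continuous_at_imp_continuous_on by blast
    then have "continuous_on S (\<lambda>z. \<chi> i. (of_int_mat g *v tube \<theta> z) $ i)" by (rule continuous_on_vec_lambda)
    then show ?thesis by simp
  qed
  have open_\<sigma>: "open {z \<in> lie_ball. \<sigma> g z \<in> S}" if g: "g \<in> \<Gamma>" and S: "open S" for g S
  proof -
    have "open (lie_ball \<inter> (\<lambda>z. of_int_mat g *v tube \<theta> z) -` {x. eigen_coord \<theta> x \<noteq> 0 \<and> affine_coord \<theta> x \<in> S})"
      by (rule continuous_open_preimage[OF cont open_lie_ball open_image_coord[OF S]])
    moreover have "lie_ball \<inter> (\<lambda>z. of_int_mat g *v tube \<theta> z) -` {x. eigen_coord \<theta> x \<noteq> 0 \<and> affine_coord \<theta> x \<in> S}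
        = {z \<in> lie_ball. \<sigma> g z \<in> S}"
      using \<sigma>(3)[OF g] by (auto simp: \<sigma>_def)
    ultimately show ?thesis by simp
  qed
  have \<pi>_eq: "\<pi> z = \<pi> z' \<longleftrightarrow> (\<exists>g\<in>\<Gamma>. z' = \<sigma> g z)" if "z \<in> lie_ball" for z z'
  proof -
    have "L z' = L (\<sigma> g z) \<longleftrightarrow> z' = \<sigma> g z" for g
      using inj_line_tube[OF \<theta>] by (auto simp: L_def)
    then show ?thesis unfolding \<pi>_def orb_eq using \<sigma>(2)[OF _ that] by metis
  qed
  have sh: "sheafy X" unfolding X_def M_def by (rule sheafy_quotient[OF sheafy_sub])
  have im: "openin (cs_top X) (\<pi> ` S)" if S: "open S" "S \<subseteq> lie_ball" for S
  proof -
    \<comment> \<open>The saturation of S is a union of preimages of S under the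
      \<open>\<sigma> g\<close>, open however many group elements there are.\<close>
    have "{z \<in> lie_ball. L z \<in> {l \<in> topspace (cs_top M). orb l \<in> \<pi> ` S}} = (\<Union>g\<in>\<Gamma>. {z \<in> lie_ball. \<sigma> g z \<in> S})"
    proof (intro equalityI subsetI)
      fix z assume "z \<in> {z \<in> lie_ball. L z \<in> {l \<in> topspace (cs_top M). orb l \<in> \<pi> ` S}}"
      then obtain s where "z \<in> lie_ball" "s \<in> S" "\<pi> z = \<pi> s" by (auto simp: \<pi>_def)
      then show "z \<in> (\<Union>g\<in>\<Gamma>. {z \<in> lie_ball. \<sigma> g z \<in> S})" using \<pi>_eq[of z s] by auto
    next
      fix z assume "z \<in> (\<Union>g\<in>\<Gamma>. {z \<in> lie_ball. \<sigma> g z \<in> S})"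
      then obtain g where g: "g \<in> \<Gamma>" "z \<in> lie_ball" "\<sigma> g z \<in> S" by blast
      then have "\<pi> z = \<pi> (\<sigma> g z)" using \<pi>_eq by blast
      then have "orb (L z) \<in> \<pi> ` S" using g(3) unfolding \<pi>_def by blast
      then show "z \<in> {z \<in> lie_ball. L z \<in> {l \<in> topspace (cs_top M). orb l \<in> \<pi> ` S}}"
        using g(2) L_in topM by simp
    qed
    moreover have "open (\<Union>g\<in>\<Gamma>. {z \<in> lie_ball. \<sigma> g z \<in> S})" using open_\<sigma> S(1) by (intro open_UN) blast
    ultimately have "openin (cs_top M) {l \<in> topspace (cs_top M). orb l \<in> \<pi> ` S}"
      unfolding M_open using topM by auto
    moreover have "\<pi> ` S \<subseteq> orb ` topspace (cs_top M)"
      unfolding \<pi>_def topM using L_in S(2) by blast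
    ultimately show ?thesis unfolding X_def cs_top_quotient openin_quotient_top by blast
  qed
  have vim: "open {z \<in> lie_ball. \<pi> z \<in> U}" if "openin (cs_top X) U" for U
  proof -
    have "openin (cs_top M) {l \<in> topspace (cs_top M). orb l \<in> U}"
      using that unfolding X_def cs_top_quotient openin_quotient_top by blast
    then have "open {z \<in> lie_ball. L z \<in> {l \<in> topspace (cs_top M). orb l \<in> U}}" unfolding M_open by blast
    moreover have "{z \<in> lie_ball. L z \<in> {l \<in> topspace (cs_top M). orb l \<in> U}} = {z \<in> lie_ball. \<pi> z \<in> U}"
      using L_in topM by (auto simp: \<pi>_def)
    ultimately show ?thesis by simp
  qed
  have hol: "cs_hol X h (\<pi> z) \<longleftrightarrow> hol_at (h \<circ> \<pi>) z" if z: "z \<in> lie_ball" for h z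
  proof
    assume "cs_hol X h (\<pi> z)"
    then obtain V where V: "\<pi> z \<in> V" "\<And>l. l \<in> topspace (cs_top M) \<Longrightarrow> orb l \<in> V \<Longrightarrow> cs_hol M (h \<circ> orb) l"
      unfolding X_def cs_hol_quotient by blast
    have "cs_hol M (h \<circ> orb) (L z)" using V L_in[OF z] topM by (simp add: \<pi>_def)
    then show "hol_at (h \<circ> \<pi>) z" unfolding M_hol[OF z] by (simp add: comp_def \<pi>_def)
  next
    assume "hol_at (h \<circ> \<pi>) z"
    then obtain N0 where N0: "open N0" "z \<in> N0" "\<And>y. y \<in> N0 \<Longrightarrow> hol_at (h \<circ> \<pi>) y"
      unfolding hol_at_def by blast
    define N where "N = N0 \<inter> lie_ball"
    have N: "open N" "z \<in> N" "N \<subseteq> lie_ball" "\<And>y. y \<in> N \<Longrightarrow> hol_at (h \<circ> \<pi>) y"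
      using N0 z open_lie_ball by (auto simp: N_def)
    \<comment> \<open>Holomorphy is required along the whole orbit; \<open>\<sigma> g\<close>
      carries the point back into \<open>N\<close>, and invariance of \<open>\<pi>\<close>
      transports the germ.\<close>
    have "cs_hol M (h \<circ> orb) l" if l: "l \<in> topspace (cs_top M)" "orb l \<in> \<pi> ` N" for l
    proof -
      obtain y where y: "y \<in> lie_ball" "l = L y" using domL l(1) topM by auto
      obtain x where x: "x \<in> N" "\<pi> y = \<pi> x" using l(2) y(2) by (auto simp: \<pi>_def)
      then obtain g where g: "g \<in> \<Gamma>" "x = \<sigma> g y" using \<pi>_eq[OF y(1)] by blast
      have "hol_at (h \<circ> \<pi> \<circ> \<sigma> g) y"
      proof (rule hol_at_compose[OF open_lie_ball y(1)])
        fix i w assume w: "w \<in> (lie_ball :: (complex ^ 'n) set)"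
        have "cdiff ((\<lambda>x. affine_coord \<theta> x $ i) \<circ> (\<lambda>z. of_int_mat g *v tube \<theta> z)) w"
          by (rule cdiff_compose[OF cd cdiff_affine_coord[OF \<sigma>(3)[OF g(1) w]]])
        then show "cdiff (\<lambda>z. \<sigma> g z $ i) w" by (simp add: \<sigma>_def comp_def)
      qed (use N(4) x g in simp)
      moreover have "hol_at (h \<circ> \<pi> \<circ> \<sigma> g) y \<longleftrightarrow> hol_at (\<lambda>z. (h \<circ> orb) (L z)) y"
      proof (rule hol_at_cong[OF open_lie_ball y(1)])
        fix w assume "w \<in> (lie_ball :: (complex ^ 'n) set)"
        then have "\<pi> w = \<pi> (\<sigma> g w)" using \<pi>_eq g(1) by blast
        then show "(h \<circ> \<pi> \<circ> \<sigma> g) w = (h \<circ> orb) (L w)" by (simp add: \<pi>_def)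
      qed
      ultimately show ?thesis unfolding y(2) M_hol[OF y(1)] by simp
    qed
    then show "cs_hol X h (\<pi> z)"
      unfolding X_def cs_hol_quotient using im[OF N(1,3)] N(2) unfolding X_def cs_top_quotient by blast
  qed
  have "sextic_model X \<pi> r"
  proof
    show "0 < r" by (rule r(1))
    show "sheafy X" by (rule sh)
    show "openin (cs_top X) (\<pi> ` S)" if "open S" "S \<subseteq> ball 0 r" for S
      by (rule im) (use that r(2) in auto)
    show "open {z \<in> ball 0 r. \<pi> z \<in> U}" if "openin (cs_top X) U" for U
    proof -
      have "open (ball 0 r \<inter> {z \<in> lie_ball. \<pi> z \<in> U})" by (intro open_Int open_ball vim[OF that])
      moreover have "ball 0 r \<inter> {z \<in> lie_ball. \<pi> z \<in> U} = {z \<in> ball 0 r. \<pi> z \<in> U}" using r(2) by blast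
      ultimately show ?thesis by simp
    qed
    show "\<pi> z = \<pi> z' \<longleftrightarrow> (\<exists>e. e ^ 6 = 1 \<and> z' = e *s z)" if "z \<in> ball 0 r" "z' \<in> ball 0 r" for z z'
      using fib[OF that] unfolding \<pi>_def orb_eq L_def .
    show "cs_hol X h (\<pi> z) \<longleftrightarrow> hol_at (h \<circ> \<pi>) z" if "z \<in> ball 0 r" for z h
      by (rule hol) (use that r(2) in blast)
  qed
  then show ?thesis unfolding X \<pi>_def orb_def L_def .
qed

text \<open>
  The level is 3 because an isometry near the centre has entries in \<open>{-1, 0, 1}\<close> and is therefore
  determined by its residues modulo 3.
\<close>

definition level3_group :: "complex \<Rightarrow> (int ^ ('n::finite + 2) ^ ('n + 2)) set" where
  "level3_group \<theta> = {h \<in> carrier (O_plus gram (domain_of \<theta>)). \<exists>a b. eisenstein_unit a b \<and> cong3 h (rot a b)}"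

lemma rot_in_O_plus:
  assumes "hexroot \<theta>" "eisenstein_unit a b"
  shows "rot a b \<in> carrier (O_plus gram (domain_of \<theta> :: (complex ^ ('n::finite + 2)) set set))"
proof -
  have "invertible (rot a b :: int ^ ('n + 2) ^ ('n + 2))"
    unfolding invertible_def using rot_conj[OF assms(2)] by blast
  then show ?thesis using rot_isometry[OF assms(2)] rot_domain[OF assms] by (simp add: O_plus_def)
qed

lemma subgroup_level3:
  assumes \<theta>: "hexroot \<theta>"
  shows "subgroup (level3_group \<theta>) (O_plus gram (domain_of \<theta> :: (complex ^ ('n::finite + 2)) set set))"
proof -
  let ?G = "O_plus gram (domain_of \<theta> :: (complex ^ ('n + 2)) set set)"
  interpret group ?G by (rule group_O_plus)
  show ?thesis
  proof
    show "level3_group \<theta> \<subseteq> carrier ?G" by (auto simp: level3_group_def)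
    show "\<one>\<^bsub>?G\<^esub> \<in> level3_group \<theta>"
    proof -
      have "eisenstein_unit 1 0" by (simp add: eisenstein_unit_def)
      moreover have "cong3 \<one>\<^bsub>?G\<^esub> (rot 1 0)" by (simp add: O_plus_def rot_one cong3_refl)
      ultimately show ?thesis using one_closed unfolding level3_group_def by blast
    qed
    fix x :: "int ^ ('n + 2) ^ ('n + 2)" assume x: "x \<in> level3_group \<theta>"
    then obtain a b where ab: "x \<in> carrier ?G" "eisenstein_unit a b" "cong3 x (rot a b)" by (auto simp: level3_group_def)
    show "x \<otimes>\<^bsub>?G\<^esub> y \<in> level3_group \<theta>" if y: "y \<in> level3_group \<theta>" for y :: "int ^ ('n + 2) ^ ('n + 2)"
    proof -
      obtain c d where cd: "y \<in> carrier ?G" "eisenstein_unit c d" "cong3 y (rot c d)" using y by (auto simp: level3_group_def)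
      have "cong3 (x ** y) (rot (a * c - b * d) (a * d + b * c + b * d))"
        using cong3_mult[OF ab(3) cd(3)] by (simp add: rot_mult)
      moreover have "x \<otimes>\<^bsub>?G\<^esub> y = x ** y" by (simp add: O_plus_def)
      ultimately show ?thesis
        using m_closed[OF ab(1) cd(1)] eisenstein_unit_mult[OF ab(2) cd(2)] by (auto simp: level3_group_def)
    qed
    define y where "y = inv\<^bsub>?G\<^esub> x"
    have y: "y \<in> carrier ?G" "x ** y = mat 1"
      using inv_closed[OF ab(1)] r_inv[OF ab(1)] by (auto simp: y_def O_plus_def)
    \<comment> \<open>Multiplying \<open>rot a b\<close> congruent to \<open>x\<close> by
      \<open>y\<close> on the right and by the inverse rotation on the left isolates
      \<open>y\<close>.\<close>
    have "cong3 (rot (a + b) (-b) ** (rot a b ** y)) (rot (a + b) (-b) ** (x ** y))"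
      by (intro cong3_mult cong3_refl cong3_sym[OF ab(3)])
    moreover have "rot (a + b) (-b) ** (rot a b ** y) = y"
      by (simp add: matrix_mul_assoc rot_conj[OF ab(2)])
    ultimately have "cong3 y (rot (a + b) (-b))" by (simp add: y(2))
    then show "inv\<^bsub>?G\<^esub> x \<in> level3_group \<theta>"
      using y(1) eisenstein_unit_conj[OF ab(2)] by (auto simp: level3_group_def y_def)
  qed
qed

lemma finite_image_of_factor:
  assumes "finite (r ` S)" "\<And>x y. x \<in> S \<Longrightarrow> y \<in> S \<Longrightarrow> r x = r y \<Longrightarrow> f x = f y"
  shows "finite (f ` S)"
proof -
  have "f ` S \<subseteq> (\<lambda>k. f (SOME x. x \<in> S \<and> r x = k)) ` (r ` S)"
  proof
    fix v assume "v \<in> f ` S"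
    then obtain x where x: "x \<in> S" "v = f x" by auto
    have "(SOME y. y \<in> S \<and> r y = r x) \<in> S \<and> r (SOME y. y \<in> S \<and> r y = r x) = r x"
      by (rule someI[of _ x]) (use x in simp)
    then have "v = f (SOME y. y \<in> S \<and> r y = r x)" using assms(2) x by metis
    then show "v \<in> (\<lambda>k. f (SOME x. x \<in> S \<and> r x = k)) ` (r ` S)" using x(1) by blast
  qed
  then show ?thesis using assms(1) finite_surj by blast
qed

lemma finite_residue_matrices: "finite (range (\<lambda>A :: int ^ 'm::finite ^ 'k::finite. \<lambda>i j. A $ i $ j mod 3))"
proof (rule finite_subset)
  show "finite (PiE (UNIV :: 'k set) (\<lambda>_. PiE (UNIV :: 'm set) (\<lambda>_. {0..<3::int})))"
    by (intro finite_PiE) auto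
qed (auto simp: PiE_def extensional_def)

text \<open>A coset depends only on residues modulo 3: two isometries with equal residues differ by
  one congruent to the identity, which belongs to the group through the unit 1. Residue matrices are
  finite in number.\<close>

lemma finite_index_level3:
  assumes \<theta>: "hexroot \<theta>"
  shows "finite (rcosets\<^bsub>O_plus gram (domain_of \<theta> :: (complex ^ ('n::finite + 2)) set set)\<^esub> (level3_group \<theta>))"
proof -
  let ?G = "O_plus gram (domain_of \<theta> :: (complex ^ ('n + 2)) set set)"
  interpret group ?G by (rule group_O_plus)
  note sub = subgroup_level3[OF \<theta>, where 'n = 'n]
  have mult_eq: "x \<otimes>\<^bsub>?G\<^esub> y = x ** y" for x y by (simp add: O_plus_def)
  have "finite ((\<lambda>a. level3_group \<theta> #>\<^bsub>?G\<^esub> a) ` carrier ?G)"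
  proof (rule finite_image_of_factor)
    show "finite ((\<lambda>A i j. A $ i $ j mod 3) ` carrier ?G)"
      by (rule finite_subset[OF _ finite_residue_matrices]) auto
    fix x y assume x: "x \<in> carrier ?G" and y: "y \<in> carrier ?G"
      and eq: "(\<lambda>i j. x $ i $ j mod 3) = (\<lambda>i j. y $ i $ j mod 3)"
    have "x $ i $ j mod 3 = y $ i $ j mod 3" for i j using eq by meson
    then have xy: "cong3 x y" unfolding cong3_def by (simp add: mod_eq_dvd_iff)
    define y' where "y' = inv\<^bsub>?G\<^esub> y"
    have y': "y' \<in> carrier ?G" "y ** y' = mat 1" using inv_closed[OF y] r_inv[OF y] by (auto simp: y'_def O_plus_def)
    have "cong3 (x ** y') (y ** y')" by (rule cong3_mult[OF xy cong3_refl])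
    then have "cong3 (x ** y') (rot 1 0)" by (simp add: y'(2) rot_one)
    moreover have "x ** y' \<in> carrier ?G" using m_closed[OF x y'(1)] by (simp add: mult_eq)
    moreover have "eisenstein_unit 1 0" by (simp add: eisenstein_unit_def)
    ultimately have "x ** y' \<in> level3_group \<theta>" unfolding level3_group_def by blast
    then have "x \<otimes>\<^bsub>?G\<^esub> inv\<^bsub>?G\<^esub> y \<in> level3_group \<theta>" by (simp add: mult_eq y'_def)
    moreover have "x = (x \<otimes>\<^bsub>?G\<^esub> inv\<^bsub>?G\<^esub> y) \<otimes>\<^bsub>?G\<^esub> y" using x y by (simp add: m_assoc)
    ultimately have "x \<in> level3_group \<theta> #>\<^bsub>?G\<^esub> y" unfolding r_coset_def by blast
    then show "level3_group \<theta> #>\<^bsub>?G\<^esub> x = level3_group \<theta> #>\<^bsub>?G\<^esub> y"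
      using repr_independence[OF _ y sub] by simp
  qed
  moreover have "rcosets\<^bsub>?G\<^esub> (level3_group \<theta>) = (\<lambda>a. level3_group \<theta> #>\<^bsub>?G\<^esub> a) ` carrier ?G"
    by (auto simp: RCOSETS_def)
  ultimately show ?thesis by simp
qed

text \<open>An element relating two points near the centre has its inverse relating them backwards,
  so \<open>isometry_near_center\<close> applies to both and the element is a rotation. The radius
  is the one for which that estimate holds, and the ball lies in the Lie ball.\<close>

lemma level3_sextic_model:
  assumes \<theta>: "hexroot \<theta>"
  shows "sextic_model (modular_variety (domain_of \<theta>) (level3_group \<theta> :: (int ^ ('n::finite + 2) ^ ('n + 2)) set))
    (\<lambda>z :: complex ^ 'n. (\<lambda>g. lattice_act g (line_through (tube \<theta> z))) ` level3_group \<theta>) (1 / 10)"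
proof (rule modular_variety_sextic_model[OF \<theta>])
  let ?G = "O_plus gram (domain_of \<theta> :: (complex ^ ('n + 2)) set set)"
  interpret group ?G by (rule group_O_plus)
  interpret \<Gamma>: subgroup "level3_group \<theta>" ?G by (rule subgroup_level3[OF \<theta>])
  have ops: "x \<otimes>\<^bsub>?G\<^esub> y = x ** y" "\<one>\<^bsub>?G\<^esub> = mat 1" for x y by (simp_all add: O_plus_def)
  show "(mat 1 :: int ^ ('n + 2) ^ ('n + 2)) \<in> level3_group \<theta>" using \<Gamma>.one_closed by (simp add: ops)
  show "g ** h \<in> level3_group \<theta>" if "g \<in> level3_group \<theta>" "h \<in> level3_group \<theta>" for g h :: "int ^ ('n + 2) ^ ('n + 2)"
    using \<Gamma>.m_closed[OF that] by (simp add: ops)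
  show inv: "\<exists>h\<in>level3_group \<theta>. h ** g = mat 1" if "g \<in> level3_group \<theta>" for g :: "int ^ ('n + 2) ^ ('n + 2)"
    using \<Gamma>.m_inv_closed[OF that] l_inv[OF \<Gamma>.mem_carrier[OF that]] by (auto simp: ops)
  show act: "lattice_act g ` domain_of \<theta> = domain_of \<theta>" if "g \<in> level3_group \<theta>" for g :: "int ^ ('n + 2) ^ ('n + 2)"
    using \<Gamma>.mem_carrier[OF that] by (simp add: O_plus_def)
  show "ball 0 (1 / 10) \<subseteq> (lie_ball :: (complex ^ 'n) set)"
  proof
    fix z :: "complex ^ 'n" assume "z \<in> ball 0 (1 / 10)"
    then have "(norm z)\<^sup>2 \<le> (1 / 10)\<^sup>2" by (intro power_mono) auto
    then have "(norm z)\<^sup>2 \<le> 1 / 100" by (simp add: power_divide)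
    moreover have "0 \<le> (cmod (quad z))\<^sup>2" by simp
    ultimately show "z \<in> lie_ball" using cmod_quad_le[of z] unfolding lie_ball_def mem_Collect_eq by argo
  qed
  fix z z' :: "complex ^ 'n" assume z: "z \<in> ball 0 (1 / 10)" "z' \<in> ball 0 (1 / 10)"
  show "(\<exists>g\<in>level3_group \<theta>. line_through (tube \<theta> z') = lattice_act g (line_through (tube \<theta> z))) \<longleftrightarrow> (\<exists>e. e ^ 6 = 1 \<and> z' = e *s z)"
  proof
    assume "\<exists>g\<in>level3_group \<theta>. line_through (tube \<theta> z') = lattice_act g (line_through (tube \<theta> z))"
    then obtain g where g: "g \<in> level3_group \<theta>" "line_through (tube \<theta> z') = line_through (of_int_mat g *v tube \<theta> z)"
      by (auto simp: lattice_act_line)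
    obtain a b where ab: "eisenstein_unit a b" "cong3 g (rot a b)" using g(1) unfolding level3_group_def by blast
    have iso: "transpose g ** gram ** g = gram" using \<Gamma>.mem_carrier[OF g(1)] by (simp add: O_plus_def)
    define h where "h = inv\<^bsub>?G\<^esub> g"
    have h: "h \<in> carrier ?G" "h ** g = mat 1" "g ** h = mat 1"
      using inv_closed[OF \<Gamma>.mem_carrier[OF g(1)]] l_inv[OF \<Gamma>.mem_carrier[OF g(1)]] r_inv[OF \<Gamma>.mem_carrier[OF g(1)]]
      unfolding h_def ops by simp_all
    have iso': "transpose h ** gram ** h = gram" using h(1) by (simp add: O_plus_def)
    obtain c where c: "c \<noteq> 0" "of_int_mat g *v tube \<theta> z = c *s tube \<theta> z'"
      using g(2) line_through_eq_iff[OF tube_nonzero[OF \<theta>]] by blast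
    have "of_int_mat h *v (c *s tube \<theta> z') = of_int_mat (h ** g) *v tube \<theta> z"
      unfolding c(2)[symmetric] by (simp add: of_int_mat_mult matrix_vector_mul_assoc)
    then have "c *s (of_int_mat h *v tube \<theta> z') = tube \<theta> z" by (simp add: h(2) of_int_mat_scale)
    then have "inverse c *s (c *s (of_int_mat h *v tube \<theta> z')) = inverse c *s tube \<theta> z" by simp
    then have c': "of_int_mat h *v tube \<theta> z' = inverse c *s tube \<theta> z" using c(1) by (simp add: vector_smult_assoc)
    have n: "norm z < 1 / 10" "norm z' < 1 / 10" using z by auto
    have "g = rot a b"
      by (rule block_isometry_eq_rot[OF iso h(3) isometry_near_center[OF iso \<theta> n c(2)]
            isometry_near_center[OF iso' \<theta> n(2,1) c'] ab(2,1)])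
    define e where "e = of_int a + of_int b * \<theta>"
    have e6: "e ^ 6 = 1" unfolding e_def by (rule eisenstein_unit_pow6[OF \<theta> ab(1)])
    then have e0: "e \<noteq> 0" by auto
    have "line_through (tube \<theta> z') = line_through (tube \<theta> (inverse e *s z))"
      unfolding g(2) \<open>g = rot a b\<close> rot_tube[OF \<theta> ab(1)] e_def[symmetric] by (rule line_through_scale[OF e0])
    then have "z' = inverse e *s z" by (rule inj_line_tube[OF \<theta>])
    then show "\<exists>e. e ^ 6 = 1 \<and> z' = e *s z" using e6 by (intro exI[of _ "inverse e"]) (simp add: power_inverse)
  next
    assume "\<exists>e. e ^ 6 = 1 \<and> z' = e *s z"
    then obtain e where e: "e ^ 6 = 1" "z' = e *s z" by blast
    have e0: "e \<noteq> 0" using e(1) by auto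
    have "inverse e ^ 6 = 1" using e(1) by (simp add: power_inverse)
    then obtain a b where ab: "eisenstein_unit a b" "inverse e = of_int a + of_int b * \<theta>"
      by (rule sixth_root_eisenstein[OF \<theta>])
    have "rot a b \<in> level3_group \<theta>"
      using rot_in_O_plus[OF \<theta> ab(1)] ab(1) cong3_refl by (auto simp: level3_group_def)
    moreover have "lattice_act (rot a b) (line_through (tube \<theta> z)) = line_through (tube \<theta> z')"
      unfolding lattice_act_line rot_tube[OF \<theta> ab(1)] ab(2)[symmetric] e(2)
      using line_through_scale[of "inverse e"] e0 by simp
    ultimately show "\<exists>g\<in>level3_group \<theta>. line_through (tube \<theta> z') = lattice_act g (line_through (tube \<theta> z))"
      by metis
  qed
qed simp

lemma gram_modular_variety:
  assumes n: "2 \<le> CARD('n::finite)" "CARD('n) \<le> 5" and D: "D \<in> period_domains (gram :: int ^ ('n + 2) ^ ('n + 2))"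
  shows "\<exists>\<Gamma>. subgroup \<Gamma> (O_plus gram D) \<and> finite (rcosets\<^bsub>O_plus gram D\<^esub> \<Gamma>) \<and>
    (\<exists>x. noncanonical_singularity TYPE('n) (modular_variety D \<Gamma>) x \<and>
      cyclic_quotient_singularity (modular_variety D \<Gamma>) x 6 (\<lambda>_ :: 'n. 1))"
proof -
  obtain \<theta> where \<theta>: "hexroot \<theta>" "D = domain_of \<theta>" by (rule period_domains_gram[OF D])
  interpret sextic_model "modular_variety D (level3_group \<theta>)"
    "\<lambda>z :: complex ^ 'n. (\<lambda>g. lattice_act g (line_through (tube \<theta> z))) ` level3_group \<theta>" "1 / 10"
    unfolding \<theta>(2) by (rule level3_sextic_model[OF \<theta>(1)])
  show ?thesis
  proof (intro exI conjI)
    show "subgroup (level3_group \<theta>) (O_plus gram D)" unfolding \<theta>(2) by (rule subgroup_level3[OF \<theta>(1)])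
    show "finite (rcosets\<^bsub>O_plus gram D\<^esub> (level3_group \<theta>))" unfolding \<theta>(2) by (rule finite_index_level3[OF \<theta>(1)])
    show "noncanonical_singularity TYPE('n) (modular_variety D (level3_group \<theta>))
        ((\<lambda>g. lattice_act g (line_through (tube \<theta> (0 :: complex ^ 'n)))) ` level3_group \<theta>)"
      by (rule center_noncanonical_singularity[OF n])
    show "cyclic_quotient_singularity (modular_variety D (level3_group \<theta>))
        ((\<lambda>g. lattice_act g (line_through (tube \<theta> (0 :: complex ^ 'n)))) ` level3_group \<theta>) 6 (\<lambda>_ :: 'n. 1)"
      by (rule center_cyclic_quotient_singularity)
  qed
qed

lemma gram_witness:
  assumes "2 \<le> CARD('n::finite)" "CARD('n) \<le> 5"
  shows "\<exists>G :: int ^ ('n + 2) ^ ('n + 2).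
    integral_lattice G \<and> has_signature G (2, CARD('n)) \<and> period_domains G \<noteq> {} \<and>
    (\<forall>D \<in> period_domains G. \<exists>\<Gamma>.
       subgroup \<Gamma> (O_plus G D) \<and> finite (rcosets\<^bsub>O_plus G D\<^esub> \<Gamma>) \<and>
       (\<exists>x. noncanonical_singularity TYPE('n) (modular_variety D \<Gamma>) x \<and>
            cyclic_quotient_singularity (modular_variety D \<Gamma>) x 6 (\<lambda>_ :: 'n. 1)))"
  using integral_lattice_gram has_signature_gram period_domains_gram_nonempty gram_modular_variety[OF assms]
  by (intro exI[of _ gram] conjI ballI) auto

theorem mainTheorem4:
  shows
    "(2 \<le> CARD('n::finite) \<and> CARD('n) \<le> 5 \<longrightarrow>
       (\<exists>G :: int ^ ('n + 2) ^ ('n + 2).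
          integral_lattice G \<and> has_signature G (2, CARD('n)) \<and> period_domains G \<noteq> {} \<and>
          (\<forall>D \<in> period_domains G. \<exists>\<Gamma>.
             subgroup \<Gamma> (O_plus G D) \<and> finite (rcosets\<^bsub>O_plus G D\<^esub> \<Gamma>) \<and>
             (\<exists>x. noncanonical_singularity TYPE('n) (modular_variety D \<Gamma>) x \<and>
                  cyclic_quotient_singularity (modular_variety D \<Gamma>) x 6 (\<lambda>_ :: 'n. 1)))))
     \<and> (\<exists>G :: int ^ (5 + 2) ^ (5 + 2).
          integral_lattice G \<and> has_signature G (2, 5) \<and> period_domains G \<noteq> {} \<and>
          (\<forall>D \<in> period_domains G. \<exists>\<Gamma>.
             subgroup \<Gamma> (O_plus G D) \<and> finite (rcosets\<^bsub>O_plus G D\<^esub> \<Gamma>) \<and>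
             (\<exists>x. noncanonical_singularity TYPE(5) (modular_variety D \<Gamma>) x \<and>
                  cyclic_quotient_singularity (modular_variety D \<Gamma>) x 6 (\<lambda>_ :: 5. 1))))"
proof
  show "2 \<le> CARD('n) \<and> CARD('n) \<le> 5 \<longrightarrow>
       (\<exists>G :: int ^ ('n + 2) ^ ('n + 2).
          integral_lattice G \<and> has_signature G (2, CARD('n)) \<and> period_domains G \<noteq> {} \<and>
          (\<forall>D \<in> period_domains G. \<exists>\<Gamma>.
             subgroup \<Gamma> (O_plus G D) \<and> finite (rcosets\<^bsub>O_plus G D\<^esub> \<Gamma>) \<and>
             (\<exists>x. noncanonical_singularity TYPE('n) (modular_variety D \<Gamma>) x \<and>
                  cyclic_quotient_singularity (modular_variety D \<Gamma>) x 6 (\<lambda>_ :: 'n. 1))))"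
    by (elim conjE | rule impI gram_witness)+
  show "\<exists>G :: int ^ (5 + 2) ^ (5 + 2).
          integral_lattice G \<and> has_signature G (2, 5) \<and> period_domains G \<noteq> {} \<and>
          (\<forall>D \<in> period_domains G. \<exists>\<Gamma>.
             subgroup \<Gamma> (O_plus G D) \<and> finite (rcosets\<^bsub>O_plus G D\<^esub> \<Gamma>) \<and>
             (\<exists>x. noncanonical_singularity TYPE(5) (modular_variety D \<Gamma>) x \<and>
                  cyclic_quotient_singularity (modular_variety D \<Gamma>) x 6 (\<lambda>_ :: 5. 1)))"
    using gram_witness[where 'n = 5] by simp
qed

end
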